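(* Let $\nu,\nu_1,\nu_2>0$ with $\nu=\nu_1+\nu_2$, and let $q_1,q_2\ge2$ be integers. For every $k\ge1$ let $f_k\in L^2(T^{q_1})$ and $h_k\in L^2(T^{q_2})$ be symmetric, and let $Z_k=X_k+Y_k$ with $X_k=I_{q_1}(f_k)$, $Y_k=I_{q_2}(h_k)$, be such that $X_k$ and $Y_k$ are independent for every $k\ge1$ and, as $k\to+\infty$, $$\mathbf{E}(Z_k^2)\to2\nu,\qquad \mathbf{E}(X_k^2)=q_1!\,\|f_k\|^2_{L^2(T^{q_1})}\to2\nu_1,\qquad \mathbf{E}(Y_k^2)=q_2!\,\|h_k\|^2_{L^2(T^{q_2})}\to2\nu_2.$$ Assume that $Z_k\to F(\nu)$ in distribution as $k\to+\infty$. Then $X_k\to F(\nu_1)$ and $Y_k\to F(\nu_2)$ in distribution as $k\to+\infty$.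
   Context: $(W_t)_{t\in T}$ is a classical Wiener process on a time interval $T$ (with Lebesgue measure), defined on a standard Wiener space $(\Omega,\mathcal{F},\mathbf{P})$. For $f\in L^2(T^n)$, $n\ge1$, $I_n(f)$ denotes the multiple Wiener–Itô integral of $f$ with respect to $W$, normalized so that $\mathbf{E}(I_n(f)I_n(g))=n!\langle f,g\rangle_{L^2(T^n)}$ for symmetric $f,g$. The centered Gamma law $F(\nu)$, $\nu>0$, is the law of $2G(\nu/2)-\nu$, where $G(\nu/2)$ has density $\frac{x^{\nu/2-1}e^{-x}}{\Gamma(\nu/2)}\mathbf{1}_{(0,\infty)}(x)$; its characteristic function is $\lambda\mapsto\left(\frac{e^{-i\lambda}}{\sqrt{1-2i\lambda}}\right)^{\nu}$. *)

theory Defs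
  imports "HOL-Probability.Probability"
begin

locale wiener_process = prob_space M
  for M :: "'w measure" +
  fixes T :: "real set" and W :: "real \<Rightarrow> 'w \<Rightarrow> real"
  assumes interval: "is_interval T" "0 \<in> T" "T \<subseteq> {0..}"
    and measurable_W: "\<And>t. t \<in> T \<Longrightarrow> random_variable borel (W t)"
    and starts_at_0: "AE \<omega> in M. W 0 \<omega> = 0"
    and indep_increments:
      "\<And>m t. strict_mono_on {..m} t \<Longrightarrow> t ` {..m} \<subseteq> T \<Longrightarrow>
         indep_vars (\<lambda>_. borel) (\<lambda>i \<omega>. W (t (Suc i)) \<omega> - W (t i) \<omega>) {..<m::nat}"
    and normal_increments:
      "\<And>s t. s \<in> T \<Longrightarrow> t \<in> T \<Longrightarrow> s < t \<Longrightarrow>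
         distributed M lborel (\<lambda>\<omega>. W t \<omega> - W s \<omega>) (\<lambda>x. ennreal (normal_density 0 (sqrt (t - s)) x))"
    and continuous_paths: "AE \<omega> in M. continuous_on T (\<lambda>t. W t \<omega>)"

definition square_integrable :: "'a measure \<Rightarrow> ('a \<Rightarrow> real) \<Rightarrow> bool" where
  "square_integrable M f \<longleftrightarrow> f \<in> borel_measurable M \<and> integrable M (\<lambda>x. (f x)\<^sup>2)"

definition tendsto_L2 :: "'a measure \<Rightarrow> (nat \<Rightarrow> 'a \<Rightarrow> real) \<Rightarrow> ('a \<Rightarrow> real) \<Rightarrow> bool" where
  "tendsto_L2 M g f \<longleftrightarrow> (\<lambda>k. \<integral>\<^sup>+x. ennreal ((g k x - f x)\<^sup>2) \<partial>M) \<longlonglongrightarrow> 0"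

text \<open>A point of $T^n$ is an extensional function on \<open>{..<n}\<close> with values in \<open>T\<close>.\<close>

definition time_power :: "real set \<Rightarrow> nat \<Rightarrow> (nat \<Rightarrow> real) measure" where
  "time_power T n = PiM {..<n} (\<lambda>_. restrict_space lborel T)"

text \<open>Kernels represent elements of $L^2(T^n)$, so symmetry is required only almost everywhere.\<close>

definition symmetric_kernel :: "real set \<Rightarrow> nat \<Rightarrow> ((nat \<Rightarrow> real) \<Rightarrow> real) \<Rightarrow> bool" where
  "symmetric_kernel T n f \<longleftrightarrow>
     (\<forall>p. p permutes {..<n} \<longrightarrow> (AE x in time_power T n. f (x \<circ> p) = f x))"

text \<open>
  An elementary kernel is given by points \<open>t 0 < \<dots> < t m\<close> of \<open>T\<close> and a coefficient \<open>a i\<close> for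
  every multi-index \<open>i\<close> in $\{0,\dots,m-1\}^n$, where \<open>a i = 0\<close> as soon as two entries of \<open>i\<close>
  coincide, i.e. the kernel vanishes on the diagonals.
\<close>

definition elementary_data ::
    "real set \<Rightarrow> nat \<Rightarrow> nat \<Rightarrow> (nat \<Rightarrow> real) \<Rightarrow> ((nat \<Rightarrow> nat) \<Rightarrow> real) \<Rightarrow> bool" where
  "elementary_data T n m t a \<longleftrightarrow>
     strict_mono_on {..m} t \<and> t ` {..m} \<subseteq> T \<and>
     (\<forall>i \<in> {..<n} \<rightarrow>\<^sub>E {..<m}. \<not> inj_on i {..<n} \<longrightarrow> a i = 0)"

definition elementary_kernel ::
    "nat \<Rightarrow> nat \<Rightarrow> (nat \<Rightarrow> real) \<Rightarrow> ((nat \<Rightarrow> nat) \<Rightarrow> real) \<Rightarrow> (nat \<Rightarrow> real) \<Rightarrow> real" where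
  "elementary_kernel n m t a x =
     (\<Sum>i \<in> {..<n} \<rightarrow>\<^sub>E {..<m}. a i * (\<Prod>j<n. indicator {t (i j)<..t (Suc (i j))} (x j)))"

definition elementary_integral ::
    "(real \<Rightarrow> 'w \<Rightarrow> real) \<Rightarrow> nat \<Rightarrow> nat \<Rightarrow> (nat \<Rightarrow> real) \<Rightarrow> ((nat \<Rightarrow> nat) \<Rightarrow> real) \<Rightarrow> 'w \<Rightarrow> real" where
  "elementary_integral W n m t a \<omega> =
     (\<Sum>i \<in> {..<n} \<rightarrow>\<^sub>E {..<m}. a i * (\<Prod>j<n. W (t (Suc (i j))) \<omega> - W (t (i j)) \<omega>))"

text \<open>
  It\^o's construction: $I_n$ is the continuous extension to $L^2(T^n)$ of the integral of
  elementary kernels. It is stated as a relation, \<open>X\<close> being a version of $I_n(f)$, since $I_n(f)$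
  is determined only up to almost sure equality. The normalization is
  $\mathbf{E}(I_n(f) I_n(g)) = n! \langle f, g\rangle$ for symmetric $f, g$.
\<close>

definition has_wiener_ito_integral ::
    "'w measure \<Rightarrow> real set \<Rightarrow> (real \<Rightarrow> 'w \<Rightarrow> real) \<Rightarrow> nat \<Rightarrow>
     ((nat \<Rightarrow> real) \<Rightarrow> real) \<Rightarrow> ('w \<Rightarrow> real) \<Rightarrow> bool" where
  "has_wiener_ito_integral M T W n f X \<longleftrightarrow>
     square_integrable (time_power T n) f \<and> square_integrable M X \<and>
     (\<exists>m t a. (\<forall>k. elementary_data T n (m k) (t k) (a k)) \<and>
        tendsto_L2 (time_power T n) (\<lambda>k. elementary_kernel n (m k) (t k) (a k)) f \<and>
        tendsto_L2 M (\<lambda>k. elementary_integral W n (m k) (t k) (a k)) X)"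

definition gamma_density :: "real \<Rightarrow> real \<Rightarrow> real" where
  "gamma_density a x = (if x > 0 then x powr (a - 1) * exp (- x) / Gamma a else 0)"

definition centered_gamma :: "real \<Rightarrow> real measure" where
  "centered_gamma \<nu> =
     distr (density lborel (\<lambda>x. ennreal (gamma_density (\<nu> / 2) x))) borel (\<lambda>x. 2 * x - \<nu>)"

definition converges_in_law :: "'w measure \<Rightarrow> (nat \<Rightarrow> 'w \<Rightarrow> real) \<Rightarrow> real measure \<Rightarrow> bool" where
  "converges_in_law M X L \<longleftrightarrow> weak_conv_m (\<lambda>k. distr M borel (X k)) L"

end

theory Submission
  imports Defs
begin

text \<open>
  Write $\delta_\nu(X) = \frac13 E X^4 - 4 E X^3 + (8 - 4\nu) E X^2 + 4\nu^2$; this is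
  \<open>gamma_defect\<close>. The theorem rests on three facts about a variable $X$ in the $q$-th Wiener
  chaos, $q \ge 1$: $X$ is centered, $\delta_\nu(X) \ge 0$ for every real $\nu$, and the law of $X$ is
  close to $F(\nu)$ when $\delta_\nu(X)$ is small. If $X$ and $Y$ are independent and centered, then
  $E(X+Y)^3 = E X^3 + E Y^3$ and $E(X+Y)^4 = E X^4 + 6\,E X^2\,E Y^2 + E Y^4$. Along the given sequences
  the third and fourth moments of $Z_k$ converge to those of $F(\nu)$, and a computation shows that
  $\delta_{\nu_1}(X_k) + \delta_{\nu_2}(Y_k)$ tends to $0$. Both terms are nonnegative, hence both tend
  to $0$, and both limits in law follow.

  Why \<open>\<delta>\<close> is nonnegative (\<open>multilin_gamma_estimate\<close>). By approximation
  it suffices to consider $X = P(\xi)$ for a homogeneous multilinear polynomial $P$ of degree $q$ in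
  independent standard normal variables. Let $L$ be the Ornstein-Uhlenbeck generator and
  $\Gamma = |\nabla P|^2$. With $Q = X^2 - 4X - 2\nu$ and $U = \Gamma - 2qX - 2q\nu$ one has
  $U = \frac12 (L + 2q) Q$. Since $Q$ has degree at most $2q$, the eigenvalues of $L + 2q$ involved lie
  in $[0, 2q]$, so that $E U^2 \le q\,E(QU)$; integration by parts gives $E(QU) = q\,\delta_\nu(X)$. This
  replaces the product formula and the contraction norms by a spectral argument.

  Why a small \<open>\<delta>\<close> forces the Gamma limit. Integration by parts gives
  $(1 - 2iu)\,E(X e^{iuX}) - 2iu\nu\,E(e^{iuX}) = \frac{iu}{q} E(U e^{iuX})$, whose modulus is at most
  $|u| \sqrt{\delta_\nu(X)}$. For $F(\nu)$ the left-hand side vanishes. It is a linear differential equation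
  for the characteristic function, and \<open>char_gamma_bound\<close> is its stability estimate.

  Two limit passages remain. Hypercontractivity (\<open>multilin_hypercontractive\<close>) bounds sixth
  moments by second moments; it carries the estimates above from elementary integrals to their
  $L^2$ limits (\<open>wiener_ito_integral_estimates\<close>) and, by \<open>weak_conv_moments\<close>, yields the
  convergence of the third and fourth moments of $Z_k$.
\<close>

section \<open>Random variables with finite moments of all orders\<close>

lemma abs_power_le_one_plus_even_power:
  fixes x :: real
  assumes "n \<le> m" "even m" shows "\<bar>x\<bar> ^ n \<le> 1 + x ^ m"
proof (cases "\<bar>x\<bar> \<le> 1")
  case True
  then have "\<bar>x\<bar> ^ n \<le> 1" by (intro power_le_one) auto
  moreover have "0 \<le> x ^ m" using assms(2) by (rule zero_le_even_power)
  ultimately show ?thesis by linarith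
next
  case False
  then have "\<bar>x\<bar> ^ n \<le> \<bar>x\<bar> ^ m" using assms by (intro power_increasing) auto
  then show ?thesis using assms(2) by (simp add: power_even_abs)
qed

text \<open>A class of random variables closed under the ring operations; it discharges every
integrability obligation about polynomials in Gaussian variables.\<close>

definition all_moments :: "'a measure \<Rightarrow> ('a \<Rightarrow> real) \<Rightarrow> bool" where
  "all_moments M f \<longleftrightarrow> f \<in> borel_measurable M \<and> (\<forall>n. integrable M (\<lambda>x. \<bar>f x\<bar> ^ n))"

lemma all_momentsD [measurable_dest]: "all_moments M f \<Longrightarrow> f \<in> borel_measurable M"
  by (simp add: all_moments_def)

lemma all_moments_integrable_power: "all_moments M f \<Longrightarrow> integrable M (\<lambda>x. f x ^ n)"
  unfolding all_moments_def
  by (rule Bochner_Integration.integrable_bound[where f = "\<lambda>x. \<bar>f x\<bar> ^ n"]) (auto simp: power_abs)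

lemma all_moments_integrable: "all_moments M f \<Longrightarrow> integrable M f"
  using all_moments_integrable_power[of M f 1] by simp

lemma all_moments_const: "finite_measure M \<Longrightarrow> all_moments M (\<lambda>x. c)"
  unfolding all_moments_def by (auto intro: finite_measure.integrable_const)

lemma all_moments_mult:
  assumes f: "all_moments M f" and g: "all_moments M g"
  shows "all_moments M (\<lambda>x. f x * g x)"
  unfolding all_moments_def
proof safe
  fix n
  note [measurable] = f g
  show "(\<lambda>x. f x * g x) \<in> borel_measurable M" by measurable
  show "integrable M (\<lambda>x. \<bar>f x * g x\<bar> ^ n)"
  proof (rule Bochner_Integration.integrable_bound)
    show "integrable M (\<lambda>x. \<bar>f x\<bar> ^ (n*2) + \<bar>g x\<bar> ^ (n*2))"
      using f g by (auto simp: all_moments_def)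
    show "(\<lambda>x. \<bar>f x * g x\<bar> ^ n) \<in> borel_measurable M" by measurable
    have *: "u * v \<le> u\<^sup>2 + v\<^sup>2" for u v :: real
    proof -
      have "2 * u * v \<le> u\<^sup>2 + v\<^sup>2" by (rule sum_squares_bound)
      moreover have "0 \<le> u\<^sup>2 + v\<^sup>2" by simp
      ultimately show ?thesis by linarith
    qed
    show "AE x in M. norm (\<bar>f x * g x\<bar> ^ n) \<le> norm (\<bar>f x\<bar> ^ (n*2) + \<bar>g x\<bar> ^ (n*2))"
      using *[of "\<bar>f x\<bar>^n" "\<bar>g x\<bar>^n" for x]
      by (intro AE_I2) (auto simp: abs_mult power_mult_distrib power_mult)
  qed
qed

lemma all_moments_add:
  assumes f: "all_moments M f" and g: "all_moments M g"
  shows "all_moments M (\<lambda>x. f x + g x)"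
  unfolding all_moments_def
proof safe
  fix n
  note [measurable] = f g
  show "(\<lambda>x. f x + g x) \<in> borel_measurable M" by measurable
  show "integrable M (\<lambda>x. \<bar>f x + g x\<bar> ^ n)"
  proof (rule Bochner_Integration.integrable_bound)
    show "integrable M (\<lambda>x. 2 ^ n * (\<bar>f x\<bar> ^ n + \<bar>g x\<bar> ^ n))"
      using f g by (auto simp: all_moments_def)
    show "(\<lambda>x. \<bar>f x + g x\<bar> ^ n) \<in> borel_measurable M" by measurable
    have *: "\<bar>u + v\<bar> ^ n \<le> 2 ^ n * (\<bar>u\<bar> ^ n + \<bar>v\<bar> ^ n)" for u v :: real
    proof -
      have "\<bar>u + v\<bar> ^ n \<le> (2 * max \<bar>u\<bar> \<bar>v\<bar>) ^ n"
        by (intro power_mono) auto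
      also have "\<dots> = 2 ^ n * max \<bar>u\<bar> \<bar>v\<bar> ^ n" by (simp add: power_mult_distrib)
      also have "\<dots> \<le> 2 ^ n * (\<bar>u\<bar> ^ n + \<bar>v\<bar> ^ n)"
        by (intro mult_left_mono) (auto simp: max_def)
      finally show ?thesis .
    qed
    show "AE x in M. norm (\<bar>f x + g x\<bar> ^ n) \<le> norm (2 ^ n * (\<bar>f x\<bar> ^ n + \<bar>g x\<bar> ^ n))"
      using * by (intro AE_I2) (auto simp: abs_mult)
  qed
qed

lemma all_moments_cmult:
  assumes "all_moments M f" shows "all_moments M (\<lambda>x. c * f x)"
  using assms unfolding all_moments_def by (auto simp: abs_mult power_mult_distrib)

lemma all_moments_diff:
  assumes "all_moments M f" "all_moments M g" shows "all_moments M (\<lambda>x. f x - g x)"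
  using all_moments_add[OF assms(1) all_moments_cmult[OF assms(2), of "-1"]] by simp

lemma all_moments_power:
  assumes "finite_measure M" "all_moments M f" shows "all_moments M (\<lambda>x. f x ^ n)"
  by (induction n) (auto intro: all_moments_mult all_moments_const assms)

lemma all_moments_sum:
  assumes "finite_measure M" "\<And>i. i \<in> I \<Longrightarrow> all_moments M (f i)"
  shows "all_moments M (\<lambda>x. \<Sum>i\<in>I. f i x)"
  using assms(2) by (induction I rule: infinite_finite_induct)
    (auto intro: all_moments_add all_moments_const assms(1))

lemma all_moments_prod:
  assumes "finite_measure M" "\<And>i. i \<in> I \<Longrightarrow> all_moments M (f i)"
  shows "all_moments M (\<lambda>x. \<Prod>i\<in>I. f i x)"
  using assms(2) by (induction I rule: infinite_finite_induct)
    (auto intro: all_moments_mult all_moments_const assms(1))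

lemmas all_moments_intros =
  all_moments_mult all_moments_add all_moments_diff all_moments_cmult all_moments_power
  all_moments_sum all_moments_prod all_moments_const

section \<open>Integration by parts for the standard normal law\<close>

interpretation std_normal: prob_space std_normal_distribution
  by (rule prob_space_normal_density) simp

lemma finite_measure_std_normal: "finite_measure std_normal_distribution"
  by standard simp

lemma all_moments_std_normal: "all_moments std_normal_distribution (\<lambda>x. x)"
  unfolding all_moments_def
proof safe
  fix n
  have "integrable std_normal_distribution (\<lambda>x. x ^ n)"
    by (rule integrable_std_normal_distribution_moment)
  then show "integrable std_normal_distribution (\<lambda>x. \<bar>x\<bar> ^ n)"
    using integrable_abs[of std_normal_distribution "\<lambda>x. x^n"] by (simp add: power_abs)
qed simp

lemma std_normal_moments:
  "integral\<^sup>L std_normal_distribution (\<lambda>x. x) = 0"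
  "integral\<^sup>L std_normal_distribution (\<lambda>x. x ^ 2) = 1"
  "integral\<^sup>L std_normal_distribution (\<lambda>x. x ^ 3) = 0"
  "integral\<^sup>L std_normal_distribution (\<lambda>x. x ^ 4) = 3"
  "integral\<^sup>L std_normal_distribution (\<lambda>x. x ^ 5) = 0"
  "integral\<^sup>L std_normal_distribution (\<lambda>x. x ^ 6) = 15"
  using std_normal_distribution_even_moments(1)[of 1]
    std_normal_distribution_even_moments(1)[of 2] std_normal_distribution_even_moments(1)[of 3]
    integral_std_normal_distribution_moment_odd[of 1]
    integral_std_normal_distribution_moment_odd[of 3]
    integral_std_normal_distribution_moment_odd[of 5]
  by (simp_all add: fact_numeral)

lemma einterval_UNIV: "einterval (-\<infinity>) \<infinity> = UNIV"
  by (auto simp: einterval_def)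

text \<open>The boundary terms of $\int (G p)'$, where $p$ is the normal density, vanish because of
the polynomial growth of \<open>G\<close>. Growth of degree four covers the powers and exponentials to which
the identity is applied below.\<close>

lemma std_normal_ibp:
  fixes G G' :: "real \<Rightarrow> 'b::euclidean_space"
  assumes G: "\<And>x. (G has_vector_derivative G' x) (at x)"
    and G': "continuous_on UNIV G'"
    and bG: "\<And>x. norm (G x) \<le> C * (1 + x ^ 4)"
    and bG': "\<And>x. norm (G' x) \<le> C * (1 + x ^ 4)"
  shows "(\<integral>y. y *\<^sub>R G y \<partial>std_normal_distribution) = (\<integral>y. G' y \<partial>std_normal_distribution)"
proof -
  let ?p = std_normal_density
  have cG: "continuous_on UNIV G"
    using G by (meson continuous_at_imp_continuous_on has_vector_derivative_continuous)
  have [measurable]: "G \<in> borel_measurable borel" "G' \<in> borel_measurable borel"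
    using cG G' by (auto intro: borel_measurable_continuous_onI)
  have dp: "(?p has_real_derivative (- x * ?p x)) (at x)" for x
    unfolding std_normal_density_def
    by (auto intro!: derivative_eq_intros simp: field_simps power2_eq_square)
  have int0: "integrable std_normal_distribution (\<lambda>x. x ^ n)" for n
    by (rule integrable_std_normal_distribution_moment)
  have int1: "integrable std_normal_distribution (\<lambda>y. y *\<^sub>R G y)"
  proof (rule Bochner_Integration.integrable_bound)
    show "integrable std_normal_distribution (\<lambda>x. C * (\<bar>x\<bar> + \<bar>x\<bar> ^ 5))"
      using all_moments_std_normal unfolding all_moments_def
      by (auto intro!: Bochner_Integration.integrable_add integrable_mult_right 
            dest: spec[of _ 1] spec[of _ 5])
    have "norm (y *\<^sub>R G y) \<le> norm (C * (\<bar>y\<bar> + \<bar>y\<bar> ^ 5))" for y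
    proof -
      have "norm (y *\<^sub>R G y) \<le> \<bar>y\<bar> * (C * (1 + y ^ 4))"
        using bG[of y] by (auto intro: mult_left_mono)
      also have "\<dots> = C * (\<bar>y\<bar> + \<bar>y\<bar> ^ 5)"
        by (simp add: algebra_simps power_abs power_numeral_reduce abs_if)
      finally show ?thesis by (auto)
    qed
    then show "AE y in std_normal_distribution. norm (y *\<^sub>R G y) \<le> norm (C * (\<bar>y\<bar> + \<bar>y\<bar> ^ 5))"
      by simp
  qed simp
  have int2: "integrable std_normal_distribution G'"
  proof (rule Bochner_Integration.integrable_bound)
    show "integrable std_normal_distribution (\<lambda>x. C * (1 + x ^ 4))"
      using int0 std_normal.integrable_const by (auto intro!: Bochner_Integration.integrable_add integrable_mult_right)
    show "AE y in std_normal_distribution. norm (G' y) \<le> norm (C * (1 + y ^ 4))"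
      using bG' by (auto intro: order_trans[OF _ abs_ge_self])
  qed simp
  let ?f = "\<lambda>x. ?p x *\<^sub>R G' x - ?p x *\<^sub>R (x *\<^sub>R G x)"
  have i1: "integrable lborel (\<lambda>x. ?p x *\<^sub>R (x *\<^sub>R G x))"
    using int1 by (subst (asm) integrable_density) auto
  have i2: "integrable lborel (\<lambda>x. ?p x *\<^sub>R G' x)"
    using int2 by (subst (asm) integrable_density) auto
  have lim: "((\<lambda>x. C * (1 + x ^ 4) * ?p x) \<longlongrightarrow> 0) F" if "F = at_top \<or> F = at_bot" for F
    using that unfolding std_normal_density_def
  proof
    assume F: "F = at_top"
    show "((\<lambda>x. C * (1 + x ^ 4) * (1 / sqrt (2 * pi) * exp (- x\<^sup>2 / 2))) \<longlongrightarrow> 0) F"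
      unfolding F by real_asymp
  next
    assume F: "F = at_bot"
    show "((\<lambda>x. C * (1 + x ^ 4) * (1 / sqrt (2 * pi) * exp (- x\<^sup>2 / 2))) \<longlongrightarrow> 0) F"
      unfolding F by real_asymp
  qed
  have limG: "((\<lambda>x. ?p x *\<^sub>R G x) \<longlongrightarrow> 0) F" if "F = at_top \<or> F = at_bot" for F
  proof (rule Lim_null_comparison[OF _ lim[OF that]])
    show "\<forall>\<^sub>F x in F. norm (?p x *\<^sub>R G x) \<le> C * (1 + x ^ 4) * ?p x"
      using bG by (intro always_eventually allI) (simp add: mult.commute[of _ "?p _"] mult_left_mono)
  qed
  have "(LBINT x=-\<infinity>..\<infinity>. ?f x) = 0 - 0"
  proof (rule interval_integral_FTC_integrable[where F = "\<lambda>x. ?p x *\<^sub>R G x"])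
    show "((\<lambda>x. ?p x *\<^sub>R G x) has_vector_derivative ?f x) (at x)" for x
      using dp[of x] G[of x]
      by (auto intro!: derivative_eq_intros simp: algebra_simps)
    have cf: "continuous_on UNIV ?f"
      using cG G' unfolding std_normal_density_def by (intro continuous_intros) auto
    then show "isCont ?f x" for x
      by (simp add: continuous_on_eq_continuous_at)
    show "set_integrable lborel (einterval (-\<infinity>) \<infinity>) ?f"
      using i1 i2 unfolding einterval_UNIV set_integrable_def by simp
    show "(((\<lambda>x. ?p x *\<^sub>R G x) \<circ> real_of_ereal) \<longlongrightarrow> 0) (at_right (-\<infinity>))"
      using limG[of at_bot] by (simp add: ereal_tendsto_simps)
    show "(((\<lambda>x. ?p x *\<^sub>R G x) \<circ> real_of_ereal) \<longlongrightarrow> 0) (at_left \<infinity>)"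
      using limG[of at_top] by (simp add: ereal_tendsto_simps)
  qed simp
  then have "(\<integral>x. ?f x \<partial>lborel) = 0"
    by (simp add: interval_lebesgue_integral_def einterval_UNIV set_lebesgue_integral_def)
  then have "(\<integral>x. ?p x *\<^sub>R G' x \<partial>lborel) = (\<integral>x. ?p x *\<^sub>R (x *\<^sub>R G x) \<partial>lborel)"
    using i1 i2 by (simp add: Bochner_Integration.integral_diff)
  then show ?thesis
    by (subst (1 2) integral_density) auto
qed

section \<open>Hypercontractivity of multilinear Gaussian polynomials\<close>

abbreviation gauss_space :: "'i set \<Rightarrow> ('i \<Rightarrow> real) measure" where
  "gauss_space I \<equiv> PiM I (\<lambda>_. std_normal_distribution)"

interpretation gauss: product_sigma_finite "\<lambda>_ :: 'i. std_normal_distribution"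
  by unfold_locales

lemma prob_space_gauss: "prob_space (gauss_space I)"
  by (rule prob_space_PiM) (rule std_normal.prob_space_axioms)

lemma finite_measure_gauss: "finite_measure (gauss_space I)"
  using prob_space_gauss by (rule prob_space.finite_measure)

lemma all_moments_coordinate:
  assumes "i \<in> I" shows "all_moments (gauss_space I) (\<lambda>x. x i)"
proof -
  have m: "(\<lambda>x. x i) \<in> measurable (gauss_space I) std_normal_distribution"
    using assms by (rule measurable_component_singleton)
  have m': "(\<lambda>x. x i) \<in> borel_measurable (gauss_space I)"
    using m by simp
  have d: "distr (gauss_space I) std_normal_distribution (\<lambda>x. x i) = std_normal_distribution"
    by (rule distr_PiM_component) (auto simp: assms std_normal.prob_space_axioms)
  have "integrable (gauss_space I) (\<lambda>x. \<bar>x i\<bar> ^ n)" for n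
  proof -
    have "integrable (distr (gauss_space I) std_normal_distribution (\<lambda>x. x i)) (\<lambda>y. \<bar>y\<bar> ^ n)"
      unfolding d using all_moments_std_normal by (auto simp: all_moments_def)
    then show ?thesis
      by (subst (asm) integrable_distr_eq) (use m in auto)
  qed
  with m' show ?thesis by (auto simp: all_moments_def)
qed

text \<open>A polynomial of degree at most one in each variable, with its monomials indexed by
their sets of variables. Kernels that vanish on the diagonals produce exactly such polynomials.\<close>

definition multilin :: "'i set \<Rightarrow> ('i set \<Rightarrow> real) \<Rightarrow> ('i \<Rightarrow> real) \<Rightarrow> real" where
  "multilin I c x = (\<Sum>S\<in>Pow I. c S * (\<Prod>i\<in>S. x i))"

lemma all_moments_multilin:
  "J \<subseteq> I \<Longrightarrow> all_moments (gauss_space I) (multilin J c)"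
  unfolding multilin_def
  by (intro all_moments_intros finite_measure_gauss all_moments_coordinate) auto

lemma multilin_insert:
  assumes "finite I" "i \<notin> I"
  shows "multilin (insert i I) c x = multilin I c x + x i * multilin I (\<lambda>S. c (insert i S)) x"
proof -
  have "multilin (insert i I) c x =
      multilin I c x + (\<Sum>S\<in>insert i ` Pow I. c S * (\<Prod>i\<in>S. x i))"
    unfolding multilin_def Pow_insert using assms by (subst sum.union_disjoint) auto
  also have "(\<Sum>S\<in>insert i ` Pow I. c S * (\<Prod>i\<in>S. x i)) =
      (\<Sum>S\<in>Pow I. c (insert i S) * (\<Prod>i\<in>insert i S. x i))"
    using assms by (subst sum.reindex) (auto intro!: inj_onI)
  also have "\<dots> = x i * multilin I (\<lambda>S. c (insert i S)) x"
    unfolding multilin_def sum_distrib_left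
  proof (rule sum.cong[OF refl])
    fix S assume "S \<in> Pow I"
    then have "finite S" "i \<notin> S" using assms finite_subset by auto
    then show "c (insert i S) * (\<Prod>i\<in>insert i S. x i) = x i * (c (insert i S) * (\<Prod>i\<in>S. x i))"
      by simp
  qed
  finally show ?thesis .
qed

lemma multilin_update: "i \<notin> I \<Longrightarrow> multilin I c (x(i := y)) = multilin I c x"
  unfolding multilin_def by (intro sum.cong refl arg_cong2[where f = "(*)"] prod.cong) auto

lemma std_normal_affine_moments:
  "(\<integral>y. (a + y * b) ^ 2 \<partial>std_normal_distribution) = a ^ 2 + b ^ 2"
  "(\<integral>y. (a + y * b) ^ 6 \<partial>std_normal_distribution) =
     a ^ 6 + 15 * (a ^ 4 * b ^ 2) + 45 * (a ^ 2 * b ^ 4) + 15 * b ^ 6"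
proof -
  have i1: "integrable std_normal_distribution (\<lambda>x. x)"
    using integrable_std_normal_distribution_moment[of 1] by simp
  have e2: "(a + y * b) ^ 2 = a ^ 2 + (2 * a * b) * y + b ^ 2 * y ^ 2" for y
    by algebra
  have e6: "(a + y * b) ^ 6 = a ^ 6 + (6 * a ^ 5 * b) * y + (15 * a ^ 4 * b ^ 2) * y ^ 2 +
      (20 * a ^ 3 * b ^ 3) * y ^ 3 + (15 * a ^ 2 * b ^ 4) * y ^ 4 + (6 * a * b ^ 5) * y ^ 5 +
      b ^ 6 * y ^ 6" for y
    by algebra
  note * = i1 integrable_std_normal_distribution_moment std_normal.integrable_const
  show "(\<integral>y. (a + y * b) ^ 2 \<partial>std_normal_distribution) = a ^ 2 + b ^ 2"
    unfolding e2 by (simp add: * std_normal_moments std_normal.prob_space[simplified])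
  show "(\<integral>y. (a + y * b) ^ 6 \<partial>std_normal_distribution) =
     a ^ 6 + 15 * (a ^ 4 * b ^ 2) + 45 * (a ^ 2 * b ^ 4) + 15 * b ^ 6"
    unfolding e6 by (simp add: * std_normal_moments std_normal.prob_space[simplified])
qed

lemma young_2_1: "3 * (p\<^sup>2 * r) \<le> 2 * p ^ 3 + r ^ 3" if "0 \<le> p" "0 \<le> r" for p r :: real
proof -
  have "2 * p ^ 3 + r ^ 3 - 3 * (p\<^sup>2 * r) = (p - r)\<^sup>2 * (2 * p + r)" by algebra
  moreover have "0 \<le> (p - r)\<^sup>2 * (2 * p + r)" using that by simp
  ultimately show ?thesis by linarith
qed

text \<open>The constant is that of the general bound
$\|P\|_6 \le \sqrt5^{\,d} \|P\|_2$. Splitting off one variable, $P = A + yB$ where $B$ has degree at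
most $d - 1$, gives $E P^6 = E A^6 + 15\,E A^4 B^2 + 45\,E A^2 B^4 + 15\,E B^6$, and every term is bounded by the
corresponding one in $125^d (a + b)^3$, where $a$ and $b$ are the second moments of $A$ and $B$. The
strict upper bound \<open>s\<close> in place of the second moment leaves room to choose $a$ and $b$ positive, so
that Young's inequality can be applied with weights $1/a$ and $1/b$.\<close>

theorem multilin_hypercontractive:
  assumes "finite I" and "\<And>S. S \<subseteq> I \<Longrightarrow> d < card S \<Longrightarrow> c S = 0"
    and "(\<integral>x. (multilin I c x) ^ 2 \<partial>gauss_space I) < s"
  shows "(\<integral>x. (multilin I c x) ^ 6 \<partial>gauss_space I) \<le> 125 ^ d * s ^ 3"
  using assms
proof (induction I arbitrary: c d s rule: finite_induct)
  case empty
  interpret prob_space "gauss_space {} :: ('a \<Rightarrow> real) measure" by (rule prob_space_gauss)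
  have m: "multilin {} c x = c {}" for x by (simp add: multilin_def)
  have "c {} ^ 2 < s" using empty by (simp add: m prob_space)
  then have "(c {} ^ 2) ^ 3 \<le> s ^ 3" by (intro power_mono) auto
  moreover have "0 \<le> s ^ 3" using \<open>c {} ^ 2 < s\<close> by (smt (verit) zero_le_power zero_le_power2)
  then have "1 * s ^ 3 \<le> 125 ^ d * s ^ 3" by (intro mult_right_mono) auto
  ultimately show ?case by (simp add: m prob_space flip: power_mult)
next
  case (insert i I)
  let ?G = "gauss_space I" and ?G' = "gauss_space (insert i I)"
  define A where "A = multilin I c"
  define B where "B = multilin I (\<lambda>S. c (insert i S))"
  have P: "multilin (insert i I) c x = A x + x i * B x" for x
    unfolding A_def B_def using insert.hyps by (rule multilin_insert)
  have upd: "A (x(i := y)) = A x" "B (x(i := y)) = B x" for x y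
    unfolding A_def B_def using insert.hyps by (simp_all add: multilin_update)
  have mA: "all_moments ?G A" and mB: "all_moments ?G B"
    unfolding A_def B_def by (simp_all add: all_moments_multilin)
  have mAB: "all_moments ?G (\<lambda>x. A x ^ k * B x ^ l)" for k l
    using mA mB by (intro all_moments_intros finite_measure_gauss)
  note int = all_moments_integrable[OF mAB] all_moments_integrable_power[OF mA]
    all_moments_integrable_power[OF mB]
  have fubini: "(\<integral>x. (multilin (insert i I) c x) ^ n \<partial>?G') =
      (\<integral>x. (\<integral>y. (A x + y * B x) ^ n \<partial>std_normal_distribution) \<partial>?G)" for n
  proof (subst gauss.product_integral_insert)
    show "integrable ?G' (\<lambda>x. (multilin (insert i I) c x) ^ n)"
      by (intro all_moments_integrable_power all_moments_multilin order_refl)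
  qed (use insert.hyps in \<open>simp_all add: P upd\<close>)
  have second: "(\<integral>x. (multilin (insert i I) c x) ^ 2 \<partial>?G') =
      (\<integral>x. A x ^ 2 \<partial>?G) + (\<integral>x. B x ^ 2 \<partial>?G)"
    unfolding fubini std_normal_affine_moments using int by simp
  have sixth: "(\<integral>x. (multilin (insert i I) c x) ^ 6 \<partial>?G') =
      (\<integral>x. A x ^ 6 \<partial>?G) + 15 * (\<integral>x. A x ^ 4 * B x ^ 2 \<partial>?G) +
      45 * (\<integral>x. A x ^ 2 * B x ^ 4 \<partial>?G) + 15 * (\<integral>x. B x ^ 6 \<partial>?G)"
    unfolding fubini std_normal_affine_moments using int by simp
  have cA: "c S = 0" if "S \<subseteq> I" "d < card S" for S
    using that insert.prems(1)[of S] by auto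
  have cB: "c (insert i S) = 0" if "S \<subseteq> I" "d \<le> card S" for S
  proof (rule insert.prems(1))
    have "finite S" "i \<notin> S" using that insert.hyps finite_subset by auto
    then show "d < card (insert i S)" using that by simp
  qed (use that in auto)
  show ?case
  proof (cases d)
    \<comment> \<open>A polynomial of degree 0 has no part containing the new variable.\<close>
    case 0
    then have B0: "B x = 0" for x
      unfolding B_def multilin_def by (intro sum.neutral) (auto simp: cB)
    have "(\<integral>x. A x ^ 6 \<partial>?G) \<le> 125 ^ d * s ^ 3"
      unfolding A_def using cA insert.prems(2)[unfolded second B0]
      by (intro insert.IH) (auto simp: A_def)
    then show ?thesis unfolding sixth B0 by simp
  next
    case (Suc e)
    \<comment> \<open>The slack is divided equally, so that \<open>a + b = s\<close> and both bounds are strict.\<close>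
    define \<delta> where "\<delta> = (s - (\<integral>x. (multilin (insert i I) c x) ^ 2 \<partial>?G')) / 2"
    define a where "a = (\<integral>x. A x ^ 2 \<partial>?G) + \<delta>"
    define b where "b = (\<integral>x. B x ^ 2 \<partial>?G) + \<delta>"
    have \<delta>: "\<delta> > 0" using insert.prems(2) by (simp add: \<delta>_def)
    have "0 \<le> (\<integral>x. A x ^ 2 \<partial>?G)" "0 \<le> (\<integral>x. B x ^ 2 \<partial>?G)" by simp_all
    then have a: "a > 0" and b: "b > 0" using \<delta> unfolding a_def b_def by linarith+
    have ab: "s = a + b" by (simp add: a_def b_def \<delta>_def second field_simps)
    define K where "K = (125 :: real) ^ d"
    have K: "K > 0" "(125::real) ^ e = K / 125" by (simp_all add: K_def Suc)
    have A6: "(\<integral>x. A x ^ 6 \<partial>?G) \<le> K * a ^ 3"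
      unfolding A_def K_def using cA \<delta> by (intro insert.IH) (auto simp: A_def a_def)
    have B6: "(\<integral>x. B x ^ 6 \<partial>?G) \<le> K / 125 * b ^ 3"
      unfolding B_def K(2)[symmetric] using cB \<delta> Suc
      by (intro insert.IH) (auto simp: B_def b_def)
    \<comment> \<open>Young's inequality for \<open>A\<^sup>2 b\<close> and \<open>5 B\<^sup>2 a\<close>; the factor 5 is the cube root of 125.\<close>
    have p1: "15 * a * b ^ 2 * (A x ^ 4 * B x ^ 2) \<le> 2 * b ^ 3 * A x ^ 6 + 125 * a ^ 3 * B x ^ 6"
      for x
      using young_2_1[of "A x ^ 2 * b" "5 * B x ^ 2 * a"] a b
      by (simp add: algebra_simps flip: power_mult)
    have p2: "75 * a ^ 2 * b * (A x ^ 2 * B x ^ 4) \<le> b ^ 3 * A x ^ 6 + 250 * a ^ 3 * B x ^ 6" for x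
      using young_2_1[of "5 * B x ^ 2 * a" "A x ^ 2 * b"] a b
      by (simp add: algebra_simps flip: power_mult)
    have "(\<integral>x. 15 * a * b ^ 2 * (A x ^ 4 * B x ^ 2) \<partial>?G) \<le>
        (\<integral>x. 2 * b ^ 3 * A x ^ 6 + 125 * a ^ 3 * B x ^ 6 \<partial>?G)"
      using int by (intro integral_mono p1) auto
    then have "15 * a * b ^ 2 * (\<integral>x. A x ^ 4 * B x ^ 2 \<partial>?G) \<le>
        2 * b ^ 3 * (\<integral>x. A x ^ 6 \<partial>?G) + 125 * a ^ 3 * (\<integral>x. B x ^ 6 \<partial>?G)"
      using int by simp
    also have "\<dots> \<le> 2 * b ^ 3 * (K * a ^ 3) + 125 * a ^ 3 * (K / 125 * b ^ 3)"
      using A6 B6 a b by (intro add_mono mult_left_mono) auto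
    also have "\<dots> = 15 * a * b ^ 2 * (K * (a\<^sup>2 * b) / 5)"
      by (simp add: field_simps power_numeral_reduce)
    finally have AB1: "(\<integral>x. A x ^ 4 * B x ^ 2 \<partial>?G) \<le> K * (a\<^sup>2 * b) / 5"
      using a b by (subst (asm) mult_le_cancel_left_pos) auto
    have "(\<integral>x. 75 * a ^ 2 * b * (A x ^ 2 * B x ^ 4) \<partial>?G) \<le>
        (\<integral>x. b ^ 3 * A x ^ 6 + 250 * a ^ 3 * B x ^ 6 \<partial>?G)"
      using int by (intro integral_mono p2) auto
    then have "75 * a ^ 2 * b * (\<integral>x. A x ^ 2 * B x ^ 4 \<partial>?G) \<le>
        b ^ 3 * (\<integral>x. A x ^ 6 \<partial>?G) + 250 * a ^ 3 * (\<integral>x. B x ^ 6 \<partial>?G)"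
      using int by simp
    also have "\<dots> \<le> b ^ 3 * (K * a ^ 3) + 250 * a ^ 3 * (K / 125 * b ^ 3)"
      using A6 B6 a b by (intro add_mono mult_left_mono) auto
    also have "\<dots> = 75 * a ^ 2 * b * (K * (a * b\<^sup>2) / 25)"
      by (simp add: field_simps power_numeral_reduce)
    finally have AB2: "(\<integral>x. A x ^ 2 * B x ^ 4 \<partial>?G) \<le> K * (a * b\<^sup>2) / 25"
      using a b by (subst (asm) mult_le_cancel_left_pos) auto
    have "(\<integral>x. (multilin (insert i I) c x) ^ 6 \<partial>?G') \<le>
        K * a ^ 3 + 15 * (K * (a\<^sup>2 * b) / 5) + 45 * (K * (a * b\<^sup>2) / 25) + 15 * (K / 125 * b ^ 3)"
      unfolding sixth using A6 B6 AB1 AB2 by (intro add_mono mult_left_mono) auto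
    also have "\<dots> = K * (a ^ 3 + 3 * a\<^sup>2 * b + 9 / 5 * a * b\<^sup>2 + 3 / 25 * b ^ 3)"
      by (simp add: field_simps)
    also have "\<dots> \<le> K * (a ^ 3 + 3 * a\<^sup>2 * b + 3 * a * b\<^sup>2 + b ^ 3)"
      using K a b by (intro mult_left_mono add_mono mult_right_mono) auto
    also have "\<dots> = K * (a + b) ^ 3"
      by (simp add: power3_eq_cube power2_eq_square algebra_simps)
    finally show ?thesis by (simp add: K_def ab)
  qed
qed

section \<open>Gradient and integration by parts in a Gaussian chaos\<close>

lemma power4_sum_le: "(a + b) ^ 4 \<le> 8 * (a ^ 4 + b ^ 4)" for a b :: real
proof -
  have sq: "(u + v)\<^sup>2 \<le> 2 * (u\<^sup>2 + v\<^sup>2)" for u v :: real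
    using sum_squares_bound[of u v] by (simp add: power2_sum)
  have "((a + b)\<^sup>2)\<^sup>2 \<le> (2 * (a\<^sup>2 + b\<^sup>2))\<^sup>2" by (intro power_mono sq) auto
  also have "\<dots> = 4 * (a\<^sup>2 + b\<^sup>2)\<^sup>2" by (simp only: power_mult_distrib) simp
  also have "\<dots> \<le> 4 * (2 * ((a\<^sup>2)\<^sup>2 + (b\<^sup>2)\<^sup>2))" by (intro mult_left_mono sq) auto
  finally show ?thesis by (simp flip: power_mult)
qed

text \<open>For fixed values of the other coordinates this is the one-dimensional identity for
$y \mapsto F(a + yb)$; Fubini's theorem does the rest.\<close>

lemma gauss_ibp:
  fixes F F' :: "real \<Rightarrow> 'b::euclidean_space"
  assumes I: "finite I" "i \<in> I"
    and A: "all_moments (gauss_space I) A" "\<And>x y. A (x(i := y)) = A x"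
    and B: "all_moments (gauss_space I) B" "\<And>x y. B (x(i := y)) = B x"
    and F: "\<And>x. (F has_vector_derivative F' x) (at x)"
    and F': "continuous_on UNIV F'"
    and bF: "\<And>x. norm (F x) \<le> C * (1 + x ^ 4)"
    and bF': "\<And>x. norm (F' x) \<le> C * (1 + x ^ 4)"
  shows "(\<integral>x. (x i * B x) *\<^sub>R F (A x + x i * B x) \<partial>gauss_space I) =
         (\<integral>x. (B x)\<^sup>2 *\<^sub>R F' (A x + x i * B x) \<partial>gauss_space I)"
proof -
  define J where "J = I - {i}"
  have J: "finite J" "i \<notin> J" "I = insert i J" using I by (auto simp: J_def)
  have cF: "continuous_on UNIV F"
    using F by (meson continuous_at_imp_continuous_on has_vector_derivative_continuous)
  have mF [measurable]: "F \<in> borel_measurable borel" "F' \<in> borel_measurable borel"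
    using cF F' by (auto intro: borel_measurable_continuous_onI)
  have "0 \<le> norm (F 0)" by simp
  also have "\<dots> \<le> C" using bF[of 0] by simp
  finally have C: "0 \<le> C" .
  have mX: "all_moments (gauss_space I) (\<lambda>x. x i)" using I by (intro all_moments_coordinate)
  note [measurable] = A(1) B(1) mX
  have mP: "all_moments (gauss_space I) (\<lambda>x. C * (1 + (A x + x i * B x) ^ 4))"
    using A B mX by (intro all_moments_intros finite_measure_gauss)
  have int: "integrable (gauss_space I) (\<lambda>x. g x *\<^sub>R H (A x + x i * B x))"
    if g: "all_moments (gauss_space I) g" and [measurable]: "H \<in> borel_measurable borel"
      and H: "\<And>x. norm (H x) \<le> C * (1 + x ^ 4)" for g and H :: "real \<Rightarrow> 'b"
  proof (rule Bochner_Integration.integrable_bound)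
    note [measurable] = g
    show "integrable (gauss_space I) (\<lambda>x. g x * (C * (1 + (A x + x i * B x) ^ 4)))"
      using all_moments_mult[OF g mP] by (rule all_moments_integrable)
    show "(\<lambda>x. g x *\<^sub>R H (A x + x i * B x)) \<in> borel_measurable (gauss_space I)"
      by measurable
    show "AE x in gauss_space I. norm (g x *\<^sub>R H (A x + x i * B x)) \<le>
        norm (g x * (C * (1 + (A x + x i * B x) ^ 4)))"
      using H C by (intro AE_I2) (auto simp: abs_mult intro!: mult_left_mono)
  qed
  have inner: "(\<integral>y. (y * b) *\<^sub>R F (a + y * b) \<partial>std_normal_distribution) =
      (\<integral>y. b\<^sup>2 *\<^sub>R F' (a + y * b) \<partial>std_normal_distribution)" for a b
  proof -
    define D where "D = (1 + \<bar>b\<bar>) * (C * (8 * (1 + a ^ 4 + b ^ 4)))"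
    have bound: "C * (1 + (a + y * b) ^ 4) \<le> C * (8 * (1 + a ^ 4 + b ^ 4)) * (1 + y ^ 4)" for y
    proof -
      have "(a + y * b) ^ 4 \<le> 8 * (a ^ 4 + (y * b) ^ 4)" by (rule power4_sum_le)
      moreover have "0 \<le> a ^ 4" "0 \<le> b ^ 4" "0 \<le> y ^ 4" "0 \<le> a ^ 4 * y ^ 4" by simp_all
      ultimately have "1 + (a + y * b) ^ 4 \<le> 8 * (1 + a ^ 4 + b ^ 4) * (1 + y ^ 4)"
        unfolding power_mult_distrib distrib_left distrib_right mult_1_left mult_1_right
        by (simp only: mult.commute[of "y ^ 4"] mult.assoc)
      then show ?thesis using C by (simp add: mult_left_mono mult.assoc)
    qed
    have "(\<integral>y. y *\<^sub>R F (a + y * b) \<partial>std_normal_distribution) =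
        (\<integral>y. b *\<^sub>R F' (a + y * b) \<partial>std_normal_distribution)"
    proof (rule std_normal_ibp[where C = D])
      show "((\<lambda>y. F (a + y * b)) has_vector_derivative b *\<^sub>R F' (a + y * b)) (at y)" for y
      proof -
        have "((\<lambda>y. a + y * b) has_vector_derivative b) (at y)"
          by (auto intro!: derivative_eq_intros)
        from vector_diff_chain_at[OF this F] show ?thesis by (simp add: o_def)
      qed
      show "continuous_on UNIV (\<lambda>y. b *\<^sub>R F' (a + y * b))"
        by (intro continuous_intros continuous_on_compose2[OF F']) auto
      fix y
      let ?r = "C * (8 * (1 + a ^ 4 + b ^ 4)) * (1 + y ^ 4)"
      have r: "0 \<le> ?r" using C by simp
      have D: "D * (1 + y ^ 4) = (1 + \<bar>b\<bar>) * ?r" by (simp add: D_def mult.assoc)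
      have "norm (F (a + y * b)) \<le> 1 * ?r"
        using order_trans[OF bF bound] by simp
      also have "\<dots> \<le> (1 + \<bar>b\<bar>) * ?r" using r by (intro mult_right_mono) auto
      finally show "norm (F (a + y * b)) \<le> D * (1 + y ^ 4)" unfolding D .
      have "norm (b *\<^sub>R F' (a + y * b)) \<le> \<bar>b\<bar> * ?r"
        using order_trans[OF bF' bound] by (simp add: mult_left_mono)
      also have "\<dots> \<le> (1 + \<bar>b\<bar>) * ?r" using r by (intro mult_right_mono) auto
      finally show "norm (b *\<^sub>R F' (a + y * b)) \<le> D * (1 + y ^ 4)" unfolding D .
    qed
    then have "b *\<^sub>R (\<integral>y. y *\<^sub>R F (a + y * b) \<partial>std_normal_distribution) =
        b *\<^sub>R (\<integral>y. b *\<^sub>R F' (a + y * b) \<partial>std_normal_distribution)" by simp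
    then show ?thesis
      by (simp add: power2_eq_square scaleR_left_commute flip: integral_scaleR_right scaleR_scaleR)
  qed
  have i1: "integrable (gauss_space (insert i J)) (\<lambda>x. (x i * B x) *\<^sub>R F (A x + x i * B x))"
    unfolding J(3)[symmetric] using mX B by (intro int bF mF all_moments_intros)
  have i2: "integrable (gauss_space (insert i J)) (\<lambda>x. (B x)\<^sup>2 *\<^sub>R F' (A x + x i * B x))"
    unfolding J(3)[symmetric] using mX B by (intro int bF' mF all_moments_intros finite_measure_gauss)
  show ?thesis
    unfolding J(3)
    by (subst (1 2) gauss.product_integral_insert) (use J i1 i2 in \<open>simp_all add: A B inner\<close>)
qed

text \<open>The partial derivative of \<open>multilin I c\<close> in the direction \<open>i\<close>.\<close>

definition dmultilin :: "'i set \<Rightarrow> ('i set \<Rightarrow> real) \<Rightarrow> 'i \<Rightarrow> ('i \<Rightarrow> real) \<Rightarrow> real" where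
  "dmultilin I c i x = (\<Sum>S\<in>{S \<in> Pow I. i \<in> S}. c S * (\<Prod>j\<in>S - {i}. x j))"

text \<open>The squared length of the gradient, that is $\Gamma(P, P)$ for the Ornstein-Uhlenbeck
generator.\<close>

definition carre_du_champ :: "'i set \<Rightarrow> ('i set \<Rightarrow> real) \<Rightarrow> ('i \<Rightarrow> real) \<Rightarrow> real" where
  "carre_du_champ I c x = (\<Sum>i\<in>I. (dmultilin I c i x)\<^sup>2)"

lemma all_moments_dmultilin: "all_moments (gauss_space I) (dmultilin I c i)"
  unfolding dmultilin_def
  by (intro all_moments_intros finite_measure_gauss all_moments_coordinate) auto

lemma all_moments_carre: "all_moments (gauss_space I) (carre_du_champ I c)"
  unfolding carre_du_champ_def
  by (intro all_moments_intros finite_measure_gauss all_moments_dmultilin)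

lemma dmultilin_update: "dmultilin I c i (x(i := y)) = dmultilin I c i x"
  unfolding dmultilin_def by (intro sum.cong refl arg_cong2[where f = "(*)"] prod.cong) auto

lemma coordinate_times_dmultilin:
  assumes "finite I"
  shows "x i * dmultilin I c i x = (\<Sum>S\<in>{S \<in> Pow I. i \<in> S}. c S * (\<Prod>j\<in>S. x j))"
  unfolding dmultilin_def sum_distrib_left
proof (rule sum.cong[OF refl])
  fix S assume "S \<in> {S \<in> Pow I. i \<in> S}"
  then have "finite S" "i \<in> S" using assms finite_subset by auto
  then show "x i * (c S * (\<Prod>j\<in>S - {i}. x j)) = c S * (\<Prod>j\<in>S. x j)"
    by (simp add: prod.remove[of S i])
qed

lemma multilin_euler:
  assumes "finite I" and hom: "\<And>S. S \<subseteq> I \<Longrightarrow> card S \<noteq> q \<Longrightarrow> c S = 0"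
  shows "(\<Sum>i\<in>I. x i * dmultilin I c i x) = real q * multilin I c x"
proof -
  have "(\<Sum>i\<in>I. x i * dmultilin I c i x) =
      (\<Sum>i\<in>I. \<Sum>S\<in>Pow I. if i \<in> S then c S * (\<Prod>j\<in>S. x j) else 0)"
    unfolding coordinate_times_dmultilin[OF assms(1)]
    using assms(1) by (intro sum.cong refl sum.inter_filter) simp
  also have "\<dots> = (\<Sum>S\<in>Pow I. \<Sum>i\<in>I. if i \<in> S then c S * (\<Prod>j\<in>S. x j) else 0)"
    by (rule sum.swap)
  also have "\<dots> = (\<Sum>S\<in>Pow I. real q * (c S * (\<Prod>j\<in>S. x j)))"
  proof (rule sum.cong[OF refl])
    fix S assume S: "S \<in> Pow I"
    then have "{i \<in> I. i \<in> S} = S" by auto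
    then have "(\<Sum>i\<in>I. if i \<in> S then c S * (\<Prod>j\<in>S. x j) else 0) =
        real (card S) * (c S * (\<Prod>j\<in>S. x j))"
      using assms(1) by (simp flip: sum.inter_filter)
    also have "\<dots> = real q * (c S * (\<Prod>j\<in>S. x j))"
      using hom[of S] S by (cases "card S = q") auto
    finally show "(\<Sum>i\<in>I. if i \<in> S then c S * (\<Prod>j\<in>S. x j) else 0) =
        real q * (c S * (\<Prod>j\<in>S. x j))" .
  qed
  finally show ?thesis by (simp add: multilin_def sum_distrib_left)
qed

text \<open>Euler's identity writes $qP$ as $\sum_i x_i \partial_i P$, and each $x_i$ can be integrated by
parts because $\partial_i P$ and $P - x_i \partial_i P$ do not depend on $x_i$. In terms of the generator
this is $-E(F(P) L P) = E(F'(P)\,\Gamma(P,P))$.\<close>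

lemma multilin_chaos_ibp:
  fixes F F' :: "real \<Rightarrow> 'b::euclidean_space"
  assumes I: "finite I" and hom: "\<And>S. S \<subseteq> I \<Longrightarrow> card S \<noteq> q \<Longrightarrow> c S = 0"
    and F: "\<And>x. (F has_vector_derivative F' x) (at x)"
    and F': "continuous_on UNIV F'"
    and bF: "\<And>x. norm (F x) \<le> C * (1 + x ^ 4)"
    and bF': "\<And>x. norm (F' x) \<le> C * (1 + x ^ 4)"
  shows "real q *\<^sub>R (\<integral>x. multilin I c x *\<^sub>R F (multilin I c x) \<partial>gauss_space I) =
         (\<integral>x. carre_du_champ I c x *\<^sub>R F' (multilin I c x) \<partial>gauss_space I)"
proof -
  let ?P = "multilin I c" and ?G = "gauss_space I"
  have cF: "continuous_on UNIV F"
    using F by (meson continuous_at_imp_continuous_on has_vector_derivative_continuous)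
  have mF [measurable]: "F \<in> borel_measurable borel" "F' \<in> borel_measurable borel"
    using cF F' by (auto intro: borel_measurable_continuous_onI)
  have "0 \<le> norm (F 0)" by simp
  also have "\<dots> \<le> C" using bF[of 0] by simp
  finally have C: "0 \<le> C" .
  have mP: "all_moments ?G ?P" by (simp add: all_moments_multilin)
  note [measurable] = mP
  have int: "integrable ?G (\<lambda>x. g x *\<^sub>R H (?P x))"
    if g: "all_moments ?G g" and [measurable]: "H \<in> borel_measurable borel"
      and H: "\<And>x. norm (H x) \<le> C * (1 + x ^ 4)" for g and H :: "real \<Rightarrow> 'b"
  proof (rule Bochner_Integration.integrable_bound)
    note [measurable] = g
    show "integrable ?G (\<lambda>x. g x * (C * (1 + ?P x ^ 4)))"
      using mP g by (intro all_moments_integrable all_moments_intros finite_measure_gauss)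
    show "(\<lambda>x. g x *\<^sub>R H (?P x)) \<in> borel_measurable ?G"
      by measurable
    show "AE x in ?G. norm (g x *\<^sub>R H (?P x)) \<le> norm (g x * (C * (1 + ?P x ^ 4)))"
      using H C by (intro AE_I2) (auto simp: abs_mult intro!: mult_left_mono)
  qed
  have each: "(\<integral>x. (x i * dmultilin I c i x) *\<^sub>R F (?P x) \<partial>?G) =
      (\<integral>x. (dmultilin I c i x)\<^sup>2 *\<^sub>R F' (?P x) \<partial>?G)" if i: "i \<in> I" for i
  proof -
    \<comment> \<open>The part of the polynomial that does not contain the variable \<open>i\<close>.\<close>
    define A where "A = (\<lambda>x. \<Sum>S\<in>{S \<in> Pow I. i \<notin> S}. c S * (\<Prod>j\<in>S. x j))"
    have "?P x = A x + (\<Sum>S\<in>{S \<in> Pow I. i \<in> S}. c S * (\<Prod>j\<in>S. x j))" for x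
    proof -
      have "Pow I = {S \<in> Pow I. i \<notin> S} \<union> {S \<in> Pow I. i \<in> S}" by auto
      then show ?thesis unfolding multilin_def A_def
        using I by (subst \<open>Pow I = _\<close>, subst sum.union_disjoint) auto
    qed
    then have P: "?P x = A x + x i * dmultilin I c i x" for x
      using I by (simp add: coordinate_times_dmultilin)
    show ?thesis unfolding P
    proof (rule gauss_ibp[OF I i _ _ all_moments_dmultilin dmultilin_update F F' bF bF'])
      show "all_moments ?G A" unfolding A_def
        by (intro all_moments_intros finite_measure_gauss all_moments_coordinate) auto
      show "A (x(i := y)) = A x" for x y
        unfolding A_def by (intro sum.cong refl arg_cong2[where f = "(*)"] prod.cong) auto
    qed
  qed
  have mxB: "all_moments ?G (\<lambda>x. x i * dmultilin I c i x)" if "i \<in> I" for i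
    by (intro all_moments_mult all_moments_coordinate all_moments_dmultilin that)
  have mBB: "all_moments ?G (\<lambda>x. (dmultilin I c i x)\<^sup>2)" for i
    by (intro all_moments_intros all_moments_dmultilin finite_measure_gauss)
  have "real q *\<^sub>R (\<integral>x. ?P x *\<^sub>R F (?P x) \<partial>?G) =
      (\<integral>x. (\<Sum>i\<in>I. x i * dmultilin I c i x) *\<^sub>R F (?P x) \<partial>?G)"
    by (simp add: multilin_euler[OF I hom] flip: scaleR_scaleR)
  also have "\<dots> = (\<Sum>i\<in>I. \<integral>x. (x i * dmultilin I c i x) *\<^sub>R F (?P x) \<partial>?G)"
    unfolding scaleR_sum_left by (intro Bochner_Integration.integral_sum int mxB mF bF)
  also have "\<dots> = (\<Sum>i\<in>I. \<integral>x. (dmultilin I c i x)\<^sup>2 *\<^sub>R F' (?P x) \<partial>?G)"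
    by (intro sum.cong refl each)
  also have "\<dots> = (\<integral>x. (\<Sum>i\<in>I. (dmultilin I c i x)\<^sup>2) *\<^sub>R F' (?P x) \<partial>?G)"
    unfolding scaleR_sum_left
    by (intro Bochner_Integration.integral_sum[symmetric] int mBB mF bF')
  finally show ?thesis by (simp add: carre_du_champ_def)
qed

section \<open>Hermite expansions and the spectral inequality\<close>

text \<open>The first three Hermite polynomials. Squares of multilinear polynomials have degree at
most two in each variable, so only the indices 0, 1 and 2 are used.\<close>

definition hermite2 :: "nat \<Rightarrow> real \<Rightarrow> real" where
  "hermite2 k y = (if k = 0 then 1 else if k = 1 then y else y\<^sup>2 - 1)"

definition hermite_prod :: "'i set \<Rightarrow> ('i \<Rightarrow> nat) \<Rightarrow> ('i \<Rightarrow> real) \<Rightarrow> real" where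
  "hermite_prod I \<alpha> x = (\<Prod>i\<in>I. hermite2 (\<alpha> i) (x i))"

abbreviation hermite_idx :: "'i set \<Rightarrow> ('i \<Rightarrow> nat) set" where
  "hermite_idx I \<equiv> I \<rightarrow>\<^sub>E {..2}"

lemma hermite2_orthogonal:
  assumes "k \<le> 2" "l \<le> 2" "k \<noteq> l"
  shows "(\<integral>y. hermite2 k y * hermite2 l y \<partial>std_normal_distribution) = 0"
proof -
  have kl: "(k, l) \<in> {(0,1),(0,2),(1,0),(1,2),(2,0),(2,1)}" using assms by auto
  have i1: "integrable std_normal_distribution (\<lambda>x. x)"
    using integrable_std_normal_distribution_moment[of 1] by simp
  have e: "y * (y\<^sup>2 - 1) = y ^ 3 - y" "(y\<^sup>2 - 1) * y = y ^ 3 - y" for y :: real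
    by (simp_all add: power2_eq_square power3_eq_cube algebra_simps)
  note * = i1 integrable_std_normal_distribution_moment std_normal.integrable_const
    std_normal_moments std_normal.prob_space[simplified]
  show ?thesis
    using kl by (auto simp: hermite2_def e *)
qed

lemma all_moments_hermite2:
  "all_moments M f \<Longrightarrow> finite_measure M \<Longrightarrow> all_moments M (\<lambda>x. hermite2 k (f x))"
  unfolding hermite2_def
  by (cases "k = 0"; cases "k = 1")
     (simp_all add: all_moments_const all_moments_diff all_moments_power)

lemma all_moments_hermite_prod: "all_moments (gauss_space I) (hermite_prod I \<alpha>)"
  unfolding hermite_prod_def
  by (intro all_moments_prod all_moments_hermite2 finite_measure_gauss all_moments_coordinate)

lemma hermite_prod_orthogonal:
  assumes I: "finite I" and "\<alpha> \<in> hermite_idx I" "\<beta> \<in> hermite_idx I" "\<alpha> \<noteq> \<beta>"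
  shows "(\<integral>x. hermite_prod I \<alpha> x * hermite_prod I \<beta> x \<partial>gauss_space I) = 0"
proof -
  obtain i where i: "i \<in> I" "\<alpha> i \<noteq> \<beta> i"
    using assms by (metis PiE_ext)
  have le: "\<alpha> i \<le> 2" "\<beta> i \<le> 2" using assms i by (auto simp: PiE_iff)
  have "(\<integral>x. hermite_prod I \<alpha> x * hermite_prod I \<beta> x \<partial>gauss_space I) =
      (\<integral>x. (\<Prod>j\<in>I. hermite2 (\<alpha> j) (x j) * hermite2 (\<beta> j) (x j)) \<partial>gauss_space I)"
    by (simp add: hermite_prod_def prod.distrib)
  also have "\<dots> = (\<Prod>j\<in>I. \<integral>y. hermite2 (\<alpha> j) y * hermite2 (\<beta> j) y \<partial>std_normal_distribution)"
    by (intro gauss.product_integral_prod[of I "\<lambda>j y. hermite2 (\<alpha> j) y * hermite2 (\<beta> j) y"] I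
          all_moments_integrable all_moments_mult all_moments_hermite2 all_moments_std_normal
          finite_measure_std_normal)
  also have "\<dots> = 0"
    using I i hermite2_orthogonal[OF le i(2)] by (auto intro!: prod_zero)
  finally show ?thesis .
qed

text \<open>The relation $U = \frac12 (L + 2q) Q$ for polynomials $Q$ of total degree at most $2q$ and of
degree at most 2 in each variable, where $L$ is the Ornstein-Uhlenbeck generator: $L$ multiplies the Hermite product of index
\<open>\<alpha>\<close> by $-|\alpha|$. Stating it through a common coefficient function avoids differential
operators.\<close>

definition half_shifted_ou ::
    "'i set \<Rightarrow> nat \<Rightarrow> (('i \<Rightarrow> real) \<Rightarrow> real) \<Rightarrow> (('i \<Rightarrow> real) \<Rightarrow> real) \<Rightarrow> bool" where
  "half_shifted_ou I q Q U \<longleftrightarrow> (\<exists>u :: ('i \<Rightarrow> nat) \<Rightarrow> real.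
     (\<forall>\<alpha>\<in>hermite_idx I. 2 * q < sum \<alpha> I \<longrightarrow> u \<alpha> = 0) \<and>
     (\<forall>x. Q x = (\<Sum>\<alpha>\<in>hermite_idx I. u \<alpha> * hermite_prod I \<alpha> x)) \<and>
     (\<forall>x. U x = (\<Sum>\<alpha>\<in>hermite_idx I. (real q - real (sum \<alpha> I) / 2) * u \<alpha> * hermite_prod I \<alpha> x)))"

lemma finite_hermite_idx: "finite I \<Longrightarrow> finite (hermite_idx I)"
  by (simp add: finite_PiE)

lemma half_shifted_ou_single:
  assumes "finite I" "\<alpha> \<in> hermite_idx I" "sum \<alpha> I \<le> 2 * q"
  shows "half_shifted_ou I q (hermite_prod I \<alpha>)
           (\<lambda>x. (real q - real (sum \<alpha> I) / 2) * hermite_prod I \<alpha> x)"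
proof -
  have s: "(\<Sum>\<beta>\<in>hermite_idx I. g \<beta> * (if \<beta> = \<alpha> then 1 else 0) * h \<beta>) = g \<alpha> * h \<alpha>"
    for g h :: "('a \<Rightarrow> nat) \<Rightarrow> real"
    using assms finite_hermite_idx by (subst sum.remove[of _ \<alpha>]) (auto intro!: sum.neutral)
  show ?thesis
    unfolding half_shifted_ou_def
    using assms(3) s[of "\<lambda>_. 1"] s
    by (intro exI[of _ "\<lambda>\<beta>. if \<beta> = \<alpha> then 1 else 0"]) auto
qed

lemma half_shifted_ou_zero: "half_shifted_ou I q (\<lambda>x. 0) (\<lambda>x. 0)"
  unfolding half_shifted_ou_def by (intro exI[of _ "\<lambda>_. 0"]) auto

lemma half_shifted_ou_add:
  assumes "half_shifted_ou I q Q U" "half_shifted_ou I q R V"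
  shows "half_shifted_ou I q (\<lambda>x. Q x + R x) (\<lambda>x. U x + V x)"
proof -
  from assms obtain u v where
    "\<forall>\<alpha>\<in>hermite_idx I. 2 * q < sum \<alpha> I \<longrightarrow> u \<alpha> = 0"
    "\<forall>x. Q x = (\<Sum>\<alpha>\<in>hermite_idx I. u \<alpha> * hermite_prod I \<alpha> x)"
    "\<forall>x. U x = (\<Sum>\<alpha>\<in>hermite_idx I. (real q - real (sum \<alpha> I) / 2) * u \<alpha> * hermite_prod I \<alpha> x)"
    "\<forall>\<alpha>\<in>hermite_idx I. 2 * q < sum \<alpha> I \<longrightarrow> v \<alpha> = 0"
    "\<forall>x. R x = (\<Sum>\<alpha>\<in>hermite_idx I. v \<alpha> * hermite_prod I \<alpha> x)"
    "\<forall>x. V x = (\<Sum>\<alpha>\<in>hermite_idx I. (real q - real (sum \<alpha> I) / 2) * v \<alpha> * hermite_prod I \<alpha> x)"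
    unfolding half_shifted_ou_def by blast
  then show ?thesis
    unfolding half_shifted_ou_def
    by (intro exI[of _ "\<lambda>\<alpha>. u \<alpha> + v \<alpha>"])
       (simp add: distrib_left distrib_right flip: sum.distrib)
qed

lemma half_shifted_ou_cmult:
  assumes "half_shifted_ou I q Q U"
  shows "half_shifted_ou I q (\<lambda>x. r * Q x) (\<lambda>x. r * U x)"
proof -
  from assms obtain u where
    "\<forall>\<alpha>\<in>hermite_idx I. 2 * q < sum \<alpha> I \<longrightarrow> u \<alpha> = 0"
    "\<forall>x. Q x = (\<Sum>\<alpha>\<in>hermite_idx I. u \<alpha> * hermite_prod I \<alpha> x)"
    "\<forall>x. U x = (\<Sum>\<alpha>\<in>hermite_idx I. (real q - real (sum \<alpha> I) / 2) * u \<alpha> * hermite_prod I \<alpha> x)"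
    unfolding half_shifted_ou_def by blast
  then show ?thesis
    unfolding half_shifted_ou_def
    by (intro exI[of _ "\<lambda>\<alpha>. r * u \<alpha>"]) (simp add: sum_distrib_left mult_ac)
qed

lemma half_shifted_ou_sum:
  assumes "\<And>k. k \<in> K \<Longrightarrow> half_shifted_ou I q (Q k) (U k)"
  shows "half_shifted_ou I q (\<lambda>x. \<Sum>k\<in>K. Q k x) (\<lambda>x. \<Sum>k\<in>K. U k x)"
  using assms by (induction K rule: infinite_finite_induct)
    (auto intro: half_shifted_ou_zero half_shifted_ou_add)

text \<open>In the orthogonal basis of Hermite products $\frac12 (L + 2q)$ has the eigenvalues
$d = q - |\alpha|/2$, which lie in $[0, q]$; hence $d^2 \le q\,d$.\<close>

theorem half_shifted_ou_spectral:
  assumes I: "finite I" and "half_shifted_ou I q Q U"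
  shows "(\<integral>x. U x ^ 2 \<partial>gauss_space I) \<le> real q * (\<integral>x. Q x * U x \<partial>gauss_space I)"
proof -
  let ?G = "gauss_space I" and ?A = "hermite_idx I" and ?H = "hermite_prod I"
  from assms obtain u where u0: "\<forall>\<alpha>\<in>?A. 2 * q < sum \<alpha> I \<longrightarrow> u \<alpha> = 0"
    and Q: "\<forall>x. Q x = (\<Sum>\<alpha>\<in>?A. u \<alpha> * ?H \<alpha> x)"
    and U: "\<forall>x. U x = (\<Sum>\<alpha>\<in>?A. (real q - real (sum \<alpha> I) / 2) * u \<alpha> * ?H \<alpha> x)"
    unfolding half_shifted_ou_def by blast
  define d where "d \<alpha> = real q - real (sum \<alpha> I) / 2" for \<alpha>
  define w where "w \<alpha> = (\<integral>x. ?H \<alpha> x * ?H \<alpha> x \<partial>?G)" for \<alpha>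
  have int: "integrable ?G (\<lambda>x. a * (?H \<alpha> x * ?H \<beta> x))" for a \<alpha> \<beta>
    by (intro all_moments_integrable all_moments_intros all_moments_hermite_prod)
  have inner: "(\<integral>x. (\<Sum>\<alpha>\<in>?A. a \<alpha> * ?H \<alpha> x) * (\<Sum>\<beta>\<in>?A. b \<beta> * ?H \<beta> x) \<partial>?G) =
      (\<Sum>\<alpha>\<in>?A. a \<alpha> * b \<alpha> * w \<alpha>)" for a b
  proof -
    have "(\<integral>x. (\<Sum>\<alpha>\<in>?A. a \<alpha> * ?H \<alpha> x) * (\<Sum>\<beta>\<in>?A. b \<beta> * ?H \<beta> x) \<partial>?G) =
        (\<integral>x. (\<Sum>\<alpha>\<in>?A. \<Sum>\<beta>\<in>?A. (a \<alpha> * b \<beta>) * (?H \<alpha> x * ?H \<beta> x)) \<partial>?G)"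
      by (simp add: sum_product mult_ac)
    also have "\<dots> = (\<Sum>\<alpha>\<in>?A. \<Sum>\<beta>\<in>?A. \<integral>x. (a \<alpha> * b \<beta>) * (?H \<alpha> x * ?H \<beta> x) \<partial>?G)"
      using int by (simp add: Bochner_Integration.integral_sum Bochner_Integration.integrable_sum)
    also have "\<dots> = (\<Sum>\<alpha>\<in>?A. \<Sum>\<beta>\<in>?A. if \<beta> = \<alpha> then a \<alpha> * b \<alpha> * w \<alpha> else 0)"
      using I hermite_prod_orthogonal by (intro sum.cong refl) (auto simp: w_def)
    also have "\<dots> = (\<Sum>\<alpha>\<in>?A. a \<alpha> * b \<alpha> * w \<alpha>)"
      by (intro sum.cong refl) (simp add: sum.delta[OF finite_hermite_idx[OF I]])
    finally show ?thesis .
  qed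
  have "(\<integral>x. U x ^ 2 \<partial>?G) = (\<Sum>\<alpha>\<in>?A. (d \<alpha> * u \<alpha>) * (d \<alpha> * u \<alpha>) * w \<alpha>)"
    using inner[of "\<lambda>\<alpha>. d \<alpha> * u \<alpha>" "\<lambda>\<alpha>. d \<alpha> * u \<alpha>"] U
    by (simp add: power2_eq_square d_def)
  also have "\<dots> \<le> (\<Sum>\<alpha>\<in>?A. real q * (u \<alpha> * (d \<alpha> * u \<alpha>) * w \<alpha>))"
  proof (rule sum_mono)
    fix \<alpha> assume \<alpha>: "\<alpha> \<in> ?A"
    show "(d \<alpha> * u \<alpha>) * (d \<alpha> * u \<alpha>) * w \<alpha> \<le> real q * (u \<alpha> * (d \<alpha> * u \<alpha>) * w \<alpha>)"
    proof (cases "u \<alpha> = 0")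
      case False
      then have "sum \<alpha> I \<le> 2 * q" using u0 \<alpha> by (metis not_le)
      then have "real (sum \<alpha> I) \<le> 2 * real q" by linarith
      then have "0 \<le> d \<alpha>" "d \<alpha> \<le> real q" unfolding d_def using of_nat_0_le_iff[of "sum \<alpha> I", where 'a = real] by linarith+
      moreover have "0 \<le> w \<alpha>" by (simp add: w_def)
      ultimately have "0 \<le> (real q - d \<alpha>) * (d \<alpha> * (u \<alpha>)\<^sup>2 * w \<alpha>)" by simp
      then show ?thesis by (simp add: algebra_simps power2_eq_square)
    qed simp
  qed
  also have "\<dots> = real q * (\<integral>x. Q x * U x \<partial>?G)"
    using inner[of u "\<lambda>\<alpha>. d \<alpha> * u \<alpha>"] Q U by (simp add: d_def sum_distrib_left)
  finally show ?thesis .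
qed

lemma half_shifted_ou_monomial:
  assumes I: "finite I" and DV: "D \<subseteq> I" "V \<subseteq> I" "D \<inter> V = {}" and le: "card D + 2 * card V \<le> 2 * q"
  shows "half_shifted_ou I q (\<lambda>x. (\<Prod>i\<in>D. x i) * (\<Prod>i\<in>V. (x i)\<^sup>2 - 1))
    (\<lambda>x. (real q - real (card D) / 2 - real (card V)) *
          ((\<Prod>i\<in>D. x i) * (\<Prod>i\<in>V. (x i)\<^sup>2 - 1)))"
proof -
  define \<alpha> where "\<alpha> = (\<lambda>i\<in>I. (if i \<in> D then 1 else 0) + (if i \<in> V then 2 else 0 :: nat))"
  have eqs: "{i \<in> I. i \<in> D} = D" "{i \<in> I. i \<in> V} = V" using DV by auto
  have H: "hermite_prod I \<alpha> x = (\<Prod>i\<in>D. x i) * (\<Prod>i\<in>V. (x i)\<^sup>2 - 1)" for x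
  proof -
    have "hermite_prod I \<alpha> x =
        (\<Prod>i\<in>I. (if i \<in> D then x i else 1) * (if i \<in> V then (x i)\<^sup>2 - 1 else 1))"
      unfolding hermite_prod_def
      using DV by (intro prod.cong refl) (auto simp: \<alpha>_def hermite2_def)
    also have "\<dots> = (\<Prod>i\<in>{i \<in> I. i \<in> D}. x i) * (\<Prod>i\<in>{i \<in> I. i \<in> V}. (x i)\<^sup>2 - 1)"
      by (simp only: prod.distrib prod.inter_filter[OF I])
    finally show ?thesis by (simp only: eqs)
  qed
  have S: "sum \<alpha> I = card D + 2 * card V"
  proof -
    have "sum \<alpha> I = (\<Sum>i\<in>I. (if i \<in> D then 1 else 0) + (if i \<in> V then 2 else 0))"
      by (simp add: \<alpha>_def)
    also have "\<dots> = (\<Sum>i\<in>{i \<in> I. i \<in> D}. 1) + (\<Sum>i\<in>{i \<in> I. i \<in> V}. 2)"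
      by (simp only: sum.distrib sum.inter_filter[OF I])
    finally show ?thesis by (simp add: eqs)
  qed
  have \<alpha>: "\<alpha> \<in> hermite_idx I" using DV by (auto simp: \<alpha>_def)
  have "half_shifted_ou I q (hermite_prod I \<alpha>)
           (\<lambda>x. (real q - real (sum \<alpha> I) / 2) * hermite_prod I \<alpha> x)"
    by (rule half_shifted_ou_single[OF I \<alpha>]) (simp add: S le)
  moreover have "real q - real (sum \<alpha> I) / 2 = real q - real (card D) / 2 - real (card V)"
    by (simp add: S add_divide_distrib)
  moreover have "hermite_prod I \<alpha> = (\<lambda>x. (\<Prod>i\<in>D. x i) * (\<Prod>i\<in>V. (x i)\<^sup>2 - 1))"
    using H by (rule ext)
  ultimately show ?thesis by (simp only:)
qed

text \<open>Each square is $1$ plus the second Hermite polynomial.\<close>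

lemma prod_squares_expand:
  fixes x :: "'i \<Rightarrow> real"
  assumes "finite R"
  shows "(\<Prod>i\<in>R. (x i)\<^sup>2) = (\<Sum>V\<in>Pow R. \<Prod>i\<in>V. (x i)\<^sup>2 - 1)"
  using prod_add[OF assms, of "\<lambda>i. (x i)\<^sup>2 - 1" "\<lambda>_. 1"] by simp

lemma prod_mult_prod_split:
  fixes x :: "'i \<Rightarrow> real"
  assumes "finite S" "finite S'"
  shows "(\<Prod>i\<in>S. x i) * (\<Prod>i\<in>S'. x i) =
    (\<Prod>i\<in>(S - S') \<union> (S' - S). x i) * (\<Prod>i\<in>S \<inter> S'. (x i)\<^sup>2)"
proof -
  have 1: "(\<Prod>i\<in>S. x i) = (\<Prod>i\<in>S - S'. x i) * (\<Prod>i\<in>S \<inter> S'. x i)"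
    using assms by (subst prod.union_disjoint[symmetric]) (auto intro!: prod.cong)
  have 2: "(\<Prod>i\<in>S'. x i) = (\<Prod>i\<in>S' - S. x i) * (\<Prod>i\<in>S \<inter> S'. x i)"
    using assms by (subst prod.union_disjoint[symmetric]) (auto intro!: prod.cong)
  have 3: "(\<Prod>i\<in>(S - S') \<union> (S' - S). x i) = (\<Prod>i\<in>S - S'. x i) * (\<Prod>i\<in>S' - S. x i)"
    using assms by (intro prod.union_disjoint) auto
  show ?thesis unfolding 1 2 3 power2_eq_square prod.distrib by simp
qed

text \<open>The case of two monomials of $\frac12 (L + 2q)(P^2) = \Gamma(P, P)$. With $R = S \cap S'$ and
$D$ the symmetric difference, the product of the monomials is the sum over $V \subseteq R$ of the
Hermite products with $D$ in degree one and $V$ in degree two. The eigenvalue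
$q - |D|/2 - |V|$ equals $|R| - |V|$, the number of $i \in R$ that may be removed while keeping $V$
inside $R \setminus \{i\}$.\<close>

lemma half_shifted_ou_monomial_product:
  assumes I: "finite I" and S: "S \<subseteq> I" "S' \<subseteq> I" "card S = q" "card S' = q"
  shows "half_shifted_ou I q (\<lambda>x. (\<Prod>i\<in>S. x i) * (\<Prod>i\<in>S'. x i))
    (\<lambda>x. \<Sum>i\<in>S \<inter> S'. (\<Prod>j\<in>S - {i}. x j) * (\<Prod>j\<in>S' - {i}. x j))"
proof -
  define D where "D = (S - S') \<union> (S' - S)"
  define R where "R = S \<inter> S'"
  have fin: "finite S" "finite S'" using I S finite_subset by auto
  have finR: "finite R" using fin by (simp add: R_def)
  have "card S = card (S - S') + card R" "card S' = card (S' - S) + card R"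
    using fin by (simp_all add: R_def card_Diff_subset_Int Int_commute card_mono)
  moreover have "card D = card (S - S') + card (S' - S)"
    unfolding D_def using fin by (intro card_Un_disjoint) auto
  ultimately have cD: "card D + 2 * card R = 2 * q" using S by simp
  let ?h = "\<lambda>V x. (\<Prod>i\<in>D. x i) * (\<Prod>i\<in>V. (x i)\<^sup>2 - 1 :: real)"
  have "half_shifted_ou I q (\<lambda>x. \<Sum>V\<in>Pow R. ?h V x)
     (\<lambda>x. \<Sum>V\<in>Pow R. (real q - real (card D) / 2 - real (card V)) * ?h V x)"
  proof (intro half_shifted_ou_sum half_shifted_ou_monomial I)
    fix V assume V: "V \<in> Pow R"
    then have "card V \<le> card R" using finR by (intro card_mono) auto
    then show "card D + 2 * card V \<le> 2 * q" using cD by simp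
    show "D \<subseteq> I" "V \<subseteq> I" "D \<inter> V = {}" using V S by (auto simp: D_def R_def)
  qed
  moreover have "(\<Sum>V\<in>Pow R. ?h V x) = (\<Prod>i\<in>S. x i) * (\<Prod>i\<in>S'. x i)" for x
    unfolding prod_mult_prod_split[OF fin] D_def[symmetric] R_def[symmetric]
      prod_squares_expand[OF finR] sum_distrib_left ..
  moreover have "(\<Sum>V\<in>Pow R. (real q - real (card D) / 2 - real (card V)) * ?h V x) =
      (\<Sum>i\<in>S \<inter> S'. (\<Prod>j\<in>S - {i}. x j) * (\<Prod>j\<in>S' - {i}. x j))" for x
  proof -
    have sub: "(S - {i} - (S' - {i})) \<union> (S' - {i} - (S - {i})) = D"
      "(S - {i}) \<inter> (S' - {i}) = R - {i}" if "i \<in> R" for i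
      using that by (auto simp: D_def R_def)
    have "(\<Sum>i\<in>R. (\<Prod>j\<in>S - {i}. x j) * (\<Prod>j\<in>S' - {i}. x j)) =
        (\<Sum>i\<in>R. \<Sum>V\<in>Pow (R - {i}). ?h V x)"
    proof (rule sum.cong[OF refl])
      fix i assume i: "i \<in> R"
      have "(\<Prod>j\<in>S - {i}. x j) * (\<Prod>j\<in>S' - {i}. x j) =
          (\<Prod>i\<in>D. x i) * (\<Prod>j\<in>R - {i}. (x j)\<^sup>2)"
        using prod_mult_prod_split[of "S - {i}" "S' - {i}" x] fin unfolding sub[OF i] by simp
      also have "\<dots> = (\<Sum>V\<in>Pow (R - {i}). ?h V x)"
        using finR by (simp add: prod_squares_expand sum_distrib_left)
      finally show "(\<Prod>j\<in>S - {i}. x j) * (\<Prod>j\<in>S' - {i}. x j) =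
        (\<Sum>V\<in>Pow (R - {i}). ?h V x)" .
    qed
    also have "\<dots> = (\<Sum>i\<in>R. \<Sum>V\<in>Pow R. if i \<notin> V then ?h V x else 0)"
    proof (rule sum.cong[OF refl])
      fix i
      have "Pow (R - {i}) = {V \<in> Pow R. i \<notin> V}" by auto
      then show "(\<Sum>V\<in>Pow (R - {i}). ?h V x) = (\<Sum>V\<in>Pow R. if i \<notin> V then ?h V x else 0)"
        using finR by (simp only: sum.inter_filter finite_Pow_iff)
    qed
    also have "\<dots> = (\<Sum>V\<in>Pow R. \<Sum>i\<in>R. if i \<notin> V then ?h V x else 0)"
      by (rule sum.swap)
    also have "\<dots> = (\<Sum>V\<in>Pow R. (real q - real (card D) / 2 - real (card V)) * ?h V x)"
    proof (rule sum.cong[OF refl])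
      fix V assume V: "V \<in> Pow R"
      have "(\<Sum>i\<in>R. if i \<notin> V then ?h V x else 0) = (\<Sum>i\<in>{i \<in> R. i \<notin> V}. ?h V x)"
        using finR by (simp only: sum.inter_filter)
      also have "{i \<in> R. i \<notin> V} = R - V" by auto
      also have "(\<Sum>i\<in>R - V. ?h V x) = real (card (R - V)) * ?h V x" by simp
      also have "real (card (R - V)) = real (card R) - real (card V)"
        using V finR by (subst card_Diff_subset) (auto simp: finite_subset card_mono of_nat_diff)
      also have "\<dots> = real q - real (card D) / 2 - real (card V)"
        using cD by (simp add: field_simps flip: of_nat_add of_nat_mult)
      finally show "(\<Sum>i\<in>R. if i \<notin> V then ?h V x else 0) =
        (real q - real (card D) / 2 - real (card V)) * ?h V x" .
    qed
    finally show ?thesis by (simp add: R_def)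
  qed
  ultimately show ?thesis by simp
qed

text \<open>This is $\Gamma(P,P) = \frac12 (L (P^2) - 2 P L P)$ together with $L P = -q P$.\<close>

lemma half_shifted_ou_multilin_square:
  assumes I: "finite I" and hom: "\<And>S. S \<subseteq> I \<Longrightarrow> card S \<noteq> q \<Longrightarrow> c S = 0"
  shows "half_shifted_ou I q (\<lambda>x. (multilin I c x)\<^sup>2) (carre_du_champ I c)"
proof -
  let ?m = "\<lambda>S x. \<Prod>i\<in>S. x i :: real"
  have "half_shifted_ou I q (\<lambda>x. \<Sum>S\<in>Pow I. \<Sum>S'\<in>Pow I. (c S * c S') * (?m S x * ?m S' x))
     (\<lambda>x. \<Sum>S\<in>Pow I. \<Sum>S'\<in>Pow I. (c S * c S') *
        (\<Sum>i\<in>S \<inter> S'. ?m (S - {i}) x * ?m (S' - {i}) x))"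
  proof (intro half_shifted_ou_sum)
    fix S S' assume S: "S \<in> Pow I" "S' \<in> Pow I"
    show "half_shifted_ou I q (\<lambda>x. (c S * c S') * (?m S x * ?m S' x))
      (\<lambda>x. (c S * c S') * (\<Sum>i\<in>S \<inter> S'. ?m (S - {i}) x * ?m (S' - {i}) x))"
    proof (cases "card S = q \<and> card S' = q")
      case True
      then show ?thesis
        using S I by (intro half_shifted_ou_cmult half_shifted_ou_monomial_product) auto
    next
      case False
      then have "c S * c S' = 0" using hom S by auto
      then show ?thesis by (simp only: mult_zero_left half_shifted_ou_zero)
    qed
  qed
  moreover have "(\<Sum>S\<in>Pow I. \<Sum>S'\<in>Pow I. (c S * c S') * (?m S x * ?m S' x)) =
      (multilin I c x)\<^sup>2" for x
    by (simp add: multilin_def power2_eq_square sum_product mult_ac)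
  moreover have "(\<Sum>S\<in>Pow I. \<Sum>S'\<in>Pow I. (c S * c S') *
        (\<Sum>i\<in>S \<inter> S'. ?m (S - {i}) x * ?m (S' - {i}) x)) = carre_du_champ I c x" for x
  proof -
    let ?g = "\<lambda>i S. if i \<in> S then c S * ?m (S - {i}) x else 0"
    have d: "dmultilin I c i x = (\<Sum>S\<in>Pow I. ?g i S)" for i
      unfolding dmultilin_def using I by (intro sum.inter_filter) simp
    have "carre_du_champ I c x = (\<Sum>i\<in>I. \<Sum>S\<in>Pow I. \<Sum>S'\<in>Pow I. ?g i S * ?g i S')"
      unfolding carre_du_champ_def d power2_eq_square sum_product ..
    also have "\<dots> = (\<Sum>S\<in>Pow I. \<Sum>i\<in>I. \<Sum>S'\<in>Pow I. ?g i S * ?g i S')"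
      by (rule sum.swap)
    also have "\<dots> = (\<Sum>S\<in>Pow I. \<Sum>S'\<in>Pow I. \<Sum>i\<in>I. ?g i S * ?g i S')"
      by (intro sum.cong refl sum.swap)
    also have "\<dots> = (\<Sum>S\<in>Pow I. \<Sum>S'\<in>Pow I. (c S * c S') *
        (\<Sum>i\<in>S \<inter> S'. ?m (S - {i}) x * ?m (S' - {i}) x))"
    proof (intro sum.cong refl)
      fix S S' assume S: "S \<in> Pow I" "S' \<in> Pow I"
      have "(\<Sum>i\<in>I. ?g i S * ?g i S') =
          (\<Sum>i\<in>I. if i \<in> S \<inter> S' then (c S * c S') * (?m (S - {i}) x * ?m (S' - {i}) x) else 0)"
        by (intro sum.cong refl) auto
      also have "\<dots> =
          (\<Sum>i\<in>{i \<in> I. i \<in> S \<inter> S'}. (c S * c S') * (?m (S - {i}) x * ?m (S' - {i}) x))"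
        using I by (simp only: sum.inter_filter)
      also have "{i \<in> I. i \<in> S \<inter> S'} = S \<inter> S'" using S by auto
      finally show "(\<Sum>i\<in>I. ?g i S * ?g i S') = (c S * c S') *
        (\<Sum>i\<in>S \<inter> S'. ?m (S - {i}) x * ?m (S' - {i}) x)" by (simp add: sum_distrib_left)
    qed
    finally show ?thesis by simp
  qed
  ultimately show ?thesis by simp
qed

lemma half_shifted_ou_multilin:
  assumes I: "finite I" and hom: "\<And>S. S \<subseteq> I \<Longrightarrow> card S \<noteq> q \<Longrightarrow> c S = 0"
  shows "half_shifted_ou I q (multilin I c) (\<lambda>x. real q / 2 * multilin I c x)"
proof -
  have "half_shifted_ou I q (\<lambda>x. \<Sum>S\<in>Pow I. c S * (\<Prod>i\<in>S. x i))
     (\<lambda>x. \<Sum>S\<in>Pow I. c S * (real q / 2 * (\<Prod>i\<in>S. x i)))"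
  proof (intro half_shifted_ou_sum)
    fix S assume S: "S \<in> Pow I"
    show "half_shifted_ou I q (\<lambda>x. c S * (\<Prod>i\<in>S. x i)) (\<lambda>x. c S * (real q / 2 * (\<Prod>i\<in>S. x i)))"
    proof (cases "card S = q")
      case True
      then show ?thesis
        using half_shifted_ou_monomial[OF I, of S "{}" q] S
        by (intro half_shifted_ou_cmult) (simp add: field_simps)
    next
      case False
      then have "c S = 0" using hom S by auto
      then show ?thesis by (simp only: mult_zero_left half_shifted_ou_zero)
    qed
  qed
  moreover have "(\<Sum>S\<in>Pow I. c S * (real q / 2 * (\<Prod>i\<in>S. x i))) = real q / 2 * multilin I c x" for x
    by (simp add: multilin_def sum_distrib_left mult_ac)
  ultimately show ?thesis by (simp only: multilin_def[abs_def])
qed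

lemma half_shifted_ou_const:
  "finite I \<Longrightarrow> half_shifted_ou I q (\<lambda>x. r) (\<lambda>x. real q * r)"
  using half_shifted_ou_cmult[OF half_shifted_ou_monomial[of I "{}" "{}" q], of r]
  by (simp add: mult.commute)

section \<open>The fourth-moment estimate for Gaussian chaos\<close>

text \<open>Three times this quantity is $E X^4 - 12 E X^3 - 12\nu^2 + 48\nu$ when $E X^2 = 2\nu$. The
present form is nonnegative on a Wiener chaos for every value of the second moment.\<close>

definition gamma_defect :: "real \<Rightarrow> 'a measure \<Rightarrow> ('a \<Rightarrow> real) \<Rightarrow> real" where
  "gamma_defect \<nu> M X = (\<integral>x. X x ^ 4 \<partial>M) / 3 - 4 * (\<integral>x. X x ^ 3 \<partial>M) +
     (8 - 4 * \<nu>) * (\<integral>x. X x ^ 2 \<partial>M) + 4 * \<nu>\<^sup>2"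

lemma has_vector_derivative_real_power:
  "((\<lambda>x. x ^ n) has_vector_derivative real n * x ^ (n - 1)) (at (x :: real))"
  using DERIV_pow[of n x] by (simp add: has_real_derivative_iff_has_vector_derivative)

lemma has_vector_derivative_iexp_scaled:
  "((\<lambda>x. iexp (t * x)) has_vector_derivative \<i> * t * iexp (t * x)) (at x)"
proof -
  have "((\<lambda>x. t * x) has_vector_derivative t) (at x)"
    by (auto intro!: derivative_eq_intros)
  from vector_diff_chain_at[OF this has_vector_derivative_iexp[of "t * x" UNIV]] show ?thesis
    by (simp add: o_def scaleR_conv_of_real mult_ac)
qed

text \<open>The mean vanishes by integration by parts with $F = 1$. The other two statements come from
$U = \Gamma - 2qP - 2q\nu = \frac12 (L + 2q)(P^2 - 4P - 2\nu)$.
The spectral inequality gives $E U^2 \le q^2 \delta$, where $\delta$ is the defect. The last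
statement is integration by parts for $F(x) = e^{itx}$ in which $\Gamma$ is replaced by $U + 2qP + 2q\nu$.\<close>

theorem multilin_gamma_estimate:
  assumes I: "finite I" and hom: "\<And>S. S \<subseteq> I \<Longrightarrow> card S \<noteq> q \<Longrightarrow> c S = 0" and q: "q > 0"
  defines "P \<equiv> multilin I c" and "G \<equiv> gauss_space I"
  shows "(\<integral>x. P x \<partial>G) = 0" (is ?zero)
    and "0 \<le> gamma_defect \<nu> G P" (is ?nonneg)
    and "cmod ((1 - 2 * \<i> * t) * (CLINT x|G. P x * iexp (t * P x)) -
          2 * \<i> * t * \<nu> * (CLINT x|G. iexp (t * P x))) \<le> \<bar>t\<bar> * sqrt (gamma_defect \<nu> G P)"
      (is ?stein)
proof -
  interpret prob_space G unfolding G_def by (rule prob_space_gauss)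
  define \<Gamma> where "\<Gamma> = carre_du_champ I c"
  define U where "U x = \<Gamma> x - 2 * real q * P x - 2 * real q * \<nu>" for x
  have mP: "all_moments G P" and m\<Gamma>: "all_moments G \<Gamma>"
    unfolding P_def G_def \<Gamma>_def by (simp_all add: all_moments_multilin all_moments_carre)
  have fm: "finite_measure G" by (rule finite_measure_axioms)
  have mU: "all_moments G U"
    unfolding U_def using mP m\<Gamma> fm by (intro all_moments_intros)
  have mPG: "all_moments G (\<lambda>x. \<Gamma> x * P x ^ n)" for n
    using mP m\<Gamma> fm by (intro all_moments_intros)
  have ibp: "real q * (\<integral>x. P x * P x ^ n \<partial>G) = (\<integral>x. \<Gamma> x * (real n * P x ^ (n - 1)) \<partial>G)"
    if "n \<le> 4" for n
    unfolding P_def G_def \<Gamma>_def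
  proof (rule multilin_chaos_ibp[where 'b = real, OF I hom, simplified])
    show "((\<lambda>x. x ^ n) has_vector_derivative real n * x ^ (n - 1)) (at x)" for x :: real
      by (rule has_vector_derivative_real_power)
    show "continuous_on UNIV (\<lambda>x :: real. real n * x ^ (n - 1))"
      by (intro continuous_intros)
    have "\<bar>x\<bar> ^ n \<le> 1 + x ^ 4" "\<bar>x\<bar> ^ (n - 1) \<le> 1 + x ^ 4" for x :: real
      using that by (intro abs_power_le_one_plus_even_power; simp)+
    then have "1 * \<bar>x\<bar> ^ n \<le> (1 + real n) * (1 + x ^ 4)"
      "real n * \<bar>x\<bar> ^ (n - 1) \<le> (1 + real n) * (1 + x ^ 4)" for x :: real
      by (intro mult_mono; simp)+
    then show "\<bar>x ^ n\<bar> \<le> (1 + real n) * (1 + x ^ 4)"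
      "\<bar>real n * x ^ (n - 1)\<bar> \<le> (1 + real n) * (1 + x ^ 4)" for x :: real
      by (simp_all add: power_abs abs_mult)
  qed
  then have ibp': "real q * (\<integral>x. P x ^ Suc n \<partial>G) = real n * (\<integral>x. \<Gamma> x * P x ^ (n - 1) \<partial>G)"
    if "n \<le> 4" for n
    using that by (simp add: mult.left_commute[of _ "real n"])
  show ?zero using ibp'[of 0] q by simp
  note zero = this
  have g1: "(\<integral>x. \<Gamma> x \<partial>G) = q * (\<integral>x. P x ^ 2 \<partial>G)"
    using ibp'[of 1] by (simp add: power2_eq_square)
  have g2: "(\<integral>x. \<Gamma> x * P x \<partial>G) = q / 2 * (\<integral>x. P x ^ 3 \<partial>G)"
    using ibp'[of 2] by simp
  have g3: "(\<integral>x. \<Gamma> x * P x ^ 2 \<partial>G) = q / 3 * (\<integral>x. P x ^ 4 \<partial>G)"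
    using ibp'[of 3] by simp
  have QU: "half_shifted_ou I q (\<lambda>x. (P x)\<^sup>2 + (-4 * P x + -2 * \<nu>)) U"
  proof -
    have "half_shifted_ou I q (\<lambda>x. (P x)\<^sup>2 + (-4 * P x + -2 * \<nu>))
        (\<lambda>x. \<Gamma> x + (-4 * (real q / 2 * P x) + real q * (-2 * \<nu>)))"
      unfolding P_def \<Gamma>_def
      by (intro half_shifted_ou_add half_shifted_ou_multilin_square half_shifted_ou_cmult
            half_shifted_ou_multilin half_shifted_ou_const I hom)
    moreover have "(\<lambda>x. \<Gamma> x + (-4 * (real q / 2 * P x) + real q * (-2 * \<nu>))) = U"
      by (auto simp: U_def fun_eq_iff)
    ultimately show ?thesis by simp
  qed
  \<comment> \<open>The expectation of every term on the right is known from integration by parts.\<close>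
  have expand: "((P x)\<^sup>2 + (-4 * P x + -2 * \<nu>)) * U x =
      \<Gamma> x * P x ^ 2 - 4 * (\<Gamma> x * P x) - 2 * \<nu> * \<Gamma> x - 2 * real q * P x ^ 3 +
      (8 * real q - 2 * real q * \<nu>) * P x ^ 2 + 12 * real q * \<nu> * P x + 4 * real q * \<nu>\<^sup>2" for x
    unfolding U_def by algebra
  have ints: "integrable G (\<lambda>x. \<Gamma> x * P x ^ 2)" "integrable G (\<lambda>x. \<Gamma> x * P x)" "integrable G \<Gamma>"
     "integrable G P" "integrable G (\<lambda>x. P x ^ n)" for n
    using mPG[of 2] mPG[of 1] mPG[of 0] mP
    by (auto dest: all_moments_integrable intro: all_moments_integrable_power)
  have "(\<integral>x. ((P x)\<^sup>2 + (-4 * P x + -2 * \<nu>)) * U x \<partial>G) = q * gamma_defect \<nu> G P"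
  proof -
    have "(\<integral>x. ((P x)\<^sup>2 + (-4 * P x + -2 * \<nu>)) * U x \<partial>G) =
        (\<integral>x. \<Gamma> x * P x ^ 2 \<partial>G) - 4 * (\<integral>x. \<Gamma> x * P x \<partial>G) - 2 * \<nu> * (\<integral>x. \<Gamma> x \<partial>G) -
        2 * real q * (\<integral>x. P x ^ 3 \<partial>G) + (8 * real q - 2 * real q * \<nu>) * (\<integral>x. P x ^ 2 \<partial>G) +
        12 * real q * \<nu> * (\<integral>x. P x \<partial>G) + 4 * real q * \<nu>\<^sup>2"
      unfolding expand using ints by (simp add: prob_space)
    then show ?thesis
      unfolding g1 g2 g3 zero gamma_defect_def by (simp add: field_simps)
  qed
  then have U2: "(\<integral>x. U x ^ 2 \<partial>G) \<le> (real q)\<^sup>2 * gamma_defect \<nu> G P"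
    using half_shifted_ou_spectral[OF I QU] unfolding G_def by (simp add: power2_eq_square)
  have "0 \<le> (\<integral>x. U x ^ 2 \<partial>G)" by simp
  also note U2
  finally show nonneg: ?nonneg using q by (simp add: zero_le_mult_iff)
  have U1: "(\<integral>x. \<bar>U x\<bar> \<partial>G) \<le> q * sqrt (gamma_defect \<nu> G P)"
  proof -
    have "0 \<le> variance (\<lambda>x. \<bar>U x\<bar>)" by (rule variance_positive)
    also have "\<dots> = (\<integral>x. U x ^ 2 \<partial>G) - (\<integral>x. \<bar>U x\<bar> \<partial>G)\<^sup>2"
      using mU all_moments_integrable_power[OF mU]
      by (subst variance_eq) (auto intro: all_moments_integrable)
    finally have "(\<integral>x. \<bar>U x\<bar> \<partial>G)\<^sup>2 \<le> (real q)\<^sup>2 * gamma_defect \<nu> G P" using U2 by simp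
    then have "(\<integral>x. \<bar>U x\<bar> \<partial>G) \<le> sqrt ((real q)\<^sup>2 * gamma_defect \<nu> G P)"
      by (rule real_le_rsqrt)
    then show ?thesis by (simp add: real_sqrt_mult)
  qed
  show ?stein
  proof -
    let ?e = "\<lambda>x. iexp (t * P x)"
    note [measurable] = mP m\<Gamma> mU
    have inte: "integrable G (\<lambda>x. complex_of_real (g x) * ?e x)" if g: "all_moments G g" for g
    proof (rule Bochner_Integration.integrable_bound)
      note [measurable] = g
      show "integrable G g" by (rule all_moments_integrable[OF g])
      show "(\<lambda>x. complex_of_real (g x) * ?e x) \<in> borel_measurable G" by measurable
    qed (simp add: norm_mult)
    have e1: "integrable G ?e"
      using inte[OF all_moments_const[OF fm, of 1]] by simp
    have "real q *\<^sub>R (\<integral>x. P x *\<^sub>R iexp (t * P x) \<partial>G) =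
        (\<integral>x. \<Gamma> x *\<^sub>R (\<i> * t * iexp (t * P x)) \<partial>G)"
      unfolding P_def G_def \<Gamma>_def
    proof (rule multilin_chaos_ibp[OF I hom])
      show "((\<lambda>x. iexp (t * x)) has_vector_derivative \<i> * t * iexp (t * x)) (at x)" for x
        by (rule has_vector_derivative_iexp_scaled)
      show "continuous_on UNIV (\<lambda>x. \<i> * t * iexp (t * x))"
        by (intro continuous_intros)
      have "1 * 1 \<le> (1 + \<bar>t\<bar>) * (1 + x ^ 4)" "\<bar>t\<bar> * 1 \<le> (1 + \<bar>t\<bar>) * (1 + x ^ 4)" for x :: real
        by (intro mult_mono; simp)+
      then show "cmod (iexp (t * x)) \<le> (1 + \<bar>t\<bar>) * (1 + x ^ 4)"
        "cmod (\<i> * t * iexp (t * x)) \<le> (1 + \<bar>t\<bar>) * (1 + x ^ 4)" for x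
        by (simp_all add: norm_mult)
    qed
    then have main: "q * (CLINT x|G. P x * ?e x) = \<i> * t * (CLINT x|G. \<Gamma> x * ?e x)"
      by (simp add: scaleR_conv_of_real mult_ac flip: integral_mult_right_zero)
    have \<Gamma>e: "(CLINT x|G. \<Gamma> x * ?e x) = (CLINT x|G. U x * ?e x) + 2 * real q * (CLINT x|G. P x * ?e x)
        + 2 * real q * \<nu> * (CLINT x|G. ?e x)"
    proof -
      have "(CLINT x|G. \<Gamma> x * ?e x) =
          (CLINT x|G. U x * ?e x + 2 * real q * (P x * ?e x) + 2 * real q * \<nu> * ?e x)"
        by (intro Bochner_Integration.integral_cong refl) (simp add: U_def algebra_simps)
      then show ?thesis using inte[OF mU] inte[OF mP] e1 by simp
    qed
    have "q * ((1 - 2 * \<i> * t) * (CLINT x|G. P x * ?e x) - 2 * \<i> * t * \<nu> * (CLINT x|G. ?e x)) =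
        \<i> * t * (CLINT x|G. U x * ?e x)"
      using main unfolding \<Gamma>e by (simp add: algebra_simps)
    then have "q * cmod ((1 - 2 * \<i> * t) * (CLINT x|G. P x * ?e x) -
        2 * \<i> * t * \<nu> * (CLINT x|G. ?e x)) = \<bar>t\<bar> * cmod (CLINT x|G. U x * ?e x)"
      by (metis (no_types, lifting) norm_mult norm_of_nat norm_ii norm_of_real mult_1)
    also have "\<dots> \<le> \<bar>t\<bar> * (\<integral>x. \<bar>U x\<bar> \<partial>G)"
      using integral_norm_bound[of G "\<lambda>x. U x * ?e x"]
      by (intro mult_left_mono) (auto simp: norm_mult)
    also have "\<dots> \<le> \<bar>t\<bar> * (q * sqrt (gamma_defect \<nu> G P))"
      using U1 by (intro mult_left_mono) auto
    finally show ?thesis using q by (simp add: mult.left_commute)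
  qed
qed

section \<open>Passage to the limit in mean square\<close>

lemma integral_Cauchy_Schwarz:
  fixes u v :: "'a \<Rightarrow> real"
  assumes [measurable]: "u \<in> borel_measurable M" "v \<in> borel_measurable M"
    and u: "integrable M (\<lambda>x. (u x)\<^sup>2)" and v: "integrable M (\<lambda>x. (v x)\<^sup>2)"
  shows "integrable M (\<lambda>x. u x * v x)"
    and "(\<integral>x. \<bar>u x * v x\<bar> \<partial>M) \<le> sqrt (\<integral>x. (u x)\<^sup>2 \<partial>M) * sqrt (\<integral>x. (v x)\<^sup>2 \<partial>M)"
proof -
  have am_gm: "2 * \<bar>a * b\<bar> \<le> e * a\<^sup>2 + b\<^sup>2 / e" if "e > 0" for a b e :: real
  proof -
    have "2 * (sqrt e * \<bar>a\<bar>) * (\<bar>b\<bar> / sqrt e) \<le> (sqrt e * \<bar>a\<bar>)\<^sup>2 + (\<bar>b\<bar> / sqrt e)\<^sup>2"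
      by (rule sum_squares_bound)
    then show ?thesis
      using that by (simp add: power_mult_distrib power_divide abs_mult)
  qed
  show int: "integrable M (\<lambda>x. u x * v x)"
  proof (rule Bochner_Integration.integrable_bound)
    show "integrable M (\<lambda>x. (u x)\<^sup>2 + (v x)\<^sup>2)" using u v by simp
    have "\<bar>u x * v x\<bar> \<le> (u x)\<^sup>2 + (v x)\<^sup>2" for x
      using am_gm[of 1 "u x" "v x"] by simp
    then show "AE x in M. norm (u x * v x) \<le> norm ((u x)\<^sup>2 + (v x)\<^sup>2)" by simp
  qed measurable
  define a where "a = (\<integral>x. (u x)\<^sup>2 \<partial>M)"
  define b where "b = (\<integral>x. (v x)\<^sup>2 \<partial>M)"
  have ab: "0 \<le> a" "0 \<le> b" by (simp_all add: a_def b_def)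
  show "(\<integral>x. \<bar>u x * v x\<bar> \<partial>M) \<le> sqrt (\<integral>x. (u x)\<^sup>2 \<partial>M) * sqrt (\<integral>x. (v x)\<^sup>2 \<partial>M)"
  proof (cases "a = 0 \<or> b = 0")
    case True
    then have "(AE x in M. (u x)\<^sup>2 = 0) \<or> (AE x in M. (v x)\<^sup>2 = 0)"
      unfolding a_def b_def using u v by (simp add: integral_nonneg_eq_0_iff_AE)
    then have "AE x in M. \<bar>u x * v x\<bar> = 0" by (auto elim: eventually_mono)
    then have "(\<integral>x. \<bar>u x * v x\<bar> \<partial>M) = 0" by (rule integral_eq_zero_AE)
    then show ?thesis using ab by (simp add: a_def b_def)
  next
    case False
    then have pos: "0 < a" "0 < b" using ab by auto
    \<comment> \<open>The weight that makes both terms of the arithmetic-geometric mean bound equal.\<close>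
    define e where "e = sqrt b / sqrt a"
    have e: "e > 0" using pos by (simp add: e_def)
    have "(\<integral>x. 2 * \<bar>u x * v x\<bar> \<partial>M) \<le> (\<integral>x. e * (u x)\<^sup>2 + (v x)\<^sup>2 / e \<partial>M)"
      using int u v am_gm[OF e] by (intro integral_mono) auto
    then have "2 * (\<integral>x. \<bar>u x * v x\<bar> \<partial>M) \<le> e * a + b / e"
      using u v by (simp add: a_def b_def)
    also have "e * a = sqrt a * sqrt b"
      using pos by (simp add: e_def field_simps)
    also have "b / e = sqrt a * sqrt b"
      using pos by (simp add: e_def field_simps)
    finally show ?thesis by (simp add: a_def b_def)
  qed
qed

lemma (in prob_space) integrable_power_of_sixth:
  assumes [measurable]: "random_variable borel X"
    and X: "integrable M (\<lambda>x. X x ^ 6 :: real)" and n: "n \<le> 6"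
  shows "integrable M (\<lambda>x. \<bar>X x\<bar> ^ n)" and "integrable M (\<lambda>x. X x ^ n)"
proof -
  have i: "integrable M (\<lambda>x. 1 + X x ^ 6)" using X by simp
  show "integrable M (\<lambda>x. \<bar>X x\<bar> ^ n)" "integrable M (\<lambda>x. X x ^ n)"
    by (rule Bochner_Integration.integrable_bound[OF i];
        use abs_power_le_one_plus_even_power[OF n] in \<open>simp add: power_abs\<close>)+
qed

lemma (in prob_space) tendsto_L2_integral:
  assumes [measurable]: "\<And>k. random_variable borel (Y k)" "random_variable borel X"
    and Y2: "\<And>k. integrable M (\<lambda>x. (Y k x)\<^sup>2)" and X2: "integrable M (\<lambda>x. (X x)\<^sup>2)"
    and lim: "tendsto_L2 M Y X"
  shows "\<And>k. integrable M (\<lambda>x. (Y k x - X x)\<^sup>2)"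
    and "(\<lambda>k. \<integral>x. (Y k x - X x)\<^sup>2 \<partial>M) \<longlonglongrightarrow> 0"
proof -
  show int: "integrable M (\<lambda>x. (Y k x - X x)\<^sup>2)" for k
  proof (rule Bochner_Integration.integrable_bound)
    show "integrable M (\<lambda>x. 2 * ((Y k x)\<^sup>2 + (X x)\<^sup>2))" using Y2[of k] X2 by simp
    have "(a - b)\<^sup>2 \<le> 2 * (a\<^sup>2 + b\<^sup>2)" for a b :: real
    proof -
      have "2 * (a\<^sup>2 + b\<^sup>2) - (a - b)\<^sup>2 = (a + b)\<^sup>2" by algebra
      then show ?thesis by (smt (verit) zero_le_power2)
    qed
    then show "AE x in M. norm ((Y k x - X x)\<^sup>2) \<le> norm (2 * ((Y k x)\<^sup>2 + (X x)\<^sup>2))"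
      by (simp del: distrib_left_numeral)
  qed measurable
  have "(\<lambda>k. ennreal (\<integral>x. (Y k x - X x)\<^sup>2 \<partial>M)) \<longlonglongrightarrow> ennreal 0"
    using lim int unfolding tendsto_L2_def by (simp add: nn_integral_eq_integral)
  then show "(\<lambda>k. \<integral>x. (Y k x - X x)\<^sup>2 \<partial>M) \<longlonglongrightarrow> 0"
    by (subst (asm) tendsto_ennreal_iff) auto
qed

lemma (in prob_space) tendsto_L2_second_moment:
  assumes [measurable]: "\<And>k. random_variable borel (Y k)" "random_variable borel X"
    and Y2: "\<And>k. integrable M (\<lambda>x. (Y k x)\<^sup>2)" and X2: "integrable M (\<lambda>x. (X x)\<^sup>2)"
    and lim: "tendsto_L2 M Y X"
  shows "(\<lambda>k. \<integral>x. (Y k x)\<^sup>2 \<partial>M) \<longlonglongrightarrow> (\<integral>x. (X x)\<^sup>2 \<partial>M)"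
proof (rule LIM_zero_cancel, rule Lim_null_comparison[OF always_eventually, rule_format])
  note L2 = tendsto_L2_integral[OF assms]
  let ?d = "\<lambda>k. \<integral>x. (Y k x - X x)\<^sup>2 \<partial>M"
  show "norm ((\<integral>x. (Y k x)\<^sup>2 \<partial>M) - (\<integral>x. (X x)\<^sup>2 \<partial>M)) \<le>
      ?d k + 2 * (sqrt (?d k) * sqrt (\<integral>x. (X x)\<^sup>2 \<partial>M))" for k
  proof -
    have cs: "integrable M (\<lambda>x. (Y k x - X x) * X x)"
      "(\<integral>x. \<bar>(Y k x - X x) * X x\<bar> \<partial>M) \<le> sqrt (?d k) * sqrt (\<integral>x. (X x)\<^sup>2 \<partial>M)"
      by (rule integral_Cauchy_Schwarz; use L2(1) X2 in simp)+
    have "(Y k x)\<^sup>2 = (Y k x - X x)\<^sup>2 + 2 * ((Y k x - X x) * X x) + (X x)\<^sup>2" for x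
      by algebra
    then have "(\<integral>x. (Y k x)\<^sup>2 \<partial>M) - (\<integral>x. (X x)\<^sup>2 \<partial>M) = ?d k + 2 * (\<integral>x. (Y k x - X x) * X x \<partial>M)"
      using L2(1) X2 cs(1) by simp
    moreover have "\<bar>\<integral>x. (Y k x - X x) * X x \<partial>M\<bar> \<le> (\<integral>x. \<bar>(Y k x - X x) * X x\<bar> \<partial>M)"
      by (rule integral_abs_bound)
    moreover have "0 \<le> ?d k" by simp
    ultimately show ?thesis using cs(2) unfolding real_norm_def abs_le_iff by linarith
  qed
  have "(\<lambda>k. ?d k + 2 * (sqrt (?d k) * sqrt (\<integral>x. (X x)\<^sup>2 \<partial>M))) \<longlonglongrightarrow>
      0 + 2 * (sqrt 0 * sqrt (\<integral>x. (X x)\<^sup>2 \<partial>M))"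
    by (intro tendsto_intros L2(2))
  then show "(\<lambda>k. ?d k + 2 * (sqrt (?d k) * sqrt (\<integral>x. (X x)\<^sup>2 \<partial>M))) \<longlonglongrightarrow> 0" by simp
qed

text \<open>Fatou's lemma along an almost surely convergent subsequence.\<close>

lemma (in prob_space) tendsto_L2_sixth_moment:
  assumes [measurable]: "\<And>k. random_variable borel (Y k)" "random_variable borel X"
    and Y6: "\<And>k. integrable M (\<lambda>x. Y k x ^ 6)" "\<And>k. (\<integral>x. Y k x ^ 6 \<partial>M) \<le> B"
    and X2: "integrable M (\<lambda>x. (X x)\<^sup>2)" and lim: "tendsto_L2 M Y X"
  shows "integrable M (\<lambda>x. X x ^ 6)" and "(\<integral>x. X x ^ 6 \<partial>M) \<le> B"
proof -
  have Y2: "integrable M (\<lambda>x. (Y k x)\<^sup>2)" for k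
    by (rule integrable_power_of_sixth) (use Y6 in auto)
  note L2 = tendsto_L2_integral[OF assms(1,2) Y2 X2 lim]
  obtain r :: "nat \<Rightarrow> nat" where r: "AE x in M. (\<lambda>k. (Y (r k) x - X x)\<^sup>2) \<longlonglongrightarrow> 0"
    using tendsto_L1_AE_subseq[of M "\<lambda>k x. (Y k x - X x)\<^sup>2"] L2 by auto
  have B: "0 \<le> B" using order_trans[OF _ Y6(2)[of 0]] by simp
  have conv: "AE x in M. ennreal (X x ^ 6) = liminf (\<lambda>k. ennreal (Y (r k) x ^ 6))"
    using r
  proof eventually_elim
    case (elim x)
    then have "(\<lambda>k. sqrt ((Y (r k) x - X x)\<^sup>2)) \<longlonglongrightarrow> sqrt 0" by (rule tendsto_real_sqrt)
    then have "(\<lambda>k. Y (r k) x - X x) \<longlonglongrightarrow> 0" by (simp add: tendsto_rabs_zero_iff)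
    then have "(\<lambda>k. Y (r k) x) \<longlonglongrightarrow> X x" by (rule LIM_zero_cancel)
    then have "(\<lambda>k. ennreal (Y (r k) x ^ 6)) \<longlonglongrightarrow> ennreal (X x ^ 6)"
      by (intro tendsto_ennrealI tendsto_power)
    then show ?case by (rule lim_imp_Liminf[OF trivial_limit_sequentially, symmetric])
  qed
  have "(\<integral>\<^sup>+x. ennreal (X x ^ 6) \<partial>M) = (\<integral>\<^sup>+x. liminf (\<lambda>k. ennreal (Y (r k) x ^ 6)) \<partial>M)"
    using conv by (rule nn_integral_cong_AE)
  also have "\<dots> \<le> liminf (\<lambda>k. \<integral>\<^sup>+x. ennreal (Y (r k) x ^ 6) \<partial>M)"
    by (rule nn_integral_liminf) measurable
  also have "\<dots> \<le> liminf (\<lambda>k. ennreal B)"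
    using Y6 by (intro Liminf_mono always_eventually allI)
      (simp add: nn_integral_eq_integral ennreal_leI)
  also have "\<dots> = ennreal B" by (simp add: Liminf_const)
  finally have *: "(\<integral>\<^sup>+x. ennreal (X x ^ 6) \<partial>M) \<le> ennreal B" .
  show int: "integrable M (\<lambda>x. X x ^ 6)"
  proof (rule integrableI_bounded)
    have "(\<integral>\<^sup>+x. ennreal (norm (X x ^ 6)) \<partial>M) \<le> ennreal B" using * by simp
    also have "\<dots> < \<infinity>" by simp
    finally show "(\<integral>\<^sup>+x. ennreal (norm (X x ^ 6)) \<partial>M) < \<infinity>" .
  qed measurable
  show "(\<integral>x. X x ^ 6 \<partial>M) \<le> B"
    using * B int by (simp add: nn_integral_eq_integral)
qed

text \<open>The increment of \<open>g\<close> is bounded by $|Y - X|$ times a weight of cubic growth. The weight is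
bounded in $L^2$ by the sixth moments, so the Cauchy-Schwarz inequality applies.\<close>

lemma (in prob_space) tendsto_L2_expectation:
  fixes g :: "real \<Rightarrow> 'b::euclidean_space"
  assumes [measurable]: "\<And>k. random_variable borel (Y k)" "random_variable borel X"
    and Y6: "\<And>k. integrable M (\<lambda>x. Y k x ^ 6)" "\<And>k. (\<integral>x. Y k x ^ 6 \<partial>M) \<le> B"
    and X2: "integrable M (\<lambda>x. (X x)\<^sup>2)" and lim: "tendsto_L2 M Y X"
    and [measurable]: "g \<in> borel_measurable borel"
    and g: "\<And>x y. norm (g y - g x) \<le> C * (\<bar>y - x\<bar> * (1 + \<bar>x\<bar> ^ 3 + \<bar>y\<bar> ^ 3))"
  shows "(\<lambda>k. \<integral>x. g (Y k x) \<partial>M) \<longlonglongrightarrow> (\<integral>x. g (X x) \<partial>M)"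
proof (rule LIM_zero_cancel, rule Lim_null_comparison[OF always_eventually, rule_format])
  note X6 = tendsto_L2_sixth_moment[OF assms(1,2) Y6 X2 lim]
  have Y2: "integrable M (\<lambda>x. (Y k x)\<^sup>2)" for k
    by (rule integrable_power_of_sixth) (use Y6 in auto)
  note L2 = tendsto_L2_integral[OF assms(1,2) Y2 X2 lim]
  have C: "0 \<le> C" using order_trans[OF norm_ge_zero g[of 1 0]] by simp
  have gint: "integrable M (\<lambda>x. g (Z x))"
    if [measurable]: "random_variable borel Z" and Z: "integrable M (\<lambda>x. Z x ^ 6)" for Z
  proof (rule Bochner_Integration.integrable_bound)
    show "integrable M (\<lambda>x. norm (g 0) + C * (\<bar>Z x\<bar> ^ 1 + \<bar>Z x\<bar> ^ 4))"
      by (intro Bochner_Integration.integrable_add integrable_mult_right integrable_const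
            integrable_power_of_sixth[OF _ Z]) auto
    have "norm (g z) \<le> norm (g 0) + C * (\<bar>z\<bar> ^ 1 + \<bar>z\<bar> ^ 4)" for z
    proof -
      have "norm (g z) \<le> norm (g 0) + norm (g z - g 0)" by (rule norm_triangle_sub)
      also have "norm (g z - g 0) \<le> C * (\<bar>z\<bar> * (1 + \<bar>z\<bar> ^ 3))" using g[of z 0] by simp
      also have "\<bar>z\<bar> * (1 + \<bar>z\<bar> ^ 3) = \<bar>z\<bar> ^ 1 + \<bar>z\<bar> ^ 4"
        by (simp add: algebra_simps numeral_eq_Suc)
      finally show ?thesis by simp
    qed
    then show "AE x in M. norm (g (Z x)) \<le> norm (norm (g 0) + C * (\<bar>Z x\<bar> ^ 1 + \<bar>Z x\<bar> ^ 4))"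
      by (auto intro: order_trans[OF _ abs_ge_self])
  qed measurable
  let ?d = "\<lambda>k. \<integral>x. (Y k x - X x)\<^sup>2 \<partial>M"
  define K where "K = 3 * (1 + 2 * B)"
  show "norm ((\<integral>x. g (Y k x) \<partial>M) - (\<integral>x. g (X x) \<partial>M)) \<le> C * (sqrt (?d k) * sqrt K)" for k
  proof -
    let ?w = "\<lambda>x. 1 + \<bar>X x\<bar> ^ 3 + \<bar>Y k x\<bar> ^ 3"
    have sq: "(1 + a + b)\<^sup>2 \<le> 3 * (1 + a\<^sup>2 + b\<^sup>2)" for a b :: real
    proof -
      have "3 * (1 + a\<^sup>2 + b\<^sup>2) - (1 + a + b)\<^sup>2 = (1 - a)\<^sup>2 + (1 - b)\<^sup>2 + (a - b)\<^sup>2" by algebra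
      then show ?thesis by (smt (verit) zero_le_power2)
    qed
    have w: "(?w x)\<^sup>2 \<le> 3 * (1 + X x ^ 6 + Y k x ^ 6)" for x
      using sq[of "\<bar>X x\<bar> ^ 3" "\<bar>Y k x\<bar> ^ 3"] by (simp flip: power_mult)
    have wint: "integrable M (\<lambda>x. (?w x)\<^sup>2)"
    proof (rule Bochner_Integration.integrable_bound)
      show "integrable M (\<lambda>x. 3 * (1 + X x ^ 6 + Y k x ^ 6))" using X6 Y6 by simp
      show "AE x in M. norm ((?w x)\<^sup>2) \<le> norm (3 * (1 + X x ^ 6 + Y k x ^ 6))"
        using w by (intro AE_I2) (auto intro: order_trans[OF _ abs_ge_self])
    qed measurable
    have "(\<integral>x. (?w x)\<^sup>2 \<partial>M) \<le> (\<integral>x. 3 * (1 + X x ^ 6 + Y k x ^ 6) \<partial>M)"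
      using wint X6(1) Y6(1) by (intro integral_mono w) auto
    also have "\<dots> = 3 * (1 + (\<integral>x. X x ^ 6 \<partial>M) + (\<integral>x. Y k x ^ 6 \<partial>M))"
      using X6(1) Y6(1) by (simp add: prob_space)
    also have "\<dots> \<le> K" using X6(2) Y6(2)[of k] by (simp add: K_def)
    finally have wK: "(\<integral>x. (?w x)\<^sup>2 \<partial>M) \<le> K" .
    have cs: "integrable M (\<lambda>x. (Y k x - X x) * ?w x)"
      "(\<integral>x. \<bar>(Y k x - X x) * ?w x\<bar> \<partial>M) \<le> sqrt (?d k) * sqrt (\<integral>x. (?w x)\<^sup>2 \<partial>M)"
      by (rule integral_Cauchy_Schwarz; use L2(1) wint in simp)+
    have gg: "integrable M (\<lambda>x. g (Y k x))" "integrable M (\<lambda>x. g (X x))"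
      using gint Y6(1) X6(1) by auto
    have "norm ((\<integral>x. g (Y k x) \<partial>M) - (\<integral>x. g (X x) \<partial>M)) = norm (\<integral>x. g (Y k x) - g (X x) \<partial>M)"
      using gg by simp
    also have "\<dots> \<le> (\<integral>x. norm (g (Y k x) - g (X x)) \<partial>M)" by (rule integral_norm_bound)
    also have "\<dots> \<le> (\<integral>x. C * \<bar>(Y k x - X x) * ?w x\<bar> \<partial>M)"
    proof (rule integral_mono)
      show "norm (g (Y k x) - g (X x)) \<le> C * \<bar>(Y k x - X x) * ?w x\<bar>" for x
        using g[of "Y k x" "X x"] by (simp add: abs_mult)
    qed (use gg cs(1) in auto)
    also have "\<dots> = C * (\<integral>x. \<bar>(Y k x - X x) * ?w x\<bar> \<partial>M)" by simp
    also have "\<dots> \<le> C * (sqrt (?d k) * sqrt K)"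
      using wK C by (intro mult_left_mono order_trans[OF cs(2)]) auto
    finally show ?thesis .
  qed
  have "(\<lambda>k. C * (sqrt (?d k) * sqrt K)) \<longlonglongrightarrow> C * (sqrt 0 * sqrt K)"
    by (intro tendsto_intros L2(2))
  then show "(\<lambda>k. C * (sqrt (?d k) * sqrt K)) \<longlonglongrightarrow> 0" by simp
qed

lemma power_diff_bound:
  fixes x y :: real
  assumes "1 \<le> n" "n \<le> 4"
  shows "norm (y ^ n - x ^ n) \<le> 4 * (\<bar>y - x\<bar> * (1 + \<bar>x\<bar> ^ 3 + \<bar>y\<bar> ^ 3))"
proof -
  define m where "m = max \<bar>x\<bar> \<bar>y\<bar>"
  have m: "0 \<le> m" "\<bar>x\<bar> \<le> m" "\<bar>y\<bar> \<le> m" by (auto simp: m_def)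
  obtain k where n: "n = Suc k" using assms by (cases n) auto
  have "m ^ k \<le> 1 + m ^ 3"
  proof (cases "m \<le> 1")
    case True
    then have "m ^ k \<le> 1" using m by (intro power_le_one) auto
    then show ?thesis using m by (simp add: add_increasing2)
  next
    case False
    then have "m ^ k \<le> m ^ 3" using assms n by (intro power_increasing) auto
    then show ?thesis by simp
  qed
  also have "\<dots> \<le> 1 + \<bar>x\<bar> ^ 3 + \<bar>y\<bar> ^ 3" by (auto simp: m_def max_def)
  finally have mk: "m ^ k \<le> 1 + \<bar>x\<bar> ^ 3 + \<bar>y\<bar> ^ 3" .
  have "\<bar>\<Sum>p<Suc k. x ^ p * y ^ (k - p)\<bar> \<le> (\<Sum>p<Suc k. m ^ k)"
  proof (rule order_trans[OF sum_abs sum_mono])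
    fix p assume p: "p \<in> {..<Suc k}"
    have "\<bar>x ^ p * y ^ (k - p)\<bar> \<le> m ^ p * m ^ (k - p)"
      unfolding abs_mult power_abs using m by (intro mult_mono power_mono) auto
    also have "\<dots> = m ^ k" using p by (simp flip: power_add)
    finally show "\<bar>x ^ p * y ^ (k - p)\<bar> \<le> m ^ k" .
  qed
  also have "\<dots> \<le> 4 * m ^ k" using assms n m by (simp add: mult_right_mono)
  also have "\<dots> \<le> 4 * (1 + \<bar>x\<bar> ^ 3 + \<bar>y\<bar> ^ 3)" using mk by simp
  finally have *: "\<bar>\<Sum>p<Suc k. x ^ p * y ^ (k - p)\<bar> \<le> 4 * (1 + \<bar>x\<bar> ^ 3 + \<bar>y\<bar> ^ 3)" .
  have "y ^ n - x ^ n = - (x ^ Suc k - y ^ Suc k)" by (simp add: n)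
  also have "\<dots> = (y - x) * (\<Sum>p<Suc k. x ^ p * y ^ (k - p))"
    unfolding power_diff_sumr2 by (simp add: algebra_simps)
  finally have "norm (y ^ n - x ^ n) = \<bar>y - x\<bar> * \<bar>\<Sum>p<Suc k. x ^ p * y ^ (k - p)\<bar>"
    by (simp add: abs_mult)
  also have "\<dots> \<le> \<bar>y - x\<bar> * (4 * (1 + \<bar>x\<bar> ^ 3 + \<bar>y\<bar> ^ 3))" using * by (intro mult_left_mono) auto
  finally show ?thesis by (simp add: algebra_simps)
qed

lemma iexp_diff_bound: "cmod (iexp (t * y) - iexp (t * x)) \<le> \<bar>t\<bar> * \<bar>y - x\<bar>"
proof -
  have "iexp (t * y) - iexp (t * x) = iexp (t * x) * (iexp (t * y - t * x) - 1)"
    by (simp add: algebra_simps flip: exp_add)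
  then have "cmod (iexp (t * y) - iexp (t * x)) = cmod (iexp (t * y - t * x) - 1)"
    by (simp only: norm_mult norm_exp_i_times mult_1)
  also have "\<dots> \<le> \<bar>t * y - t * x\<bar>"
    using iexp_approx1[of "t * y - t * x" 0] by simp
  finally show ?thesis by (simp add: abs_mult flip: right_diff_distrib)
qed

lemma mult_iexp_diff_bound:
  "cmod (y * iexp (t * y) - x * iexp (t * x)) \<le> (1 + 2 * \<bar>t\<bar>) * (\<bar>y - x\<bar> * (1 + \<bar>x\<bar> ^ 3 + \<bar>y\<bar> ^ 3))"
proof -
  have "y * iexp (t * y) - x * iexp (t * x) =
      (y - x) * iexp (t * y) + x * (iexp (t * y) - iexp (t * x))"
    by (simp add: algebra_simps)
  then have "cmod (y * iexp (t * y) - x * iexp (t * x)) \<le>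
      cmod ((y - x) * iexp (t * y)) + cmod (x * (iexp (t * y) - iexp (t * x)))"
    by (simp only: norm_triangle_ineq)
  also have "\<dots> = \<bar>y - x\<bar> + \<bar>x\<bar> * cmod (iexp (t * y) - iexp (t * x))"
    by (simp only: norm_mult norm_exp_i_times norm_of_real mult_1_right flip: of_real_diff)
  also have "\<dots> \<le> \<bar>y - x\<bar> + \<bar>x\<bar> * (\<bar>t\<bar> * \<bar>y - x\<bar>)"
    by (intro add_left_mono mult_left_mono iexp_diff_bound) auto
  also have "\<dots> = \<bar>y - x\<bar> * (1 + \<bar>t\<bar> * \<bar>x\<bar>)" by (simp add: algebra_simps)
  also have "\<dots> \<le> \<bar>y - x\<bar> * ((1 + 2 * \<bar>t\<bar>) * (1 + \<bar>x\<bar> ^ 3 + \<bar>y\<bar> ^ 3))"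
  proof (rule mult_left_mono)
    have "\<bar>x\<bar> \<le> 1 + \<bar>x\<bar> ^ 3"
    proof (cases "\<bar>x\<bar> \<le> 1")
      case False
      then show ?thesis using power_increasing[of 1 3 "\<bar>x\<bar>"] by simp
    qed (simp add: add_increasing2)
    then have "\<bar>x\<bar> \<le> 2 * (1 + \<bar>x\<bar> ^ 3 + \<bar>y\<bar> ^ 3)"
      by (smt (verit) zero_le_power abs_ge_zero)
    then have "\<bar>t\<bar> * \<bar>x\<bar> \<le> \<bar>t\<bar> * (2 * (1 + \<bar>x\<bar> ^ 3 + \<bar>y\<bar> ^ 3))" by (rule mult_left_mono) simp
    moreover have "1 \<le> 1 + \<bar>x\<bar> ^ 3 + \<bar>y\<bar> ^ 3" by simp
    moreover have "(1 + 2 * \<bar>t\<bar>) * w = w + \<bar>t\<bar> * (2 * w)" for w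
      by (simp add: algebra_simps)
    ultimately show "1 + \<bar>t\<bar> * \<bar>x\<bar> \<le> (1 + 2 * \<bar>t\<bar>) * (1 + \<bar>x\<bar> ^ 3 + \<bar>y\<bar> ^ 3)"
      by (metis add_mono)
  qed simp
  finally show ?thesis by (simp add: algebra_simps)
qed

section \<open>Estimates for multiple Wiener-Ito integrals\<close>

text \<open>The increments of the Wiener process, divided by their standard deviations, are
independent standard normal variables. The coefficient of a set \<open>S\<close> of intervals collects all
multi-indices with image \<open>S\<close>; multi-indices with a repeated entry have coefficient 0, so the
resulting polynomial is multilinear and homogeneous.\<close>

lemma elementary_integral_law:
  assumes W: "wiener_process M T W" and e: "elementary_data T n m t a"
  obtains c where "\<And>S. S \<subseteq> {..<m} \<Longrightarrow> card S \<noteq> n \<Longrightarrow> c S = 0"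
    and "elementary_integral W n m t a \<in> borel_measurable M"
    and "distr M borel (elementary_integral W n m t a) =
         distr (gauss_space {..<m}) borel (multilin {..<m} c)"
proof -
  interpret wiener_process M T W by fact
  have t: "strict_mono_on {..m} t" "t ` {..m} \<subseteq> T"
    and a: "\<And>i. i \<in> {..<n} \<rightarrow>\<^sub>E {..<m} \<Longrightarrow> \<not> inj_on i {..<n} \<Longrightarrow> a i = 0"
    using e by (auto simp: elementary_data_def)
  define \<sigma> where "\<sigma> i = sqrt (t (Suc i) - t i)" for i
  define \<Delta> where "\<Delta> i \<omega> = W (t (Suc i)) \<omega> - W (t i) \<omega>" for i \<omega>
  define \<xi> where "\<xi> i \<omega> = \<Delta> i \<omega> / \<sigma> i" for i \<omega>
  have tT: "t i \<in> T" "t (Suc i) \<in> T" if "i < m" for i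
    using t(2) that by auto
  have lt: "t i < t (Suc i)" if "i < m" for i
    using t(1) that by (auto simp: strict_mono_on_def)
  have \<sigma>: "\<sigma> i > 0" if "i < m" for i using lt[OF that] by (simp add: \<sigma>_def)
  have m\<Delta>: "random_variable borel (\<Delta> i)" if "i < m" for i
    unfolding \<Delta>_def using tT[OF that] measurable_W by measurable
  have m\<xi>: "random_variable borel (\<xi> i)" if "i < m" for i
    unfolding \<xi>_def using m\<Delta>[OF that] by measurable
  have law\<xi>: "distr M borel (\<xi> i) = std_normal_distribution" if i: "i < m" for i
  proof -
    have "distributed M lborel (\<Delta> i) (\<lambda>x. ennreal (normal_density 0 (\<sigma> i) x))"
      unfolding \<Delta>_def \<sigma>_def by (rule normal_increments) (use tT[OF i] lt[OF i] in auto)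
    then have "distributed M lborel (\<xi> i) std_normal_density"
      using normal_standard_normal_convert[OF \<sigma>[OF i], of "\<Delta> i" 0] by (simp add: \<xi>_def[abs_def])
    then have "distr M lborel (\<xi> i) = std_normal_distribution"
      by (rule distributed_distr_eq_density)
    moreover have "distr M borel (\<xi> i) = distr M lborel (\<xi> i)"
      by (rule distr_cong) auto
    ultimately show ?thesis by simp
  qed
  have "indep_vars (\<lambda>_. borel) \<Delta> {..<m}"
    unfolding \<Delta>_def[abs_def] by (rule indep_increments) (use t in auto)
  then have ind: "indep_vars (\<lambda>_. borel) \<xi> {..<m}"
    unfolding \<xi>_def[abs_def]
    by (rule indep_vars_compose2[where Y = "\<lambda>i y. y / \<sigma> i"]) simp
  let ?B = "PiM {..<m} (\<lambda>_. borel :: real measure)"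
  let ?\<xi> = "\<lambda>\<omega>. \<lambda>i\<in>{..<m}. \<xi> i \<omega>"
  have m\<xi>': "?\<xi> \<in> measurable M ?B"
    using m\<xi> by (intro measurable_restrict) auto
  have joint: "distr M ?B ?\<xi> = gauss_space {..<m}"
  \<comment> \<open>The characterization of independence by product laws needs a nonempty index set.\<close>
  proof (cases "m = 0")
    case False
    then have "distr M ?B ?\<xi> = PiM {..<m} (\<lambda>i. distr M borel (\<xi> i))"
      using ind m\<xi> by (subst (asm) indep_vars_iff_distr_eq_PiM') auto
    also have "\<dots> = gauss_space {..<m}"
      using law\<xi> by (intro PiM_cong) auto
    finally show ?thesis .
  next
    case True
    show ?thesis
    proof (rule measure_eqI)
      show "sets (distr M ?B ?\<xi>) = sets (gauss_space {..<m})"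
        by (simp add: True PiM_empty)
      fix A assume "A \<in> sets (distr M ?B ?\<xi>)"
      then have "A = {} \<or> A = {\<lambda>_. undefined}" by (auto simp: True PiM_empty)
      then show "emeasure (distr M ?B ?\<xi>) A = emeasure (gauss_space {..<m}) A"
      proof
        assume A: "A = {\<lambda>_. undefined}"
        have "emeasure (distr M ?B ?\<xi>) A = emeasure M (?\<xi> -` A \<inter> space M)"
          using m\<xi>' by (subst emeasure_distr) (auto simp: True PiM_empty A)
        also have "?\<xi> -` A \<inter> space M = space M" by (auto simp: True A)
        finally have "emeasure (distr M ?B ?\<xi>) A = 1" by (simp only: emeasure_space_1)
        moreover have "emeasure (gauss_space {..<m}) A = 1" by (simp add: True PiM_empty A)
        ultimately show ?thesis by (simp only:)
      qed simp
    qed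
  qed
  define c where "c S = (\<Sum>i\<in>{i \<in> {i \<in> {..<n} \<rightarrow>\<^sub>E {..<m}. inj_on i {..<n}}. i ` {..<n} = S}.
      a i * (\<Prod>s\<in>S. \<sigma> s))" for S
  have E: "elementary_integral W n m t a \<omega> = multilin {..<m} c (?\<xi> \<omega>)" for \<omega>
  proof -
    let ?P = "{..<n} \<rightarrow>\<^sub>E {..<m}"
    let ?J = "{i \<in> ?P. inj_on i {..<n}}"
    have finP: "finite ?P" by (intro finite_PiE) auto
    have "elementary_integral W n m t a \<omega> = (\<Sum>i\<in>?P. a i * (\<Prod>j<n. \<Delta> (i j) \<omega>))"
      by (simp add: elementary_integral_def \<Delta>_def)
    also have "\<dots> = (\<Sum>i\<in>?J. a i * (\<Prod>j<n. \<Delta> (i j) \<omega>))"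
      using a finP by (intro sum.mono_neutral_right) auto
    also have "\<dots> = (\<Sum>i\<in>?J. a i * (\<Prod>s\<in>i ` {..<n}. \<Delta> s \<omega>))"
      by (intro sum.cong refl) (auto simp: prod.reindex)
    also have "\<dots> = (\<Sum>S\<in>Pow {..<m}. \<Sum>i\<in>{i \<in> ?J. i ` {..<n} = S}. a i * (\<Prod>s\<in>i ` {..<n}. \<Delta> s \<omega>))"
      using finP by (intro sum.group[symmetric]) auto
    also have "\<dots> = (\<Sum>S\<in>Pow {..<m}. c S * (\<Prod>s\<in>S. ?\<xi> \<omega> s))"
    proof (rule sum.cong[OF refl])
      fix S assume S: "S \<in> Pow {..<m}"
      have "(\<Prod>s\<in>S. \<Delta> s \<omega>) = (\<Prod>s\<in>S. \<sigma> s) * (\<Prod>s\<in>S. ?\<xi> \<omega> s)"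
        unfolding prod.distrib[symmetric]
        using S \<sigma> by (intro prod.cong refl) (auto simp: \<xi>_def subset_eq less_imp_neq[THEN not_sym])
      then show "(\<Sum>i\<in>{i \<in> ?J. i ` {..<n} = S}. a i * (\<Prod>s\<in>i ` {..<n}. \<Delta> s \<omega>)) =
          c S * (\<Prod>s\<in>S. ?\<xi> \<omega> s)"
        unfolding c_def sum_distrib_right by (intro sum.cong refl) (auto simp: mult.assoc)
    qed
    finally show ?thesis by (simp add: multilin_def)
  qed
  have E': "elementary_integral W n m t a = (\<lambda>\<omega>. multilin {..<m} c (?\<xi> \<omega>))"
    using E by (rule ext)
  have sets_eq: "sets (gauss_space {..<m}) = sets ?B"
    by (intro sets_PiM_cong) auto
  have mP: "multilin {..<m} c \<in> borel_measurable ?B"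
    using all_momentsD[OF all_moments_multilin[of "{..<m}" "{..<m}" c]]
    by (simp add: measurable_cong_sets[OF sets_eq refl])
  show thesis
  proof
    show "c S = 0" if "S \<subseteq> {..<m}" "card S \<noteq> n" for S
    proof -
      have "{i \<in> {i \<in> {..<n} \<rightarrow>\<^sub>E {..<m}. inj_on i {..<n}}. i ` {..<n} = S} = {}"
        using that card_image by fastforce
      then show ?thesis unfolding c_def by (simp only: sum.empty)
    qed
    show "elementary_integral W n m t a \<in> borel_measurable M"
      unfolding E' using measurable_compose[OF m\<xi>' mP] .
    have "distr M borel (elementary_integral W n m t a) =
        distr (distr M ?B ?\<xi>) borel (multilin {..<m} c)"
      unfolding E' using m\<xi>' mP by (subst distr_distr) (auto simp: o_def)
    then show "distr M borel (elementary_integral W n m t a) =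
         distr (gauss_space {..<m}) borel (multilin {..<m} c)"
      by (simp only: joint)
  qed
qed

theorem elementary_integral_estimates:
  assumes W: "wiener_process M T W" and e: "elementary_data T n m t a" and n: "n > 0"
  defines "E \<equiv> elementary_integral W n m t a"
  shows "E \<in> borel_measurable M" and "integrable M (\<lambda>x. E x ^ k)"
    and "(\<integral>x. E x \<partial>M) = 0"
    and "(\<integral>x. E x ^ 2 \<partial>M) < s \<Longrightarrow> (\<integral>x. E x ^ 6 \<partial>M) \<le> 125 ^ n * s ^ 3"
    and "0 \<le> gamma_defect \<nu> M E"
    and "cmod ((1 - 2 * \<i> * u) * (CLINT x|M. E x * iexp (u * E x)) -
          2 * \<i> * u * \<nu> * (CLINT x|M. iexp (u * E x))) \<le> \<bar>u\<bar> * sqrt (gamma_defect \<nu> M E)"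
proof -
  obtain c where c: "\<And>S. S \<subseteq> {..<m} \<Longrightarrow> card S \<noteq> n \<Longrightarrow> c S = 0"
    and mE: "E \<in> borel_measurable M"
    and law: "distr M borel E = distr (gauss_space {..<m}) borel (multilin {..<m} c)"
    unfolding E_def using elementary_integral_law[OF W e] by metis
  let ?G = "gauss_space {..<m}" and ?P = "multilin {..<m} c"
  have mP: "all_moments ?G ?P" by (simp add: all_moments_multilin)
  note [measurable] = mE mP
  have tr: "(\<integral>x. g (E x) \<partial>M) = (\<integral>x. g (?P x) \<partial>?G)" if [measurable]: "g \<in> borel_measurable borel"
    for g :: "real \<Rightarrow> 'b::{banach, second_countable_topology}"
  proof -
    have "(\<integral>x. g (E x) \<partial>M) = (\<integral>y. g y \<partial>distr M borel E)"
      by (rule integral_distr[symmetric]) measurable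
    also have "\<dots> = (\<integral>x. g (?P x) \<partial>?G)" unfolding law by (rule integral_distr) measurable
    finally show ?thesis .
  qed
  have trp: "(\<integral>x. E x ^ k \<partial>M) = (\<integral>x. ?P x ^ k \<partial>?G)" for k
    by (rule tr) measurable
  have tr1: "(\<integral>x. E x \<partial>M) = (\<integral>x. ?P x \<partial>?G)" using trp[of 1] by simp
  have def: "gamma_defect \<nu> M E = gamma_defect \<nu> ?G ?P"
    by (simp add: gamma_defect_def trp)
  have hom: "finite {..<m}" by simp
  note est = multilin_gamma_estimate[OF hom c n]
  show "E \<in> borel_measurable M" by fact
  have "integrable (distr M borel E) (\<lambda>y. y ^ k)"
    unfolding law using all_moments_integrable_power[OF mP] by (subst integrable_distr_eq) auto
  then show "integrable M (\<lambda>x. E x ^ k)" by (subst (asm) integrable_distr_eq) auto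
  show "(\<integral>x. E x \<partial>M) = 0" unfolding tr1 using est(1) by simp
  show "(\<integral>x. E x ^ 6 \<partial>M) \<le> 125 ^ n * s ^ 3" if "(\<integral>x. E x ^ 2 \<partial>M) < s"
    using that c unfolding trp by (intro multilin_hypercontractive) auto
  show "0 \<le> gamma_defect \<nu> M E" unfolding def using est(2) by simp
  show "cmod ((1 - 2 * \<i> * u) * (CLINT x|M. E x * iexp (u * E x)) -
          2 * \<i> * u * \<nu> * (CLINT x|M. iexp (u * E x))) \<le> \<bar>u\<bar> * sqrt (gamma_defect \<nu> M E)"
    unfolding def
    using est(3) tr[of "\<lambda>y. y * iexp (u * y)"] tr[of "\<lambda>y. iexp (u * y)"] by simp
qed

text \<open>Both sides of each estimate are continuous along a sequence that converges in $L^2$ with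
bounded sixth moments, and hypercontractivity bounds the sixth moments of the elementary integrals that
approximate \<open>X\<close>.\<close>

theorem wiener_ito_integral_estimates:
  assumes W: "wiener_process M T W" and X: "has_wiener_ito_integral M T W n f X" and n: "n > 0"
  shows "X \<in> borel_measurable M" and "integrable M (\<lambda>x. X x ^ 6)"
    and "(\<integral>x. X x \<partial>M) = 0"
    and "(\<integral>x. X x ^ 2 \<partial>M) < s \<Longrightarrow> (\<integral>x. X x ^ 6 \<partial>M) \<le> 125 ^ n * s ^ 3"
    and "0 \<le> gamma_defect \<nu> M X"
    and "cmod ((1 - 2 * \<i> * u) * (CLINT x|M. X x * iexp (u * X x)) -
          2 * \<i> * u * \<nu> * (CLINT x|M. iexp (u * X x))) \<le> \<bar>u\<bar> * sqrt (gamma_defect \<nu> M X)"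
proof -
  interpret wiener_process M T W by fact
  have mX: "X \<in> borel_measurable M" and X2: "integrable M (\<lambda>x. (X x)\<^sup>2)"
    using X by (auto simp: has_wiener_ito_integral_def square_integrable_def)
  obtain m t a where e: "\<And>k. elementary_data T n (m k) (t k) (a k)"
    and lim: "tendsto_L2 M (\<lambda>k. elementary_integral W n (m k) (t k) (a k)) X"
    using X unfolding has_wiener_ito_integral_def by auto
  define Y where "Y k = elementary_integral W n (m k) (t k) (a k)" for k
  note est = elementary_integral_estimates[OF W e n, folded Y_def]
  have "(\<lambda>k. \<integral>x. (Y k x)\<^sup>2 \<partial>M) \<longlonglongrightarrow> (\<integral>x. (X x)\<^sup>2 \<partial>M)"
    using lim by (intro tendsto_L2_second_moment est mX X2) (simp add: Y_def)
  note second = this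
  have key: "\<exists>N. tendsto_L2 M (\<lambda>k. Y (k + N)) X \<and> (\<forall>k. (\<integral>x. Y (k + N) x ^ 6 \<partial>M) \<le> 125 ^ n * s ^ 3)"
    if s: "(\<integral>x. X x ^ 2 \<partial>M) < s" for s
  proof -
    have "\<forall>\<^sub>F k in sequentially. (\<integral>x. (Y k x)\<^sup>2 \<partial>M) < s"
      using second s by (rule order_tendstoD)
    then obtain N where N: "\<And>k. k \<ge> N \<Longrightarrow> (\<integral>x. (Y k x)\<^sup>2 \<partial>M) < s"
      by (auto simp: eventually_sequentially)
    have "tendsto_L2 M (\<lambda>k. Y (k + N)) X"
      using LIMSEQ_ignore_initial_segment[OF lim[unfolded tendsto_L2_def], of N]
      by (simp add: tendsto_L2_def Y_def)
    with N est(4) show ?thesis by (intro exI[of _ N]) auto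
  qed
  show "X \<in> borel_measurable M" by fact
  show "(\<integral>x. X x ^ 6 \<partial>M) \<le> 125 ^ n * s ^ 3" if s: "(\<integral>x. X x ^ 2 \<partial>M) < s"
  proof -
    obtain N where "tendsto_L2 M (\<lambda>k. Y (k + N)) X" "\<And>k. (\<integral>x. Y (k + N) x ^ 6 \<partial>M) \<le> 125 ^ n * s ^ 3"
      using key[OF s] by auto
    then show ?thesis by (intro tendsto_L2_sixth_moment(2)[OF est(1) mX est(2)] X2)
  qed
  obtain N where N: "tendsto_L2 M (\<lambda>k. Y (k + N)) X"
    "\<And>k. (\<integral>x. Y (k + N) x ^ 6 \<partial>M) \<le> 125 ^ n * ((\<integral>x. X x ^ 2 \<partial>M) + 1) ^ 3"
    using key[of "(\<integral>x. X x ^ 2 \<partial>M) + 1"] by auto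
  show "integrable M (\<lambda>x. X x ^ 6)"
    by (rule tendsto_L2_sixth_moment(1)[OF est(1) mX est(2) N(2) X2 N(1)])
  have conv: "(\<lambda>k. \<integral>x. Y (k + N) x ^ p \<partial>M) \<longlonglongrightarrow> (\<integral>x. X x ^ p \<partial>M)" if "1 \<le> p" "p \<le> 4" for p
    by (rule tendsto_L2_expectation[OF est(1) mX est(2) N(2) X2 N(1) _ power_diff_bound[OF that]])
       measurable
  have conv_e: "(\<lambda>k. CLINT x|M. iexp (u * Y (k + N) x)) \<longlonglongrightarrow> (CLINT x|M. iexp (u * X x))"
  proof (rule tendsto_L2_expectation[OF est(1) mX est(2) N(2) X2 N(1)])
    show "cmod (iexp (u * y) - iexp (u * x)) \<le> \<bar>u\<bar> * (\<bar>y - x\<bar> * (1 + \<bar>x\<bar> ^ 3 + \<bar>y\<bar> ^ 3))" for x y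
    proof (rule order_trans[OF iexp_diff_bound], rule mult_left_mono)
      show "\<bar>y - x\<bar> \<le> \<bar>y - x\<bar> * (1 + \<bar>x\<bar> ^ 3 + \<bar>y\<bar> ^ 3)"
        using mult_left_mono[of 1 "1 + \<bar>x\<bar> ^ 3 + \<bar>y\<bar> ^ 3" "\<bar>y - x\<bar>"] by simp
    qed simp
  qed measurable
  have conv_xe: "(\<lambda>k. CLINT x|M. Y (k + N) x * iexp (u * Y (k + N) x)) \<longlonglongrightarrow>
      (CLINT x|M. X x * iexp (u * X x))"
    by (rule tendsto_L2_expectation[OF est(1) mX est(2) N(2) X2 N(1) _ mult_iexp_diff_bound])
       measurable
  have conv_d: "(\<lambda>k. gamma_defect \<nu> M (Y (k + N))) \<longlonglongrightarrow> gamma_defect \<nu> M X"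
    unfolding gamma_defect_def by (intro tendsto_intros conv) auto
  show "(\<integral>x. X x \<partial>M) = 0"
    using conv[of 1] est(3) by (simp add: LIMSEQ_const_iff)
  show "0 \<le> gamma_defect \<nu> M X"
    using conv_d est(5) by (intro LIMSEQ_le_const) auto
  show "cmod ((1 - 2 * \<i> * u) * (CLINT x|M. X x * iexp (u * X x)) -
          2 * \<i> * u * \<nu> * (CLINT x|M. iexp (u * X x))) \<le> \<bar>u\<bar> * sqrt (gamma_defect \<nu> M X)"
  proof (rule LIMSEQ_le)
    show "(\<lambda>k. cmod ((1 - 2 * \<i> * u) * (CLINT x|M. Y (k + N) x * iexp (u * Y (k + N) x)) -
          2 * \<i> * u * \<nu> * (CLINT x|M. iexp (u * Y (k + N) x)))) \<longlonglongrightarrow>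
       cmod ((1 - 2 * \<i> * u) * (CLINT x|M. X x * iexp (u * X x)) -
          2 * \<i> * u * \<nu> * (CLINT x|M. iexp (u * X x)))"
      by (intro tendsto_intros conv_e conv_xe)
    show "(\<lambda>k. \<bar>u\<bar> * sqrt (gamma_defect \<nu> M (Y (k + N)))) \<longlonglongrightarrow> \<bar>u\<bar> * sqrt (gamma_defect \<nu> M X)"
      by (intro tendsto_intros conv_d)
  qed (use est(6) in auto)
qed

section \<open>The centered Gamma law and its Stein identity\<close>

definition gamma_law :: "real \<Rightarrow> real measure" where
  "gamma_law a = density lborel (\<lambda>x. ennreal (gamma_density a x))"

lemma borel_measurable_gamma_density [measurable]: "gamma_density a \<in> borel_measurable borel"
  unfolding gamma_density_def[abs_def] by measurable

lemma gamma_density_nonneg: "0 < a \<Longrightarrow> 0 \<le> gamma_density a x"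
  by (simp add: gamma_density_def Gamma_real_pos)

lemma nn_integral_gamma_density_power:
  assumes a: "0 < a"
  shows "(\<integral>\<^sup>+x. ennreal (gamma_density a x * x ^ n) \<partial>lborel) = ennreal (Gamma (a + n) / Gamma a)"
proof -
  have G: "0 < Gamma a" using a by (rule Gamma_real_pos)
  have "ennreal (gamma_density a x * x ^ n) =
      ennreal (1 / Gamma a) * ennreal (indicator {0..} x * x powr (a + n - 1) / exp x)" for x
  proof (cases "x > 0")
    case True
    then have "x powr (a + n - 1) = x powr (a - 1) * x ^ n"
      by (simp add: powr_realpow[symmetric] flip: powr_add) (simp add: algebra_simps)
    then show ?thesis using True G
      by (simp add: gamma_density_def exp_minus field_simps flip: ennreal_mult)
  next
    case False
    then show ?thesis by (cases "x = 0") (auto simp: gamma_density_def)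
  qed
  then have "(\<integral>\<^sup>+x. ennreal (gamma_density a x * x ^ n) \<partial>lborel) =
      ennreal (1 / Gamma a) * (\<integral>\<^sup>+x. ennreal (indicator {0..} x * x powr (a + n - 1) / exp x) \<partial>lborel)"
    by (simp add: nn_integral_cmult)
  also have "\<dots> = ennreal (1 / Gamma a) * ennreal (Gamma (a + n))"
    using a by (subst Gamma_conv_nn_integral_real[symmetric]) auto
  finally show ?thesis using G a Gamma_real_pos[of "a + n"] by (simp flip: ennreal_mult)
qed

lemma prob_space_gamma_law:
  assumes a: "0 < a" shows "prob_space (gamma_law a)"
proof (rule prob_spaceI)
  have "Gamma a \<noteq> 0" using Gamma_real_pos[OF a] by simp
  then have "(\<integral>\<^sup>+x. ennreal (gamma_density a x) \<partial>lborel) = 1"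
    using nn_integral_gamma_density_power[OF a, of 0] by simp
  then show "emeasure (gamma_law a) (space (gamma_law a)) = 1"
    by (simp add: gamma_law_def emeasure_density)
qed

lemma all_moments_gamma_law:
  assumes a: "0 < a" shows "all_moments (gamma_law a) (\<lambda>x. x)"
  unfolding all_moments_def
proof safe
  show "(\<lambda>x. x) \<in> borel_measurable (gamma_law a)" by (simp add: gamma_law_def)
  fix n
  have "integrable lborel (\<lambda>x. gamma_density a x * \<bar>x\<bar> ^ n)"
  proof (rule integrableI_bounded)
    have "norm (gamma_density a x * \<bar>x\<bar> ^ n) = gamma_density a x * x ^ n" for x
      using gamma_density_nonneg[OF a, of x] by (auto simp: gamma_density_def abs_mult)
    then show "(\<integral>\<^sup>+x. ennreal (norm (gamma_density a x * \<bar>x\<bar> ^ n)) \<partial>lborel) < \<infinity>"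
      by (simp add: nn_integral_gamma_density_power[OF a])
  qed measurable
  then show "integrable (gamma_law a) (\<lambda>x. \<bar>x\<bar> ^ n)"
    unfolding gamma_law_def
    by (subst integrable_density) (auto simp: gamma_density_nonneg a)
qed

text \<open>For the density $p$ of the Gamma law, $(x\,p(x))' = (a - x)\,p(x)$; the boundary term
$x^a e^{-x} F(x)$ vanishes at $0$ because $a > 0$.\<close>

lemma gamma_law_stein:
  fixes F F' :: "real \<Rightarrow> 'b::euclidean_space"
  assumes a: "0 < a" and F: "\<And>x. (F has_vector_derivative F' x) (at x)"
    and F': "continuous_on UNIV F'"
    and bF: "\<And>x. norm (F x) \<le> C * (1 + x ^ 4)"
    and bF': "\<And>x. norm (F' x) \<le> C * (1 + x ^ 4)"
  shows "(\<integral>x. (x - a) *\<^sub>R F x \<partial>gamma_law a) = (\<integral>x. x *\<^sub>R F' x \<partial>gamma_law a)"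
    and "integrable (gamma_law a) (\<lambda>x. (x - a) *\<^sub>R F x)"
    and "integrable (gamma_law a) (\<lambda>x. x *\<^sub>R F' x)"
proof -
  let ?p = "gamma_density a"
  have cF: "continuous_on UNIV F"
    using F by (meson continuous_at_imp_continuous_on has_vector_derivative_continuous)
  have [measurable]: "F \<in> borel_measurable borel" "F' \<in> borel_measurable borel"
    using cF F' by (auto intro: borel_measurable_continuous_onI)
  have "0 \<le> norm (F 0)" by simp
  also have "\<dots> \<le> C" using bF[of 0] by simp
  finally have C: "0 \<le> C" .
  interpret prob_space "gamma_law a" by (rule prob_space_gamma_law[OF a])
  have int: "integrable (gamma_law a) (\<lambda>x. (x - b) *\<^sub>R H x)"
    if [measurable]: "H \<in> borel_measurable borel" and H: "\<And>x. norm (H x) \<le> C * (1 + x ^ 4)"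
    for b and H :: "real \<Rightarrow> 'b"
  proof (rule Bochner_Integration.integrable_bound)
    show "integrable (gamma_law a) (\<lambda>x. (x - b) * (C * (1 + x ^ 4)))"
      by (intro all_moments_integrable all_moments_intros all_moments_gamma_law a
            finite_measure_axioms)
    show "AE x in gamma_law a. norm ((x - b) *\<^sub>R H x) \<le> norm ((x - b) * (C * (1 + x ^ 4)))"
      using H C by (intro AE_I2) (auto simp: abs_mult intro!: mult_left_mono)
  qed (simp add: gamma_law_def)
  show i1: "integrable (gamma_law a) (\<lambda>x. (x - a) *\<^sub>R F x)" by (intro int bF) measurable
  show i2: "integrable (gamma_law a) (\<lambda>x. x *\<^sub>R F' x)"
    using int[OF _ bF', of 0] by simp
  have i1': "integrable lborel (\<lambda>x. ?p x *\<^sub>R ((x - a) *\<^sub>R F x))"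
    using i1 unfolding gamma_law_def
    by (subst (asm) integrable_density) (auto simp: gamma_density_nonneg a)
  have i2': "integrable lborel (\<lambda>x. ?p x *\<^sub>R (x *\<^sub>R F' x))"
    using i2 unfolding gamma_law_def
    by (subst (asm) integrable_density) (auto simp: gamma_density_nonneg a)
  have G: "0 < Gamma a" using a by (rule Gamma_real_pos)
  define h where "h x = x powr a * exp (- x) / Gamma a" for x :: real
  let ?f = "\<lambda>x. ?p x *\<^sub>R (x *\<^sub>R F' x) - ?p x *\<^sub>R ((x - a) *\<^sub>R F x)"
  have dh: "(h has_real_derivative - ((x - a) * ?p x)) (at x)" "h x = x * ?p x" if x: "x > 0" for x
  proof -
    show "h x = x * ?p x" using x powr_mult_base[of x "a - 1"] by (simp add: h_def gamma_density_def)
    show "(h has_real_derivative - ((x - a) * ?p x)) (at x)"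
      unfolding h_def using x G powr_mult_base[of x "a - 1"]
      by (auto intro!: derivative_eq_intros simp: gamma_density_def field_simps)
  qed
  have hb: "norm (h x *\<^sub>R F x) \<le> h x * (C * (1 + x ^ 4))" for x
  proof -
    have "0 \<le> h x" using G by (simp add: h_def)
    then show ?thesis using bF[of x] by (simp add: mult_left_mono)
  qed
  have "(LBINT x=ereal 0..\<infinity>. ?f x) = 0 - 0"
  proof (rule interval_integral_FTC_integrable[where F = "\<lambda>x. h x *\<^sub>R F x"])
    fix x assume "ereal 0 < ereal x"
    then have x: "x > 0" by simp
    show "((\<lambda>x. h x *\<^sub>R F x) has_vector_derivative ?f x) (at x)"
      using dh(1)[OF x] F[of x]
      by (auto intro!: derivative_eq_intros simp: dh(2)[OF x] algebra_simps)
    have "continuous_on {0<..} (\<lambda>x. x powr (a - 1) * exp (- x) / Gamma a)"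
      using G by (intro continuous_intros) auto
    then have cp: "continuous_on {0<..} ?p"
      by (rule continuous_on_cong[THEN iffD1, rotated 2]) (auto simp: gamma_density_def)
    have "continuous_on {0<..} ?f"
      by (intro continuous_intros cp continuous_on_subset[OF cF] continuous_on_subset[OF F']) auto
    then show "isCont ?f x" using x by (simp add: continuous_on_eq_continuous_at)
  next
    have "set_integrable lborel UNIV ?f" using i1' i2' by (simp add: set_integrable_def)
    then show "set_integrable lborel (einterval (ereal 0) \<infinity>) ?f"
      by (rule set_integrable_subset) auto
  next
    have lim: "((\<lambda>x. h x * (C * (1 + x ^ 4))) \<longlongrightarrow> 0) (at_right 0)"
    proof -
      have "((\<lambda>x :: real. x powr a) \<longlongrightarrow> 0) (at_right 0)"
        using a by (intro tendsto_zero_powrI[where b = a] tendsto_intros)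
          (auto simp: eventually_at_right_less intro!: eventually_at_rightI[of 0 1])
      then have "((\<lambda>x. x powr a * exp (- x) / Gamma a * (C * (1 + x ^ 4))) \<longlongrightarrow>
          0 * exp (- 0) / Gamma a * (C * (1 + 0 ^ 4))) (at_right 0)"
        using G by (intro tendsto_intros) auto
      then show ?thesis by (simp add: h_def)
    qed
    have "((\<lambda>x. h x *\<^sub>R F x) \<longlongrightarrow> 0) (at_right 0)"
      by (rule Lim_null_comparison[OF always_eventually lim]) (use hb in blast)
    then show "(((\<lambda>x. h x *\<^sub>R F x) \<circ> real_of_ereal) \<longlongrightarrow> 0) (at_right (ereal 0))"
      by (simp only: ereal_tendsto_simps)
    have lim: "((\<lambda>x. h x * (C * (1 + x ^ 4))) \<longlongrightarrow> 0) at_top"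
    proof -
      have "((\<lambda>x. x powr a * exp (- x) * (1 + x ^ 4)) \<longlongrightarrow> 0) at_top" by real_asymp
      from tendsto_mult_left[OF this, of "C / Gamma a"] show ?thesis
        by (simp add: h_def mult_ac)
    qed
    have "((\<lambda>x. h x *\<^sub>R F x) \<longlongrightarrow> 0) at_top"
      by (rule Lim_null_comparison[OF always_eventually lim]) (use hb in blast)
    then show "(((\<lambda>x. h x *\<^sub>R F x) \<circ> real_of_ereal) \<longlongrightarrow> 0) (at_left \<infinity>)"
      by (simp only: ereal_tendsto_simps)
  qed simp
  then have "(\<integral>x. indicator {0<..} x *\<^sub>R ?f x \<partial>lborel) = 0"
    by (simp add: interval_lebesgue_integral_def einterval_def set_lebesgue_integral_def
          greaterThan_def)
  also have "(\<lambda>x. indicator {0<..} x *\<^sub>R ?f x) = ?f"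
    by (auto simp: fun_eq_iff gamma_density_def indicator_def)
  finally have "(\<integral>x. ?p x *\<^sub>R (x *\<^sub>R F' x) \<partial>lborel) = (\<integral>x. ?p x *\<^sub>R ((x - a) *\<^sub>R F x) \<partial>lborel)"
    using i1' i2' by (simp add: Bochner_Integration.integral_diff)
  then show "(\<integral>x. (x - a) *\<^sub>R F x \<partial>gamma_law a) = (\<integral>x. x *\<^sub>R F' x \<partial>gamma_law a)"
    unfolding gamma_law_def
    by (subst (1 2) integral_density) (auto simp: gamma_density_nonneg a)
qed

lemma centered_gamma_eq: "centered_gamma \<nu> = distr (gamma_law (\<nu> / 2)) borel (\<lambda>x. 2 * x - \<nu>)"
  by (simp add: centered_gamma_def gamma_law_def)

lemma real_distribution_centered_gamma:
  assumes "0 < \<nu>" shows "real_distribution (centered_gamma \<nu>)"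
proof -
  interpret prob_space "gamma_law (\<nu> / 2)" using assms by (intro prob_space_gamma_law) simp
  show ?thesis unfolding centered_gamma_eq
    by (intro real_distribution_distr) (simp add: gamma_law_def)
qed

lemma all_moments_centered_gamma:
  assumes "0 < \<nu>" shows "all_moments (centered_gamma \<nu>) (\<lambda>x. x)"
proof -
  interpret prob_space "gamma_law (\<nu> / 2)" using assms by (intro prob_space_gamma_law) simp
  have m: "all_moments (gamma_law (\<nu> / 2)) (\<lambda>x. 2 * x - \<nu>)"
    using assms by (intro all_moments_intros all_moments_gamma_law finite_measure_axioms) auto
  have "integrable (centered_gamma \<nu>) (\<lambda>x. \<bar>x\<bar> ^ n)" for n
    unfolding centered_gamma_eq using m
    by (subst integrable_distr_eq) (auto simp: all_moments_def)
  then show ?thesis by (auto simp: all_moments_def centered_gamma_eq)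
qed

text \<open>The identity for \<open>gamma_law\<close> after the substitution $v = 2x - \nu$. It is the limiting
case of \<open>multilin_chaos_ibp\<close>, with $2q(v + \nu)$ in the place of $\Gamma$.\<close>

lemma centered_gamma_stein:
  fixes F F' :: "real \<Rightarrow> 'b::euclidean_space"
  assumes \<nu>: "0 < \<nu>" and F: "\<And>x. (F has_vector_derivative F' x) (at x)"
    and F': "continuous_on UNIV F'"
    and bF: "\<And>x. norm (F x) \<le> C * (1 + x ^ 4)"
    and bF': "\<And>x. norm (F' x) \<le> C * (1 + x ^ 4)"
  shows "(\<integral>v. v *\<^sub>R F v \<partial>centered_gamma \<nu>) = 2 *\<^sub>R (\<integral>v. (v + \<nu>) *\<^sub>R F' v \<partial>centered_gamma \<nu>)"
proof -
  let ?a = "\<nu> / 2" and ?s = "\<lambda>x. 2 * x - \<nu>"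
  have cF: "continuous_on UNIV F"
    using F by (meson continuous_at_imp_continuous_on has_vector_derivative_continuous)
  have [measurable]: "F \<in> borel_measurable borel" "F' \<in> borel_measurable borel"
    using cF F' by (auto intro: borel_measurable_continuous_onI)
  have "0 \<le> norm (F 0)" by simp
  also have "\<dots> \<le> C" using bF[of 0] by simp
  finally have C: "0 \<le> C" .
  define D where "D = 2 * (C * (129 + 8 * \<nu> ^ 4))"
  have bound: "2 * (C * (1 + ?s x ^ 4)) \<le> D * (1 + x ^ 4)" for x
  proof -
    have "?s x ^ 4 \<le> 8 * ((2 * x) ^ 4 + (- \<nu>) ^ 4)" using power4_sum_le[of "2 * x" "- \<nu>"] by simp
    also have "\<dots> = 128 * x ^ 4 + 8 * \<nu> ^ 4" by (simp add: power_mult_distrib)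
    finally have "?s x ^ 4 \<le> 128 * x ^ 4 + 8 * \<nu> ^ 4" .
    moreover have "0 \<le> x ^ 4" "0 \<le> \<nu> ^ 4 * x ^ 4" by simp_all
    moreover have "(129 + 8 * \<nu> ^ 4) * (1 + x ^ 4) = 129 + 129 * x ^ 4 + 8 * \<nu> ^ 4 + 8 * (\<nu> ^ 4 * x ^ 4)"
      by (simp add: algebra_simps)
    ultimately have "1 + ?s x ^ 4 \<le> (129 + 8 * \<nu> ^ 4) * (1 + x ^ 4)"
      by linarith
    then show ?thesis using C unfolding D_def mult.assoc by (intro mult_left_mono) auto
  qed
  have st: "(\<integral>x. (x - ?a) *\<^sub>R F (?s x) \<partial>gamma_law ?a) =
      (\<integral>x. x *\<^sub>R (2 *\<^sub>R F' (?s x)) \<partial>gamma_law ?a)"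
  proof (rule gamma_law_stein(1)[where C = D])
    show "0 < ?a" using \<nu> by simp
    show "((\<lambda>x. F (?s x)) has_vector_derivative 2 *\<^sub>R F' (?s x)) (at x)" for x
    proof -
      have "(?s has_vector_derivative 2) (at x)"
        by (auto intro!: derivative_eq_intros)
      from vector_diff_chain_at[OF this F] show ?thesis by (simp add: o_def)
    qed
    show "continuous_on UNIV (\<lambda>x. 2 *\<^sub>R F' (?s x))"
      by (intro continuous_intros continuous_on_compose2[OF F']) auto
    show "norm (F (?s x)) \<le> D * (1 + x ^ 4)" for x
    proof -
      have "0 \<le> C * (1 + ?s x ^ 4)" using C by simp
      then show ?thesis using bF[of "?s x"] bound[of x] by linarith
    qed
    show "norm (2 *\<^sub>R F' (?s x)) \<le> D * (1 + x ^ 4)" for x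
      using bF'[of "?s x"] bound[of x] by simp
  qed
  have "(\<integral>v. v *\<^sub>R F v \<partial>centered_gamma \<nu>) = (\<integral>x. ?s x *\<^sub>R F (?s x) \<partial>gamma_law ?a)"
    unfolding centered_gamma_eq by (rule integral_distr) (simp_all add: gamma_law_def)
  also have "\<dots> = (\<integral>x. 2 *\<^sub>R ((x - ?a) *\<^sub>R F (?s x)) \<partial>gamma_law ?a)"
    by (intro Bochner_Integration.integral_cong refl) (simp add: algebra_simps)
  also have "\<dots> = 2 *\<^sub>R (\<integral>x. (x - ?a) *\<^sub>R F (?s x) \<partial>gamma_law ?a)"
    by (rule integral_scaleR_right)
  also have "(\<integral>x. (x - ?a) *\<^sub>R F (?s x) \<partial>gamma_law ?a) = (\<integral>x. (?s x + \<nu>) *\<^sub>R F' (?s x) \<partial>gamma_law ?a)"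
    unfolding st by (intro Bochner_Integration.integral_cong refl) simp
  also have "\<dots> = (\<integral>v. (v + \<nu>) *\<^sub>R F' v \<partial>centered_gamma \<nu>)"
    unfolding centered_gamma_eq by (rule integral_distr[symmetric]) (simp_all add: gamma_law_def)
  finally show ?thesis .
qed

text \<open>Stein's identity for $F(v) = v^n$ is a recursion for the moments.\<close>

lemma centered_gamma_moments:
  assumes \<nu>: "0 < \<nu>"
  shows "(\<integral>v. v ^ 3 \<partial>centered_gamma \<nu>) = 8 * \<nu>"
    and "(\<integral>v. v ^ 4 \<partial>centered_gamma \<nu>) = 12 * \<nu>\<^sup>2 + 48 * \<nu>"
proof -
  interpret real_distribution "centered_gamma \<nu>" using \<nu> by (rule real_distribution_centered_gamma)
  have i: "integrable (centered_gamma \<nu>) (\<lambda>v. v ^ n)" for n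
    by (rule all_moments_integrable_power[OF all_moments_centered_gamma[OF \<nu>]])
  have i1: "integrable (centered_gamma \<nu>) (\<lambda>v. v)" using i[of 1] by simp
  have rec: "(\<integral>v. v ^ Suc n \<partial>centered_gamma \<nu>) =
      2 * (real n * ((\<integral>v. v ^ Suc (n - 1) \<partial>centered_gamma \<nu>) + \<nu> * (\<integral>v. v ^ (n - 1) \<partial>centered_gamma \<nu>)))"
    if "n \<le> 4" for n
  proof -
    have "(\<integral>v. v *\<^sub>R v ^ n \<partial>centered_gamma \<nu>) =
        2 *\<^sub>R (\<integral>v. (v + \<nu>) *\<^sub>R (real n * v ^ (n - 1)) \<partial>centered_gamma \<nu>)"
    proof (rule centered_gamma_stein[OF \<nu> has_vector_derivative_real_power])
      show "continuous_on UNIV (\<lambda>x :: real. real n * x ^ (n - 1))"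
        by (intro continuous_intros)
      have "\<bar>x\<bar> ^ n \<le> 1 + x ^ 4" "\<bar>x\<bar> ^ (n - 1) \<le> 1 + x ^ 4" for x :: real
        using that by (intro abs_power_le_one_plus_even_power; simp)+
      then have "1 * \<bar>x\<bar> ^ n \<le> (1 + real n) * (1 + x ^ 4)"
        "real n * \<bar>x\<bar> ^ (n - 1) \<le> (1 + real n) * (1 + x ^ 4)" for x :: real
        by (intro mult_mono; simp)+
      then show "norm (x ^ n) \<le> (1 + real n) * (1 + x ^ 4)"
        "norm (real n * x ^ (n - 1)) \<le> (1 + real n) * (1 + x ^ 4)" for x :: real
        by (simp_all add: power_abs abs_mult)
    qed
    also have "(\<integral>v. (v + \<nu>) *\<^sub>R (real n * v ^ (n - 1)) \<partial>centered_gamma \<nu>) =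
        (\<integral>v. real n * (v ^ Suc (n - 1) + \<nu> * v ^ (n - 1)) \<partial>centered_gamma \<nu>)"
      by (intro Bochner_Integration.integral_cong refl) (simp add: algebra_simps)
    also have "\<dots> = real n * ((\<integral>v. v ^ Suc (n - 1) \<partial>centered_gamma \<nu>) + \<nu> * (\<integral>v. v ^ (n - 1) \<partial>centered_gamma \<nu>))"
      using i[of "Suc (n - 1)"] i[of "n - 1"]
      by (simp del: power_Suc)
    finally show ?thesis by simp
  qed
  have m1: "(\<integral>v. v \<partial>centered_gamma \<nu>) = 0" using rec[of 0] by simp
  have m2: "(\<integral>v. v ^ 2 \<partial>centered_gamma \<nu>) = 2 * \<nu>"
    using rec[of 1] prob_space m1 by (simp add: power2_eq_square)
  show m3: "(\<integral>v. v ^ 3 \<partial>centered_gamma \<nu>) = 8 * \<nu>"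
    using rec[of 2] m1 m2[unfolded numeral_2_eq_2] by (simp del: power_Suc)
  show "(\<integral>v. v ^ 4 \<partial>centered_gamma \<nu>) = 12 * \<nu>\<^sup>2 + 48 * \<nu>"
    using rec[of 3] m2 m3 by (simp del: power_Suc add: power2_eq_square)
qed

lemma centered_gamma_stein_iexp:
  assumes \<nu>: "0 < \<nu>"
  shows "(1 - 2 * \<i> * t) * (CLINT v|centered_gamma \<nu>. v * iexp (t * v)) -
          2 * \<i> * t * \<nu> * (CLINT v|centered_gamma \<nu>. iexp (t * v)) = 0"
proof -
  interpret real_distribution "centered_gamma \<nu>" using \<nu> by (rule real_distribution_centered_gamma)
  have i1: "integrable (centered_gamma \<nu>) (\<lambda>v. v)"
    by (rule all_moments_integrable[OF all_moments_centered_gamma[OF \<nu>]])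
  have ie: "integrable (centered_gamma \<nu>) (\<lambda>v. v * iexp (t * v))"
    by (rule Bochner_Integration.integrable_bound[OF i1]) (simp_all add: norm_mult)
  have e1: "integrable (centered_gamma \<nu>) (\<lambda>v. iexp (t * v))"
    by (rule integrable_const_bound[of _ 1]) auto
  have "(\<integral>v. v *\<^sub>R iexp (t * v) \<partial>centered_gamma \<nu>) =
      2 *\<^sub>R (\<integral>v. (v + \<nu>) *\<^sub>R (\<i> * t * iexp (t * v)) \<partial>centered_gamma \<nu>)"
  proof (rule centered_gamma_stein[OF \<nu> has_vector_derivative_iexp_scaled])
    show "continuous_on UNIV (\<lambda>x. \<i> * t * iexp (t * x))"
      by (intro continuous_intros)
    have "1 * 1 \<le> (1 + \<bar>t\<bar>) * (1 + x ^ 4)" "\<bar>t\<bar> * 1 \<le> (1 + \<bar>t\<bar>) * (1 + x ^ 4)" for x :: real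
      by (intro mult_mono; simp)+
    then show "cmod (iexp (t * x)) \<le> (1 + \<bar>t\<bar>) * (1 + x ^ 4)"
      "cmod (\<i> * t * iexp (t * x)) \<le> (1 + \<bar>t\<bar>) * (1 + x ^ 4)" for x
      by (simp_all add: norm_mult)
  qed
  also have "(\<integral>v. (v + \<nu>) *\<^sub>R (\<i> * t * iexp (t * v)) \<partial>centered_gamma \<nu>) =
      (CLINT v|centered_gamma \<nu>. \<i> * t * (v * iexp (t * v)) + \<i> * t * \<nu> * iexp (t * v))"
    by (intro Bochner_Integration.integral_cong refl)
       (simp add: scaleR_conv_of_real algebra_simps)
  also have "\<dots> = \<i> * t * (CLINT v|centered_gamma \<nu>. v * iexp (t * v)) +
      \<i> * t * \<nu> * (CLINT v|centered_gamma \<nu>. iexp (t * v))"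
    using ie e1 by simp
  finally show ?thesis by (simp add: scaleR_conv_of_real algebra_simps)
qed

section \<open>Stability of the differential equation for the characteristic function\<close>

text \<open>The reciprocal of the characteristic function $(e^{-it} / \sqrt{1 - 2it})^\nu$. Working with
the reciprocal, an integrating factor, avoids division by a characteristic function.\<close>

definition inverse_gamma_char :: "real \<Rightarrow> real \<Rightarrow> complex" where
  "inverse_gamma_char \<nu> t = exp (\<i> * \<nu> * t + \<nu> / 2 * Ln (1 - 2 * \<i> * t))"

lemma has_vector_derivative_inverse_gamma_char:
  "(inverse_gamma_char \<nu> has_vector_derivative
     inverse_gamma_char \<nu> t * (2 * t * \<nu> / (1 - 2 * \<i> * t))) (at t)"
proof -
  have nz: "1 - 2 * \<i> * t \<noteq> 0" by (auto simp: complex_eq_iff)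
  have "((\<lambda>z. exp (\<i> * \<nu> * z + \<nu> / 2 * Ln (1 - 2 * \<i> * z))) has_field_derivative
      inverse_gamma_char \<nu> t * (\<i> * \<nu> + \<nu> / 2 * (- 2 * \<i> / (1 - 2 * \<i> * t)))) (at (complex_of_real t))"
  proof -
    have "((\<lambda>z. 1 - 2 * \<i> * z) has_field_derivative - 2 * \<i>) (at (complex_of_real t))"
      by (auto intro!: derivative_eq_intros)
    moreover have "1 - 2 * \<i> * t \<notin> \<real>\<^sub>\<le>\<^sub>0"
      by (simp add: complex_nonpos_Reals_iff)
    ultimately have "((\<lambda>z. Ln (1 - 2 * \<i> * z)) has_field_derivative
        inverse (1 - 2 * \<i> * t) * (- 2 * \<i>)) (at (complex_of_real t))"
      by (intro DERIV_chain2[where f = Ln] has_field_derivative_Ln)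
    then have "((\<lambda>z. \<i> * \<nu> * z + of_real (\<nu> / 2) * Ln (1 - 2 * \<i> * z)) has_field_derivative
        \<i> * \<nu> * 1 + of_real (\<nu> / 2) * (inverse (1 - 2 * \<i> * t) * (- 2 * \<i>))) (at (complex_of_real t))"
      by (rule DERIV_add[OF DERIV_cmult[OF DERIV_ident] DERIV_cmult])
    then have "((\<lambda>z. exp (\<i> * \<nu> * z + of_real (\<nu> / 2) * Ln (1 - 2 * \<i> * z))) has_field_derivative
        exp (\<i> * \<nu> * t + of_real (\<nu> / 2) * Ln (1 - 2 * \<i> * t)) *
        (\<i> * \<nu> * 1 + of_real (\<nu> / 2) * (inverse (1 - 2 * \<i> * t) * (- 2 * \<i>)))) (at (complex_of_real t))"
      by (rule DERIV_chain2[where f = exp, OF DERIV_exp])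
    then show ?thesis
      by (simp only: inverse_gamma_char_def divide_inverse[of "- 2 * \<i>"] mult_1_right
            mult.commute[of "inverse _" "- 2 * \<i>"] of_real_divide of_real_numeral)
  qed
  also have "\<i> * \<nu> + \<nu> / 2 * (- 2 * \<i> / (1 - 2 * \<i> * t)) = 2 * t * \<nu> / (1 - 2 * \<i> * t)"
    using nz by (simp add: field_simps)
  finally have "((\<lambda>z. exp (\<i> * \<nu> * z + \<nu> / 2 * Ln (1 - 2 * \<i> * z))) has_field_derivative
      inverse_gamma_char \<nu> t * (2 * t * \<nu> / (1 - 2 * \<i> * t))) (at (complex_of_real t))" .
  from has_vector_derivative_real_field[OF this] show ?thesis
    by (simp add: inverse_gamma_char_def[abs_def])
qed

lemma has_vector_derivative_char:
  assumes "real_distribution \<mu>" and x2: "integrable \<mu> (\<lambda>x. x\<^sup>2)"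
  shows "(char \<mu> has_vector_derivative \<i> * (CLINT x|\<mu>. x * iexp (t * x))) (at t)"
proof -
  interpret real_distribution \<mu> by fact
  have x1: "integrable \<mu> (\<lambda>x. x)"
  proof (rule Bochner_Integration.integrable_bound)
    show "integrable \<mu> (\<lambda>x. 1 + x\<^sup>2)" using x2 by simp
    have "\<bar>x\<bar> \<le> 1 + x\<^sup>2" for x :: real
      using sum_squares_bound[of 1 "\<bar>x\<bar>"] by simp
    then show "AE x in \<mu>. norm x \<le> norm (1 + x\<^sup>2)" by simp
  qed simp
  have e: "integrable \<mu> (\<lambda>x. iexp (s * x))" for s
    by (rule integrable_const_bound[of _ 1]) auto
  have xe: "integrable \<mu> (\<lambda>x. x * iexp (s * x))" for s
    by (rule Bochner_Integration.integrable_bound[OF x1]) (simp_all add: norm_mult)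
  let ?D = "CLINT x|\<mu>. x * iexp (t * x)" and ?K = "\<integral>x. x\<^sup>2 \<partial>\<mu>"
  have point: "cmod (iexp (s * x) - iexp (t * x) - (s - t) * (\<i> * (x * iexp (t * x)))) \<le> (s - t)\<^sup>2 * x\<^sup>2"
    for s x
  proof -
    have "iexp (s * x) - iexp (t * x) - (s - t) * (\<i> * (x * iexp (t * x))) =
        iexp (t * x) * (iexp ((s - t) * x) - (1 + \<i> * ((s - t) * x)))"
    proof -
      have "iexp (s * x) = iexp (t * x) * iexp ((s - t) * x)"
        unfolding exp_add[symmetric] by (simp add: algebra_simps)
      then show ?thesis by (simp only:) (simp add: algebra_simps)
    qed
    then have "cmod (iexp (s * x) - iexp (t * x) - (s - t) * (\<i> * (x * iexp (t * x)))) =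
        cmod (iexp ((s - t) * x) - (1 + \<i> * ((s - t) * x)))"
      by (simp only: norm_mult norm_exp_i_times mult_1)
    also have "\<dots> \<le> \<bar>(s - t) * x\<bar> ^ 2 / 2"
      using iexp_approx1[of "(s - t) * x" 1] by (simp add: numeral_2_eq_2)
    also have "\<dots> \<le> (s - t)\<^sup>2 * x\<^sup>2" by (simp add: power_mult_distrib)
    finally show ?thesis .
  qed
  have bound: "cmod ((char \<mu> s - char \<mu> t) - (s - t) *\<^sub>R (\<i> * ?D)) \<le> (s - t)\<^sup>2 * ?K" for s
  proof -
    let ?f = "\<lambda>x. iexp (s * x) - iexp (t * x) - (s - t) * (\<i> * (x * iexp (t * x)))"
    have f: "integrable \<mu> ?f"
      by (intro Bochner_Integration.integrable_diff e integrable_mult_right xe)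
    have "(char \<mu> s - char \<mu> t) - (s - t) *\<^sub>R (\<i> * ?D) = (CLINT x|\<mu>. ?f x)"
      unfolding char_def scaleR_conv_of_real
      by (simp only: Bochner_Integration.integral_diff Bochner_Integration.integrable_diff e
            integrable_mult_right xe integral_mult_right_zero)
    then have "cmod ((char \<mu> s - char \<mu> t) - (s - t) *\<^sub>R (\<i> * ?D)) = cmod (CLINT x|\<mu>. ?f x)"
      by (rule arg_cong)
    also have "\<dots> \<le> (\<integral>x. cmod (?f x) \<partial>\<mu>)" by (rule integral_norm_bound)
    also have "\<dots> \<le> (\<integral>x. (s - t)\<^sup>2 * x\<^sup>2 \<partial>\<mu>)"
      by (intro integral_mono point integrable_norm f integrable_mult_right x2)
    finally show ?thesis by simp
  qed
  show ?thesis
    unfolding has_vector_derivative_def has_derivative_iff_norm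
  proof
    show "bounded_linear (\<lambda>h. h *\<^sub>R (\<i> * ?D))" by (rule bounded_linear_scaleR_left)
    show "((\<lambda>s. norm ((char \<mu> s - char \<mu> t) - (s - t) *\<^sub>R (\<i> * ?D)) / norm (s - t)) \<longlongrightarrow> 0) (at t)"
    proof (rule Lim_null_comparison[OF always_eventually, rule_format])
      show "norm (norm ((char \<mu> s - char \<mu> t) - (s - t) *\<^sub>R (\<i> * ?D)) / norm (s - t)) \<le> \<bar>s - t\<bar> * ?K" for s
      proof (cases "s = t")
        case False
        then have p: "0 < \<bar>s - t\<bar>" by simp
        note bound[of s]
        also have "(s - t)\<^sup>2 * ?K = \<bar>s - t\<bar> * ?K * \<bar>s - t\<bar>"
          by (subst power2_abs[symmetric]) (simp only: power2_eq_square mult_ac)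
        finally have "cmod ((char \<mu> s - char \<mu> t) - (s - t) *\<^sub>R (\<i> * ?D)) / \<bar>s - t\<bar> \<le> \<bar>s - t\<bar> * ?K"
          by (simp only: pos_divide_le_eq[OF p])
        then show ?thesis by (simp only: real_norm_def abs_divide abs_norm_cancel abs_abs)
      qed simp
      have "((\<lambda>s. \<bar>s - t\<bar> * ?K) \<longlongrightarrow> \<bar>t - t\<bar> * ?K) (at t)" by (intro tendsto_intros)
      then show "((\<lambda>s. \<bar>s - t\<bar> * ?K) \<longlongrightarrow> 0) (at t)" by simp
    qed
  qed
qed

text \<open>The size of the error in Stein's identity for $F(\nu)$, tested on exponentials.\<close>

definition gamma_stein_bound :: "real \<Rightarrow> real \<Rightarrow> real measure \<Rightarrow> bool" where
  "gamma_stein_bound \<nu> \<delta> \<mu> \<longleftrightarrow> (\<forall>u. cmod ((1 - 2 * \<i> * u) * (CLINT x|\<mu>. x * iexp (u * x)) -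
          2 * \<i> * u * \<nu> * (CLINT x|\<mu>. iexp (u * x))) \<le> \<bar>u\<bar> * \<delta>)"

text \<open>Let $\varphi$ be the characteristic function and $\psi$ the integrating factor. Then
$(\varphi \psi)'(u)$ is $\psi(u) \cdot i / (1 - 2iu)$ times the error in Stein's identity, and
$\varphi \psi$ starts at $1$; the mean value inequality on the interval between $0$ and \<open>t\<close> gives the
bound. The constant does not depend on the law, which makes the estimate uniform along a sequence.\<close>

lemma char_gamma_bound:
  "\<exists>K. \<forall>\<mu> \<delta>. real_distribution \<mu> \<longrightarrow> integrable \<mu> (\<lambda>x. x\<^sup>2) \<longrightarrow>
     gamma_stein_bound \<nu> \<delta> \<mu> \<longrightarrow>
     cmod (char \<mu> t - inverse (inverse_gamma_char \<nu> t)) \<le> K * \<delta>"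
proof -
  let ?\<psi> = "inverse_gamma_char \<nu>" and ?S = "{- \<bar>t\<bar>..\<bar>t\<bar>}"
  have cont: "continuous_on UNIV ?\<psi>"
    by (intro continuous_at_imp_continuous_on ballI
          has_vector_derivative_continuous[OF has_vector_derivative_inverse_gamma_char])
  have "compact (?\<psi> ` ?S)"
    by (intro compact_continuous_image continuous_on_subset[OF cont] subset_UNIV compact_Icc)
  then have "bounded (?\<psi> ` ?S)" by (rule compact_imp_bounded)
  then obtain B where "\<forall>z\<in>?\<psi> ` ?S. cmod z \<le> B" by (auto simp only: bounded_iff)
  then have B: "cmod (?\<psi> u) \<le> B" if "u \<in> ?S" for u using that by blast
  have nz: "?\<psi> t \<noteq> 0" by (simp add: inverse_gamma_char_def)
  have "t \<in> ?S" by auto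
  from order_trans[OF norm_ge_zero B[OF this]] have B0: "0 \<le> B" .
  show ?thesis
  proof (intro exI[of _ "B * \<bar>t\<bar> * \<bar>t\<bar> / cmod (?\<psi> t)"] allI impI)
    fix \<mu> \<delta>
    assume \<mu>: "real_distribution \<mu>" and x2: "integrable \<mu> (\<lambda>x. x\<^sup>2)"
      and \<delta>': "gamma_stein_bound \<nu> \<delta> \<mu>"
    interpret real_distribution \<mu> by fact
    note \<delta> = \<delta>'[unfolded gamma_stein_bound_def]
    have \<delta>0: "0 \<le> \<delta>" using order_trans[OF norm_ge_zero \<delta>[rule_format, of 1]] by simp
    define r where "r u = (1 - 2 * \<i> * u) * (CLINT x|\<mu>. x * iexp (u * x)) -
          2 * \<i> * u * \<nu> * (CLINT x|\<mu>. iexp (u * x))" for u :: real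
    define d where "d u = ?\<psi> u * (\<i> / (1 - 2 * \<i> * u)) * r u" for u
    have der: "((\<lambda>u. char \<mu> u * ?\<psi> u) has_vector_derivative d u) (at u)" for u
    proof -
      have nz1: "1 - 2 * \<i> * u \<noteq> 0" by (auto simp: complex_eq_iff)
      have "((\<lambda>u. char \<mu> u * ?\<psi> u) has_vector_derivative
          (char \<mu> u * (?\<psi> u * (2 * complex_of_real u * complex_of_real \<nu> / (1 - 2 * \<i> * u))) +
           \<i> * (CLINT x|\<mu>. x * iexp (u * x)) * ?\<psi> u)) (at u)"
        by (intro has_vector_derivative_mult has_vector_derivative_char
              has_vector_derivative_inverse_gamma_char \<mu> x2)
      also have "char \<mu> u * (?\<psi> u * (2 * complex_of_real u * complex_of_real \<nu> / (1 - 2 * \<i> * u))) +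
           \<i> * (CLINT x|\<mu>. x * iexp (u * x)) * ?\<psi> u = d u"
        unfolding d_def r_def char_def[of \<mu>] using nz1 by (simp add: field_simps)
      finally show ?thesis .
    qed
    have dB: "cmod (d u) \<le> B * (\<bar>t\<bar> * \<delta>)" if u: "u \<in> ?S" for u
    proof -
      have "1 \<le> cmod (1 - 2 * \<i> * u)"
        using abs_Re_le_cmod[of "1 - 2 * \<i> * u"] by simp
      then have "cmod (\<i> / (1 - 2 * \<i> * u)) \<le> 1" by (simp add: norm_divide divide_le_eq)
      moreover have "cmod (r u) \<le> \<bar>t\<bar> * \<delta>"
        using \<delta>[rule_format, of u] u \<delta>0 unfolding r_def
        by (elim order_trans) (auto intro!: mult_right_mono)
      ultimately have "cmod (d u) \<le> B * 1 * (\<bar>t\<bar> * \<delta>)"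
        unfolding d_def norm_mult using B[OF u] B0 by (intro mult_mono) auto
      then show ?thesis by simp
    qed
    have "norm (char \<mu> t * ?\<psi> t - char \<mu> 0 * ?\<psi> 0) \<le> B * (\<bar>t\<bar> * \<delta>) * norm (t - 0)"
    proof (rule differentiable_bound[where S = ?S])
      show "((\<lambda>u. char \<mu> u * ?\<psi> u) has_derivative (\<lambda>h. h *\<^sub>R d u)) (at u within ?S)" for u
        using der[of u] by (simp add: has_vector_derivative_def has_derivative_at_withinI)
      show "onorm (\<lambda>h. h *\<^sub>R d u) \<le> B * (\<bar>t\<bar> * \<delta>)" if "u \<in> ?S" for u
      proof (rule onorm_le)
        fix h :: real
        have "norm (h *\<^sub>R d u) = cmod (d u) * norm h" by simp
        also have "\<dots> \<le> B * (\<bar>t\<bar> * \<delta>) * norm h" using dB[OF that] by (rule mult_right_mono) simp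
        finally show "norm (h *\<^sub>R d u) \<le> B * (\<bar>t\<bar> * \<delta>) * norm h" .
      qed
    qed auto
    then have *: "cmod (char \<mu> t * ?\<psi> t - 1) \<le> B * \<bar>t\<bar> * \<bar>t\<bar> * \<delta>"
      by (simp add: char_zero inverse_gamma_char_def mult_ac)
    have "char \<mu> t - inverse (?\<psi> t) = (char \<mu> t * ?\<psi> t - 1) / ?\<psi> t"
      using nz by (simp add: field_simps)
    then have "cmod (char \<mu> t - inverse (?\<psi> t)) = cmod (char \<mu> t * ?\<psi> t - 1) / cmod (?\<psi> t)"
      by (simp only: norm_divide)
    also have "\<dots> \<le> B * \<bar>t\<bar> * \<bar>t\<bar> * \<delta> / cmod (?\<psi> t)"
      using * by (intro divide_right_mono) auto
    finally show "cmod (char \<mu> t - inverse (?\<psi> t)) \<le> B * \<bar>t\<bar> * \<bar>t\<bar> / cmod (?\<psi> t) * \<delta>" by simp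
  qed
qed

lemma char_centered_gamma:
  assumes \<nu>: "0 < \<nu>"
  shows "char (centered_gamma \<nu>) t = inverse (inverse_gamma_char \<nu> t)"
proof -
  obtain K where K: "\<forall>\<mu> \<delta>. real_distribution \<mu> \<longrightarrow> integrable \<mu> (\<lambda>x. x\<^sup>2) \<longrightarrow>
     gamma_stein_bound \<nu> \<delta> \<mu> \<longrightarrow>
     cmod (char \<mu> t - inverse (inverse_gamma_char \<nu> t)) \<le> K * \<delta>"
    using char_gamma_bound by blast
  have "gamma_stein_bound \<nu> 0 (centered_gamma \<nu>)"
    unfolding gamma_stein_bound_def centered_gamma_stein_iexp[OF \<nu>] by simp
  then have "cmod (char (centered_gamma \<nu>) t - inverse (inverse_gamma_char \<nu> t)) \<le> K * 0"
    using \<nu> by (intro K[rule_format] real_distribution_centered_gamma all_moments_integrable_power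
        all_moments_centered_gamma)
  then show ?thesis by simp
qed

text \<open>Levy's continuity theorem turns the pointwise estimate into weak convergence.\<close>

theorem gamma_limit_criterion:
  assumes \<nu>: "0 < \<nu>" and \<mu>: "\<And>k. real_distribution (\<mu> k)"
    and x2: "\<And>k. integrable (\<mu> k) (\<lambda>x. x\<^sup>2)"
    and stein: "\<And>k. gamma_stein_bound \<nu> (\<delta> k) (\<mu> k)"
    and \<delta>: "\<delta> \<longlonglongrightarrow> 0"
  shows "weak_conv_m \<mu> (centered_gamma \<nu>)"
proof (rule levy_continuity[OF \<mu> real_distribution_centered_gamma[OF \<nu>]])
  fix t
  obtain K where "\<forall>\<mu> \<delta>. real_distribution \<mu> \<longrightarrow> integrable \<mu> (\<lambda>x. x\<^sup>2) \<longrightarrow>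
     gamma_stein_bound \<nu> \<delta> \<mu> \<longrightarrow>
     cmod (char \<mu> t - inverse (inverse_gamma_char \<nu> t)) \<le> K * \<delta>"
    using char_gamma_bound by blast
  then have K: "cmod (char (\<mu> k) t - inverse (inverse_gamma_char \<nu> t)) \<le> K * \<delta> k" for k
    using \<mu> x2 stein by simp
  have "(\<lambda>k. K * \<delta> k) \<longlonglongrightarrow> K * 0" by (intro tendsto_intros \<delta>)
  then have lim: "(\<lambda>k. K * \<delta> k) \<longlonglongrightarrow> 0" by (simp only: mult_zero_right)
  have "(\<lambda>k. char (\<mu> k) t - inverse (inverse_gamma_char \<nu> t)) \<longlonglongrightarrow> 0"
    by (rule Lim_null_comparison[OF always_eventually[OF allI[OF K]] lim])
  then show "(\<lambda>k. char (\<mu> k) t) \<longlonglongrightarrow> char (centered_gamma \<nu>) t"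
    unfolding char_centered_gamma[OF \<nu>] by (rule LIM_zero_cancel)
qed

section \<open>Moments under weak convergence\<close>

text \<open>The truncated power is bounded and continuous, and truncation at level \<open>R\<close> changes an $n$-th
moment with $n \le 4$ by at most $2/R^2$ times the sixth moment.\<close>

lemma weak_conv_moments:
  assumes \<mu>: "\<And>k. real_distribution (\<mu> k)" "real_distribution L" and conv: "weak_conv_m \<mu> L"
    and \<mu>6: "\<And>k. integrable (\<mu> k) (\<lambda>x. x ^ 6)" "\<And>k. (\<integral>x. x ^ 6 \<partial>\<mu> k) \<le> B"
    and L6: "integrable L (\<lambda>x. x ^ 6)" and n: "n \<le> 4"
  shows "(\<lambda>k. \<integral>x. x ^ n \<partial>\<mu> k) \<longlonglongrightarrow> (\<integral>x. x ^ n \<partial>L)"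
proof (rule LIMSEQ_I)
  fix e :: real assume e: "0 < e"
  define b where "b = max B (\<integral>x. x ^ 6 \<partial>L)"
  have b: "0 \<le> b" by (simp add: b_def le_max_iff_disj)
  \<comment> \<open>Chosen such that the truncation error \<open>2 b / R\<^sup>2\<close> is at most \<open>e / 4\<close>.\<close>
  define R where "R = 1 + 8 * b / e"
  have R: "1 \<le> R" using b e by (simp add: R_def)
  define g where "g x = (max (- R) (min R x)) ^ n" for x :: real
  have clip: "\<bar>max (- R) (min R x)\<bar> \<le> R" for x using R by auto
  have g_le: "\<bar>g x\<bar> \<le> R ^ n" for x
    unfolding g_def power_abs using clip by (intro power_mono) auto
  have trunc: "\<bar>x ^ n - g x\<bar> \<le> 2 / R\<^sup>2 * x ^ 6" for x
  proof (cases "\<bar>x\<bar> \<le> R")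
    case True
    then have "max (- R) (min R x) = x" by auto
    then show ?thesis by (simp add: g_def)
  next
    case False
    have "R\<^sup>2 * \<bar>x\<bar> ^ n \<le> \<bar>x\<bar> ^ 2 * \<bar>x\<bar> ^ n"
      using False R by (intro mult_right_mono power_mono) auto
    also have "\<dots> = \<bar>x\<bar> ^ (2 + n)" by (rule power_add[symmetric])
    also have "\<dots> \<le> \<bar>x\<bar> ^ 6" using False R n by (intro power_increasing) auto
    finally have x: "R\<^sup>2 * \<bar>x\<bar> ^ n \<le> x ^ 6" by simp
    have "\<bar>x ^ n - g x\<bar> \<le> \<bar>x\<bar> ^ n + R ^ n"
      using g_le[of x] by (simp add: power_abs[symmetric])
    also have "\<dots> \<le> 2 * \<bar>x\<bar> ^ n" using False R by (auto intro: power_mono)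
    also have "\<dots> \<le> 2 * (x ^ 6 / R\<^sup>2)" using x R by (simp add: field_simps)
    finally show ?thesis by simp
  qed
  have g_m [measurable]: "g \<in> borel_measurable borel" unfolding g_def by measurable
  have approx: "\<bar>(\<integral>x. x ^ n \<partial>\<kappa>) - (\<integral>x. g x \<partial>\<kappa>)\<bar> \<le> e / 4"
    if \<kappa>: "real_distribution \<kappa>" and \<kappa>6: "integrable \<kappa> (\<lambda>x. x ^ 6)" "(\<integral>x. x ^ 6 \<partial>\<kappa>) \<le> b" for \<kappa>
  proof -
    interpret real_distribution \<kappa> by fact
    have i1: "integrable \<kappa> (\<lambda>x. x ^ n)"
      by (rule integrable_power_of_sixth(2)) (use \<kappa>6 n in auto)
    have i2: "integrable \<kappa> g"
      by (rule integrable_const_bound[of _ "R ^ n"]) (use g_le in auto)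
    have "\<bar>(\<integral>x. x ^ n \<partial>\<kappa>) - (\<integral>x. g x \<partial>\<kappa>)\<bar> = \<bar>\<integral>x. x ^ n - g x \<partial>\<kappa>\<bar>" using i1 i2 by simp
    also have "\<dots> \<le> (\<integral>x. \<bar>x ^ n - g x\<bar> \<partial>\<kappa>)" by (rule integral_abs_bound)
    also have "\<dots> \<le> (\<integral>x. 2 / R\<^sup>2 * x ^ 6 \<partial>\<kappa>)"
      using i1 i2 \<kappa>6(1) by (intro integral_mono trunc) auto
    also have "\<dots> = 2 / R\<^sup>2 * (\<integral>x. x ^ 6 \<partial>\<kappa>)" by simp
    also have "\<dots> \<le> 2 / R\<^sup>2 * b" using \<kappa>6(2) by (intro mult_left_mono) auto
    also have "\<dots> \<le> e / 4"
    proof -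
      have "8 * b \<le> e * R" using e by (simp add: R_def field_simps)
      also have "\<dots> \<le> e * R\<^sup>2" using R e by (simp add: power2_eq_square)
      finally show ?thesis using R by (simp add: field_simps)
    qed
    finally show ?thesis .
  qed
  have "(\<lambda>k. \<integral>x. g x \<partial>\<mu> k) \<longlonglongrightarrow> (\<integral>x. g x \<partial>L)"
  proof (rule weak_conv_imp_integral_bdd_continuous_conv[OF \<mu> conv])
    show "isCont g x" for x unfolding g_def by (intro continuous_intros)
    show "norm (g x) \<le> R ^ n" for x using g_le by simp
  qed
  then obtain N where N: "\<And>k. k \<ge> N \<Longrightarrow> norm ((\<integral>x. g x \<partial>\<mu> k) - (\<integral>x. g x \<partial>L)) < e / 4"
    using e LIMSEQ_D[of _ _ "e / 4"] by (metis divide_pos_pos zero_less_numeral)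
  show "\<exists>N. \<forall>k\<ge>N. norm ((\<integral>x. x ^ n \<partial>\<mu> k) - (\<integral>x. x ^ n \<partial>L)) < e"
  proof (intro exI[of _ N] allI impI)
    fix k assume k: "N \<le> k"
    have "\<bar>(\<integral>x. x ^ n \<partial>\<mu> k) - (\<integral>x. g x \<partial>\<mu> k)\<bar> \<le> e / 4"
      using \<mu>6(2)[of k] by (intro approx \<mu> \<mu>6) (simp add: b_def)
    moreover have "\<bar>(\<integral>x. x ^ n \<partial>L) - (\<integral>x. g x \<partial>L)\<bar> \<le> e / 4"
      by (intro approx \<mu> L6) (simp add: b_def)
    ultimately show "norm ((\<integral>x. x ^ n \<partial>\<mu> k) - (\<integral>x. x ^ n \<partial>L)) < e"
      using N[OF k] e unfolding real_norm_def by linarith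
  qed
qed

section \<open>Splitting a Gamma limit\<close>

text \<open>Hypotheses are available from index 1 on, while the definition of convergence in law
involves the whole sequence.\<close>

lemma converges_in_law_Suc:
  "converges_in_law M (\<lambda>k. X (Suc k)) L \<longleftrightarrow> converges_in_law M X L"
  unfolding converges_in_law_def weak_conv_m_def weak_conv_def
  by (simp add: filterlim_sequentially_Suc[of "\<lambda>n. cdf (distr M borel (X n)) _"])

text \<open>A fourth-moment criterion: within a fixed Wiener chaos, the vanishing of the defect in the
limit implies convergence to the centered Gamma law.\<close>

theorem wiener_ito_gamma_limit:
  assumes W: "wiener_process M T W" and \<nu>: "0 < \<nu>" and n: "n > 0"
    and X: "\<And>k. k \<ge> 1 \<Longrightarrow> has_wiener_ito_integral M T W n (f k) (X k)"
    and defect: "(\<lambda>k. gamma_defect \<nu> M (X k)) \<longlonglongrightarrow> 0"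
  shows "converges_in_law M X (centered_gamma \<nu>)"
proof -
  interpret wiener_process M T W by fact
  note est = wiener_ito_integral_estimates[OF W X n, of "Suc k" for k, simplified]
  have [measurable]: "X (Suc k) \<in> borel_measurable M" for k by (rule est(1))
  have "converges_in_law M (\<lambda>k. X (Suc k)) (centered_gamma \<nu>)"
    unfolding converges_in_law_def
  proof (rule gamma_limit_criterion[OF \<nu>])
    fix k
    show "real_distribution (distr M borel (X (Suc k)))"
      by (rule real_distribution_distr) measurable
    have "integrable M (\<lambda>x. X (Suc k) x ^ 2)"
      by (rule integrable_power_of_sixth(2)) (use est(2) in auto)
    then show "integrable (distr M borel (X (Suc k))) (\<lambda>x. x\<^sup>2)"
      by (subst integrable_distr_eq) auto
    show "gamma_stein_bound \<nu> (sqrt (gamma_defect \<nu> M (X (Suc k)))) (distr M borel (X (Suc k)))"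
      unfolding gamma_stein_bound_def
    proof
      fix u
      have "(CLINT x|distr M borel (X (Suc k)). x * iexp (u * x)) =
          (CLINT x|M. X (Suc k) x * iexp (u * X (Suc k) x))"
        by (rule integral_distr) measurable
      moreover have "(CLINT x|distr M borel (X (Suc k)). iexp (u * x)) =
          (CLINT x|M. iexp (u * X (Suc k) x))"
        by (rule integral_distr) measurable
      ultimately show "cmod ((1 - 2 * \<i> * u) * (CLINT x|distr M borel (X (Suc k)). x * iexp (u * x)) -
          2 * \<i> * u * \<nu> * (CLINT x|distr M borel (X (Suc k)). iexp (u * x))) \<le>
          \<bar>u\<bar> * sqrt (gamma_defect \<nu> M (X (Suc k)))"
        using wiener_ito_integral_estimates(6)[OF W X n, of "Suc k" u \<nu>] by (simp only:)
    qed
  next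
    have "(\<lambda>k. sqrt (gamma_defect \<nu> M (X (Suc k)))) \<longlonglongrightarrow> sqrt 0"
      by (intro tendsto_real_sqrt LIMSEQ_Suc defect)
    then show "(\<lambda>k. sqrt (gamma_defect \<nu> M (X (Suc k)))) \<longlonglongrightarrow> 0" by simp
  qed
  then show ?thesis by (simp only: converges_in_law_Suc)
qed

text \<open>The mixed moments factorize, and those containing a first power vanish. The crude bound on the
sixth moment serves only to keep it bounded along a sequence.\<close>

lemma (in prob_space) indep_centered_sum_moments:
  fixes X Y :: "'a \<Rightarrow> real"
  assumes ind: "indep_var borel X borel Y"
    and X6: "integrable M (\<lambda>x. X x ^ 6)" and Y6: "integrable M (\<lambda>x. Y x ^ 6)"
    and X0: "expectation X = 0" and Y0: "expectation Y = 0"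
  shows "expectation (\<lambda>x. (X x + Y x) ^ 3) = expectation (\<lambda>x. X x ^ 3) + expectation (\<lambda>x. Y x ^ 3)"
    and "expectation (\<lambda>x. (X x + Y x) ^ 4) = expectation (\<lambda>x. X x ^ 4) +
      6 * (expectation (\<lambda>x. X x ^ 2) * expectation (\<lambda>x. Y x ^ 2)) + expectation (\<lambda>x. Y x ^ 4)"
    and "integrable M (\<lambda>x. (X x + Y x) ^ 6)"
    and "expectation (\<lambda>x. (X x + Y x) ^ 6) \<le>
      64 * (expectation (\<lambda>x. X x ^ 6) + expectation (\<lambda>x. Y x ^ 6))"
proof -
  have [measurable]: "X \<in> borel_measurable M" "Y \<in> borel_measurable M"
    using indep_var_rv1[OF ind] indep_var_rv2[OF ind] by auto
  have Xn: "integrable M (\<lambda>x. X x ^ n)" and Yn: "integrable M (\<lambda>x. Y x ^ n)" if "n \<le> 6" for n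
    using integrable_power_of_sixth(2)[OF _ X6 that] integrable_power_of_sixth(2)[OF _ Y6 that] by auto
  have ind': "indep_var borel (\<lambda>x. X x ^ a) borel (\<lambda>x. Y x ^ b)" for a b
    using indep_var_compose[OF ind, of "\<lambda>z. z ^ a" borel "\<lambda>z. z ^ b" borel] by (simp add: o_def)
  have E: "expectation (\<lambda>x. X x ^ a * Y x ^ b) = expectation (\<lambda>x. X x ^ a) * expectation (\<lambda>x. Y x ^ b)"
    and I: "integrable M (\<lambda>x. X x ^ a * Y x ^ b)" if "a \<le> 6" "b \<le> 6" for a b
    using indep_var_lebesgue_integral[OF ind' Xn Yn] indep_var_integrable[OF ind' Xn Yn] that by auto
  have X1: "expectation (\<lambda>x. X x ^ 1) = 0" and Y1: "expectation (\<lambda>x. Y x ^ 1) = 0"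
    using X0 Y0 by simp_all
  have e3: "(a + b) ^ 3 = a ^ 3 + 3 * (a ^ 2 * b ^ 1) + 3 * (a ^ 1 * b ^ 2) + b ^ 3" for a b :: real
    by algebra
  have "expectation (\<lambda>x. (X x + Y x) ^ 3) = expectation (\<lambda>x. X x ^ 3) +
      3 * expectation (\<lambda>x. X x ^ 2 * Y x ^ 1) + 3 * expectation (\<lambda>x. X x ^ 1 * Y x ^ 2) +
      expectation (\<lambda>x. Y x ^ 3)"
    unfolding e3 using Xn[of 3] Yn[of 3] I[of 2 1] I[of 1 2]
    by (simp del: power_one_right)
  then show "expectation (\<lambda>x. (X x + Y x) ^ 3) = expectation (\<lambda>x. X x ^ 3) + expectation (\<lambda>x. Y x ^ 3)"
    using E[of 2 1] E[of 1 2] X1 Y1 by (simp del: power_one_right)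
  have e4: "(a + b) ^ 4 = a ^ 4 + 4 * (a ^ 3 * b ^ 1) + 6 * (a ^ 2 * b ^ 2) + 4 * (a ^ 1 * b ^ 3) + b ^ 4"
    for a b :: real by algebra
  have "expectation (\<lambda>x. (X x + Y x) ^ 4) = expectation (\<lambda>x. X x ^ 4) +
      4 * expectation (\<lambda>x. X x ^ 3 * Y x ^ 1) + 6 * expectation (\<lambda>x. X x ^ 2 * Y x ^ 2) +
      4 * expectation (\<lambda>x. X x ^ 1 * Y x ^ 3) + expectation (\<lambda>x. Y x ^ 4)"
    unfolding e4 using Xn[of 4] Yn[of 4] I[of 3 1] I[of 1 3] I[of 2 2]
    by (simp del: power_one_right)
  then show "expectation (\<lambda>x. (X x + Y x) ^ 4) = expectation (\<lambda>x. X x ^ 4) +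
      6 * (expectation (\<lambda>x. X x ^ 2) * expectation (\<lambda>x. Y x ^ 2)) + expectation (\<lambda>x. Y x ^ 4)"
    using E[of 3 1] E[of 1 3] E[of 2 2] X1 Y1 by (simp del: power_one_right)
  have p6: "(a + b) ^ 6 \<le> 64 * (a ^ 6 + b ^ 6)" for a b :: real
  proof -
    have "(a + b) ^ 6 = \<bar>a + b\<bar> ^ 6" by simp
    also have "\<dots> \<le> (2 * max \<bar>a\<bar> \<bar>b\<bar>) ^ 6" by (intro power_mono) auto
    also have "\<dots> = 64 * max \<bar>a\<bar> \<bar>b\<bar> ^ 6" by (simp add: power_mult_distrib)
    also have "\<dots> \<le> 64 * (a ^ 6 + b ^ 6)" by (auto simp: max_def)
    finally show ?thesis .
  qed
  show I6: "integrable M (\<lambda>x. (X x + Y x) ^ 6)"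
  proof (rule Bochner_Integration.integrable_bound)
    show "integrable M (\<lambda>x. 64 * (X x ^ 6 + Y x ^ 6))" using X6 Y6 by simp
    show "AE x in M. norm ((X x + Y x) ^ 6) \<le> norm (64 * (X x ^ 6 + Y x ^ 6))"
      using p6 by (intro AE_I2) (simp del: distrib_left_numeral)
  qed measurable
  have "expectation (\<lambda>x. (X x + Y x) ^ 6) \<le> expectation (\<lambda>x. 64 * (X x ^ 6 + Y x ^ 6))"
    using X6 Y6 I6 by (intro integral_mono p6) auto
  then show "expectation (\<lambda>x. (X x + Y x) ^ 6) \<le>
      64 * (expectation (\<lambda>x. X x ^ 6) + expectation (\<lambda>x. Y x ^ 6))"
    using X6 Y6 by simp
qed

lemma wiener_ito_bounded_sixth:
  assumes W: "wiener_process M T W" and n: "n > 0"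
    and X: "\<And>k. k \<ge> 1 \<Longrightarrow> has_wiener_ito_integral M T W n (f k) (X k)"
    and conv: "(\<lambda>k. \<integral>x. (X k x)\<^sup>2 \<partial>M) \<longlonglongrightarrow> l"
  obtains B where "\<And>k. k \<ge> 1 \<Longrightarrow> (\<integral>x. X k x ^ 6 \<partial>M) \<le> B"
proof -
  have "Bseq (\<lambda>k. \<integral>x. (X k x)\<^sup>2 \<partial>M)"
    using conv by (intro convergent_imp_Bseq convergentI)
  then obtain K where "\<forall>k. norm (\<integral>x. (X k x)\<^sup>2 \<partial>M) \<le> K"
    unfolding Bseq_def by blast
  then have K: "(\<integral>x. (X k x)\<^sup>2 \<partial>M) \<le> K" for k by simp
  show thesis
  proof
    fix k :: nat assume k: "k \<ge> 1"
    have "(\<integral>x. (X k x)\<^sup>2 \<partial>M) < K + 1" using K[of k] by simp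
    then show "(\<integral>x. X k x ^ 6 \<partial>M) \<le> 125 ^ n * (K + 1) ^ 3"
      by (rule wiener_ito_integral_estimates(4)[OF W X[OF k] n])
  qed
qed

theorem theorem4:
  fixes M :: "'w measure" and T :: "real set" and W :: "real \<Rightarrow> 'w \<Rightarrow> real"
    and \<nu> \<nu>1 \<nu>2 :: real and q1 q2 :: nat
    and f h :: "nat \<Rightarrow> (nat \<Rightarrow> real) \<Rightarrow> real"
    and X Y Z :: "nat \<Rightarrow> 'w \<Rightarrow> real"
  assumes W: "wiener_process M T W"
    and nu: "\<nu> > 0" "\<nu>1 > 0" "\<nu>2 > 0" "\<nu> = \<nu>1 + \<nu>2"
    and q: "q1 \<ge> 2" "q2 \<ge> 2"
    and f_L2: "\<And>k. k \<ge> 1 \<Longrightarrow> square_integrable (time_power T q1) (f k)"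
    and h_L2: "\<And>k. k \<ge> 1 \<Longrightarrow> square_integrable (time_power T q2) (h k)"
    and f_sym: "\<And>k. k \<ge> 1 \<Longrightarrow> symmetric_kernel T q1 (f k)"
    and h_sym: "\<And>k. k \<ge> 1 \<Longrightarrow> symmetric_kernel T q2 (h k)"
    and X: "\<And>k. k \<ge> 1 \<Longrightarrow> has_wiener_ito_integral M T W q1 (f k) (X k)"
    and Y: "\<And>k. k \<ge> 1 \<Longrightarrow> has_wiener_ito_integral M T W q2 (h k) (Y k)"
    and Z: "\<And>k. k \<ge> 1 \<Longrightarrow> Z k = (\<lambda>\<omega>. X k \<omega> + Y k \<omega>)"
    and indep: "\<And>k. k \<ge> 1 \<Longrightarrow> prob_space.indep_var M borel (X k) borel (Y k)"
    and var_Z: "(\<lambda>k. prob_space.expectation M (\<lambda>\<omega>. (Z k \<omega>)\<^sup>2)) \<longlonglongrightarrow> 2 * \<nu>"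
    and var_X: "(\<lambda>k. prob_space.expectation M (\<lambda>\<omega>. (X k \<omega>)\<^sup>2)) \<longlonglongrightarrow> 2 * \<nu>1"
    and var_Y: "(\<lambda>k. prob_space.expectation M (\<lambda>\<omega>. (Y k \<omega>)\<^sup>2)) \<longlonglongrightarrow> 2 * \<nu>2"
    and conv_Z: "converges_in_law M Z (centered_gamma \<nu>)"
  shows "converges_in_law M X (centered_gamma \<nu>1) \<and> converges_in_law M Y (centered_gamma \<nu>2)"
proof -
  interpret wiener_process M T W by fact
  have q0: "q1 > 0" "q2 > 0" using q by auto
  note estX = wiener_ito_integral_estimates[OF W X q0(1)]
  note estY = wiener_ito_integral_estimates[OF W Y q0(2)]
  obtain BX where BX: "\<And>k. k \<ge> 1 \<Longrightarrow> expectation (\<lambda>x. X k x ^ 6) \<le> BX"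
    using wiener_ito_bounded_sixth[OF W q0(1) X var_X] by blast
  obtain BY where BY: "\<And>k. k \<ge> 1 \<Longrightarrow> expectation (\<lambda>x. Y k x ^ 6) \<le> BY"
    using wiener_ito_bounded_sixth[OF W q0(2) Y var_Y] by blast
  have sums: "expectation (\<lambda>x. Z k x ^ 3) = expectation (\<lambda>x. X k x ^ 3) + expectation (\<lambda>x. Y k x ^ 3)"
    "expectation (\<lambda>x. Z k x ^ 4) = expectation (\<lambda>x. X k x ^ 4) +
      6 * (expectation (\<lambda>x. X k x ^ 2) * expectation (\<lambda>x. Y k x ^ 2)) + expectation (\<lambda>x. Y k x ^ 4)"
    "integrable M (\<lambda>x. Z k x ^ 6)" "expectation (\<lambda>x. Z k x ^ 6) \<le> 64 * (BX + BY)"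
    "random_variable borel (Z k)" if k: "k \<ge> 1" for k
  proof -
    note s = indep_centered_sum_moments[OF indep[OF k] estX(2)[OF k] estY(2)[OF k]
        estX(3)[OF k] estY(3)[OF k]]
    show "expectation (\<lambda>x. Z k x ^ 3) = expectation (\<lambda>x. X k x ^ 3) + expectation (\<lambda>x. Y k x ^ 3)"
      "expectation (\<lambda>x. Z k x ^ 4) = expectation (\<lambda>x. X k x ^ 4) +
      6 * (expectation (\<lambda>x. X k x ^ 2) * expectation (\<lambda>x. Y k x ^ 2)) + expectation (\<lambda>x. Y k x ^ 4)"
      "integrable M (\<lambda>x. Z k x ^ 6)"
      unfolding Z[OF k] by (rule s(1) s(2) s(3))+
    show "expectation (\<lambda>x. Z k x ^ 6) \<le> 64 * (BX + BY)"
      unfolding Z[OF k]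
      by (rule order_trans[OF s(4)]) (intro mult_left_mono add_mono BX BY k; simp)
    show "random_variable borel (Z k)"
      unfolding Z[OF k] using estX(1)[OF k] estY(1)[OF k] by measurable
  qed
  have Z_moment: "(\<lambda>k. expectation (\<lambda>x. Z (Suc k) x ^ n)) \<longlonglongrightarrow> (\<integral>v. v ^ n \<partial>centered_gamma \<nu>)"
    if n: "n \<le> 4" for n
  proof -
    have [measurable]: "random_variable borel (Z (Suc k))" for k using sums(5)[of "Suc k"] by simp
    have tr: "(\<integral>v. v ^ p \<partial>distr M borel (Z (Suc k))) = expectation (\<lambda>x. Z (Suc k) x ^ p)" for k p
      by (rule integral_distr) measurable
    have "(\<lambda>k. \<integral>v. v ^ n \<partial>distr M borel (Z (Suc k))) \<longlonglongrightarrow> (\<integral>v. v ^ n \<partial>centered_gamma \<nu>)"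
    proof (rule weak_conv_moments[OF _ real_distribution_centered_gamma[OF nu(1)] _ _ _ _ n])
      show "real_distribution (distr M borel (Z (Suc k)))" for k
        by (rule real_distribution_distr) measurable
      show "weak_conv_m (\<lambda>k. distr M borel (Z (Suc k))) (centered_gamma \<nu>)"
        using iffD2[OF converges_in_law_Suc conv_Z] unfolding converges_in_law_def .
      show "integrable (distr M borel (Z (Suc k))) (\<lambda>v. v ^ 6)" for k
        using sums(3)[of "Suc k"] by (subst integrable_distr_eq) auto
      show "(\<integral>v. v ^ 6 \<partial>distr M borel (Z (Suc k))) \<le> 64 * (BX + BY)" for k
        unfolding tr using sums(4)[of "Suc k"] by simp
      show "integrable (centered_gamma \<nu>) (\<lambda>v. v ^ 6)"
        by (intro all_moments_integrable_power all_moments_centered_gamma nu)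
    qed
    then show ?thesis by (simp only: tr)
  qed
  have Z3: "(\<lambda>k. expectation (\<lambda>x. Z (Suc k) x ^ 3)) \<longlonglongrightarrow> 8 * \<nu>"
    using Z_moment[of 3] centered_gamma_moments(1)[OF nu(1)] by simp
  have Z4: "(\<lambda>k. expectation (\<lambda>x. Z (Suc k) x ^ 4)) \<longlonglongrightarrow> 12 * \<nu>\<^sup>2 + 48 * \<nu>"
    using Z_moment[of 4] centered_gamma_moments(2)[OF nu(1)] by simp
  let ?d1 = "\<lambda>k. gamma_defect \<nu>1 M (X (Suc k))" and ?d2 = "\<lambda>k. gamma_defect \<nu>2 M (Y (Suc k))"
  let ?m = "\<lambda>X k. expectation (\<lambda>x. (X (Suc k) x)\<^sup>2)"
  \<comment> \<open>The products of second moments enter through the fourth moment of the sum.\<close>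
  have sum_defect: "?d1 k + ?d2 k = expectation (\<lambda>x. Z (Suc k) x ^ 4) / 3 - 2 * (?m X k * ?m Y k) -
      4 * expectation (\<lambda>x. Z (Suc k) x ^ 3) + (8 - 4 * \<nu>1) * ?m X k + (8 - 4 * \<nu>2) * ?m Y k +
      4 * \<nu>1\<^sup>2 + 4 * \<nu>2\<^sup>2" for k
    using sums(1,2)[of "Suc k"] by (simp add: gamma_defect_def field_simps)
  have "(\<lambda>k. ?d1 k + ?d2 k) \<longlonglongrightarrow> (12 * \<nu>\<^sup>2 + 48 * \<nu>) / 3 - 2 * (2 * \<nu>1 * (2 * \<nu>2)) - 4 * (8 * \<nu>) +
      (8 - 4 * \<nu>1) * (2 * \<nu>1) + (8 - 4 * \<nu>2) * (2 * \<nu>2) + 4 * \<nu>1\<^sup>2 + 4 * \<nu>2\<^sup>2"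
    unfolding sum_defect
    by (intro tendsto_intros Z3 Z4 LIMSEQ_Suc[OF var_X] LIMSEQ_Suc[OF var_Y]) simp
  also have "(12 * \<nu>\<^sup>2 + 48 * \<nu>) / 3 - 2 * (2 * \<nu>1 * (2 * \<nu>2)) - 4 * (8 * \<nu>) +
      (8 - 4 * \<nu>1) * (2 * \<nu>1) + (8 - 4 * \<nu>2) * (2 * \<nu>2) + 4 * \<nu>1\<^sup>2 + 4 * \<nu>2\<^sup>2 = 0"
    unfolding nu(4) by (simp add: power2_eq_square algebra_simps)
  finally have lim: "(\<lambda>k. ?d1 k + ?d2 k) \<longlonglongrightarrow> 0" .
  have pos: "0 \<le> ?d1 k" "0 \<le> ?d2 k" for k
    using estX(5)[of "Suc k"] estY(5)[of "Suc k"] by auto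
  have d1: "?d1 \<longlonglongrightarrow> 0" and d2: "?d2 \<longlonglongrightarrow> 0"
    using pos by (auto intro!: tendsto_sandwich[OF _ _ tendsto_const lim] always_eventually)
  have "converges_in_law M X (centered_gamma \<nu>1)"
    by (rule wiener_ito_gamma_limit[OF W nu(2) q0(1) X LIMSEQ_imp_Suc[OF d1]])
  moreover have "converges_in_law M Y (centered_gamma \<nu>2)"
    by (rule wiener_ito_gamma_limit[OF W nu(3) q0(2) Y LIMSEQ_imp_Suc[OF d2]])
  ultimately show ?thesis ..
qed

end
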